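(* Let $\Lambda$ be a row-finite, locally-convex $k$-graph satisfying Condition (B), and $R$ a commutative ring with $1$. If $J$ is a regular, basic, graded ideal of $KP_R(\Lambda)$, then the $k$-graph $\Lambda\setminus H(J)$ satisfies Condition (B).
   Context: A $k$-graph $(\Lambda,d)$ is a countable category with a functor $d:\Lambda\to\mathbb{N}^k$ with unique factorization; vertices $\Lambda^0$ are degree-$0$ paths, $r,s$ range and source, $\mathbb{N}^k$ ordered coordinatewise, $e_i$ standard generators. Row-finite: finitely many paths of each degree with each range. $\Lambda^{\le n}=\{\lambda:d(\lambda)\le n,\ d(\lambda)_i<n_i\Rightarrow s(\lambda)\Lambda^{e_i}=\emptyset\}$. Locally-convex: for $i\ne j$, $\lambda\in v\Lambda^{e_i}$, $\mu\in v\Lambda^{e_j}$, $s(\lambda)\Lambda^{e_j}\ne\emptyset\ne s(\mu)\Lambda^{e_i}$. For $H\subseteq\Lambda^0$, $\Lambda\setminus H$ is the subcategory with objects $\Lambda^0\setminus H$, morphisms $\{\lambda:r(\lambda),s(\lambda)\notin H\}$, restricted degree. Boundary paths and Condition (B): for $m\in(\mathbb{N}\cup\{\infty\})^k$, $\Omega_{k,m}$ is the $k$-graph with objects $\{p\in\mathbb{N}^k:p\le m\}$, morphisms $(p,q)$, $p\le q\le m$, $r(p,q)=p$, $s(p,q)=q$, $(p,q)(q,t)=(p,t)$, $d(p,q)=q-p$. A boundary path is a degree-preserving functor $x:\Omega_{k,m}\to\Lambda$ such that if an object $p$ of $\Omega_{k,m}$ has $p\,\Omega_{k,m}^{\le e_i}=\{p\}$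 then $x(p)\Lambda^{\le e_i}=\{x(p)\}$; $r(x)=x(0)$; $v\Lambda^{\le\infty}$ denotes boundary paths with range $v$; for $s(\lambda)=r(x)$, $\lambda x$ is the concatenated boundary path. A vertex $v$ satisfies Condition (B) if some $x\in v\Lambda^{\le\infty}$ has $\alpha x\ne\beta x$ whenever $\alpha\ne\beta$ in $\Lambda$ (with $s(\alpha)=s(\beta)=v$); a $k$-graph satisfies Condition (B) if all its vertices do. $KP_R(\Lambda)$ is the universal $R$-algebra generated by $p_v$, $s_\lambda,s_{\lambda^*}$ with relations (KP1) $p_v$ mutually orthogonal idempotents; (KP2) $s_\lambda s_\mu=s_{\lambda\mu}$, $s_{\mu^*}s_{\lambda^*}=s_{(\lambda\mu)^*}$, $p_{r(\lambda)}s_\lambda=s_\lambda=s_\lambda p_{s(\lambda)}$, $p_{s(\lambda)}s_{\lambda^*}=s_{\lambda^*}=s_{\lambda^*}p_{r(\lambda)}$; (KP3) $s_{\lambda^*}s_\mu=\delta_{\lambda,\mu}p_{s(\lambda)}$ for $\lambda,\mu\in\Lambda^{\le n}$, $n\ne0$; (KP4) $p_v=\sum_{\lambda\in v\Lambda^{\le n}}s_\lambda s_{\lambda^*}$, $n\ne0$. It is $\mathbb{Z}^k$-graded by $KP_R(\Lambda)_n=\mathrm{span}\{s_\alpha s_{\beta^*}:d(\alpha)-d(\beta)=n\}$; graded ideals contain the homogeneous components of their elements; an ideal is basic if $rp_v\in I$, $r\ne0$ imply $p_v\in I$. $H(I)=\{v:p_v\in I\}$. $I^\perp=\{a:ax=xa=0\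 \forall x\in I\}$; $I$ regular if $I^{\perp\perp}=I$. *)

theory Defs
  imports "HOL-Algebra.QuotRing" "HOL-Library.Extended_Nat" "HOL-Library.Countable_Set"
begin

text \<open>A k-graph is given by its set of morphisms (paths); objects are identified with
  identity morphisms. Elements of N^k are functions nat => nat vanishing from k on.\<close>

record 'p kgraph =
  kdim :: nat
  paths :: "'p set"
  rng :: "'p \<Rightarrow> 'p"
  src :: "'p \<Rightarrow> 'p"
  cmp :: "'p \<Rightarrow> 'p \<Rightarrow> 'p"
  deg :: "'p \<Rightarrow> nat \<Rightarrow> nat"

definition Nk :: "nat \<Rightarrow> (nat \<Rightarrow> nat) set" where
  "Nk k = {n. \<forall>i\<ge>k. n i = 0}"

definition unitv :: "nat \<Rightarrow> nat \<Rightarrow> nat" where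
  "unitv i = (\<lambda>j. if j = i then 1 else 0)"

definition verts :: "'p kgraph \<Rightarrow> 'p set" where
  "verts G = {v \<in> paths G. deg G v = (\<lambda>_. 0)}"

definition is_kgraph :: "'p kgraph \<Rightarrow> bool" where
  "is_kgraph G \<longleftrightarrow>
     countable (paths G) \<and>
     (\<forall>l\<in>paths G. rng G l \<in> paths G \<and> src G l \<in> paths G \<and>
        rng G (rng G l) = rng G l \<and> src G (rng G l) = rng G l \<and>
        rng G (src G l) = src G l \<and> src G (src G l) = src G l \<and>
        cmp G (rng G l) l = l \<and> cmp G l (src G l) = l \<and> deg G l \<in> Nk (kdim G)) \<and>
     (\<forall>l\<in>paths G. \<forall>m\<in>paths G. src G l = rng G m \<longrightarrow>
        cmp G l m \<in> paths G \<and> rng G (cmp G l m) = rng G l \<and> src G (cmp G l m) = src G m \<and>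
        deg G (cmp G l m) = (\<lambda>i. deg G l i + deg G m i)) \<and>
     (\<forall>l\<in>paths G. \<forall>m\<in>paths G. \<forall>n\<in>paths G. src G l = rng G m \<and> src G m = rng G n \<longrightarrow>
        cmp G (cmp G l m) n = cmp G l (cmp G m n)) \<and>
     (\<forall>l\<in>paths G. \<forall>m\<in>Nk (kdim G). \<forall>n\<in>Nk (kdim G). deg G l = (\<lambda>i. m i + n i) \<longrightarrow>
        (\<exists>!pr. fst pr \<in> paths G \<and> snd pr \<in> paths G \<and> src G (fst pr) = rng G (snd pr) \<and>
               deg G (fst pr) = m \<and> deg G (snd pr) = n \<and> cmp G (fst pr) (snd pr) = l))"

definition le_paths :: "'p kgraph \<Rightarrow> (nat \<Rightarrow> nat) \<Rightarrow> 'p set" where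
  "le_paths G n = {l \<in> paths G. deg G l \<le> n \<and>
     (\<forall>i<kdim G. deg G l i < n i \<longrightarrow> \<not> (\<exists>m\<in>paths G. rng G m = src G l \<and> deg G m = unitv i))}"

definition row_finite :: "'p kgraph \<Rightarrow> bool" where
  "row_finite G \<longleftrightarrow> (\<forall>v\<in>verts G. \<forall>n\<in>Nk (kdim G).
      finite {l \<in> paths G. rng G l = v \<and> deg G l = n})"

definition locally_convex :: "'p kgraph \<Rightarrow> bool" where
  "locally_convex G \<longleftrightarrow> (\<forall>i<kdim G. \<forall>j<kdim G. i \<noteq> j \<longrightarrow>
     (\<forall>l\<in>paths G. \<forall>m\<in>paths G. rng G l = rng G m \<and> deg G l = unitv i \<and> deg G m = unitv j \<longrightarrow>
        (\<exists>a\<in>paths G. rng G a = src G l \<and> deg G a = unitv j) \<and>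
        (\<exists>b\<in>paths G. rng G b = src G m \<and> deg G b = unitv i)))"

definition remove_verts :: "'p kgraph \<Rightarrow> 'p set \<Rightarrow> 'p kgraph" where
  "remove_verts G H = G\<lparr>paths := {l \<in> paths G. rng G l \<notin> H \<and> src G l \<notin> H}\<rparr>"

definition le_enat :: "(nat \<Rightarrow> nat) \<Rightarrow> (nat \<Rightarrow> enat) \<Rightarrow> bool" where
  "le_enat q m \<longleftrightarrow> (\<forall>i. enat (q i) \<le> m i)"

definition Omega :: "nat \<Rightarrow> (nat \<Rightarrow> enat) \<Rightarrow> ((nat \<Rightarrow> nat) \<times> (nat \<Rightarrow> nat)) kgraph" where
  "Omega k m = \<lparr> kdim = k,
      paths = {(p, q). p \<in> Nk k \<and> p \<le> q \<and> le_enat q m},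
      rng = (\<lambda>(p, q). (p, p)),
      src = (\<lambda>(p, q). (q, q)),
      cmp = (\<lambda>(p, q) (q', t). (p, t)),
      deg = (\<lambda>(p, q). (\<lambda>i. q i - p i)) \<rparr>"

type_synonym 'p bpath = "(nat \<Rightarrow> enat) \<times> ((nat \<Rightarrow> nat) \<times> (nat \<Rightarrow> nat) \<Rightarrow> 'p)"

text \<open>A boundary path is a pair (m, x) with x a degree-preserving functor from
  \<open>\<Omega>_{k,m}\<close> to the graph (taken extensional: undefined off the morphisms of \<open>\<Omega>_{k,m}\<close>)
  satisfying the boundary condition.\<close>
definition boundary_path :: "'p kgraph \<Rightarrow> 'p bpath \<Rightarrow> bool" where
  "boundary_path G y \<longleftrightarrow> (case y of (m, x) \<Rightarrow>
     (\<forall>i\<ge>kdim G. m i = 0) \<and>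
     (\<forall>pq. pq \<notin> paths (Omega (kdim G) m) \<longrightarrow> x pq = undefined) \<and>
     (\<forall>pq\<in>paths (Omega (kdim G) m). x pq \<in> paths G \<and>
         deg G (x pq) = deg (Omega (kdim G) m) pq \<and>
         rng G (x pq) = x (rng (Omega (kdim G) m) pq) \<and>
         src G (x pq) = x (src (Omega (kdim G) m) pq)) \<and>
     (\<forall>pq\<in>paths (Omega (kdim G) m). \<forall>qt\<in>paths (Omega (kdim G) m).
         src (Omega (kdim G) m) pq = rng (Omega (kdim G) m) qt \<longrightarrow>
         x (cmp (Omega (kdim G) m) pq qt) = cmp G (x pq) (x qt)) \<and>
     (\<forall>p. (p, p) \<in> paths (Omega (kdim G) m) \<longrightarrow> (\<forall>i<kdim G.
         {l \<in> le_paths (Omega (kdim G) m) (unitv i). rng (Omega (kdim G) m) l = (p, p)} = {(p, p)}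
         \<longrightarrow> {l \<in> le_paths G (unitv i). rng G l = x (p, p)} = {x (p, p)})))"

definition bp_range :: "'p bpath \<Rightarrow> 'p" where
  "bp_range y = snd y ((\<lambda>_. 0), (\<lambda>_. 0))"

definition bp_concat :: "'p kgraph \<Rightarrow> 'p \<Rightarrow> 'p bpath \<Rightarrow> 'p bpath" where
  "bp_concat G l y = (THE z. boundary_path G z \<and>
      fst z = (\<lambda>i. enat (deg G l i) + fst y i) \<and>
      snd z ((\<lambda>_. 0), deg G l) = l \<and>
      (\<forall>p q. (p, q) \<in> paths (Omega (kdim G) (fst y)) \<longrightarrow>
         snd z ((\<lambda>i. deg G l i + p i), (\<lambda>i. deg G l i + q i)) = snd y (p, q)))"

definition condB_vertex :: "'p kgraph \<Rightarrow> 'p \<Rightarrow> bool" where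
  "condB_vertex G v \<longleftrightarrow> (\<exists>x. boundary_path G x \<and> bp_range x = v \<and>
     (\<forall>a\<in>paths G. \<forall>b\<in>paths G. src G a = v \<and> src G b = v \<and> a \<noteq> b \<longrightarrow>
        bp_concat G a x \<noteq> bp_concat G b x))"

definition condB :: "'p kgraph \<Rightarrow> bool" where
  "condB G \<longleftrightarrow> (\<forall>v\<in>verts G. condB_vertex G v)"

datatype 'p kpgen = Pv 'p | Sg 'p | Ss 'p

definition gens :: "'p kgraph \<Rightarrow> 'p kpgen set" where
  "gens G = Pv ` verts G \<union> Sg ` (paths G - verts G) \<union> Ss ` (paths G - verts G)"

text \<open>Convention \<open>s_v = s_{v^*} = p_v\<close> for vertices.\<close>
definition gw :: "'p kgraph \<Rightarrow> 'p \<Rightarrow> 'p kpgen" where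
  "gw G l = (if deg G l = (\<lambda>_. 0) then Pv l else Sg l)"

definition gws :: "'p kgraph \<Rightarrow> 'p \<Rightarrow> 'p kpgen" where
  "gws G l = (if deg G l = (\<lambda>_. 0) then Pv l else Ss l)"

definition mono :: "'g list \<Rightarrow> 'g list \<Rightarrow> 'r::comm_ring_1" where
  "mono w = (\<lambda>u. if u = w then 1 else 0)"

definition fdiff :: "('g \<Rightarrow> 'r::comm_ring_1) \<Rightarrow> ('g \<Rightarrow> 'r) \<Rightarrow> 'g \<Rightarrow> 'r" where
  "fdiff f g = (\<lambda>u. f u - g u)"

text \<open>The free unital R-algebra on the generators (finitely supported functions on words);
  its non-unital part (no constant term) is the free non-unital algebra.\<close>
definition free_alg :: "'p kgraph \<Rightarrow> ('p kpgen list \<Rightarrow> 'r::comm_ring_1) ring" where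
  "free_alg G = \<lparr> carrier = {f. finite {w. f w \<noteq> 0} \<and> (\<forall>w. f w \<noteq> 0 \<longrightarrow> set w \<subseteq> gens G)},
      mult = (\<lambda>f g w. \<Sum>i\<in>{..length w}. f (take i w) * g (drop i w)),
      one = mono [],
      zero = (\<lambda>_. 0),
      add = (\<lambda>f g w. f w + g w) \<rparr>"

definition kp_rels :: "'p kgraph \<Rightarrow> ('p kpgen list \<Rightarrow> 'r::comm_ring_1) set" where
  "kp_rels G =
     \<comment> \<open>KP1\<close>
     {fdiff (mono [Pv v, Pv w]) (if v = w then mono [Pv v] else (\<lambda>_. 0)) | v w.
        v \<in> verts G \<and> w \<in> verts G}
     \<comment> \<open>KP2\<close>
   \<union> {fdiff (mono [gw G l, gw G m]) (mono [gw G (cmp G l m)]) | l m.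
        l \<in> paths G \<and> m \<in> paths G \<and> src G l = rng G m}
   \<union> {fdiff (mono [gws G m, gws G l]) (mono [gws G (cmp G l m)]) | l m.
        l \<in> paths G \<and> m \<in> paths G \<and> src G l = rng G m}
   \<union> {fdiff (mono [Pv (rng G l), gw G l]) (mono [gw G l]) | l. l \<in> paths G}
   \<union> {fdiff (mono [gw G l, Pv (src G l)]) (mono [gw G l]) | l. l \<in> paths G}
   \<union> {fdiff (mono [Pv (src G l), gws G l]) (mono [gws G l]) | l. l \<in> paths G}
   \<union> {fdiff (mono [gws G l, Pv (rng G l)]) (mono [gws G l]) | l. l \<in> paths G}
     \<comment> \<open>KP3\<close>
   \<union> {fdiff (mono [gws G l, gw G m]) (if l = m then mono [Pv (src G l)] else (\<lambda>_. 0)) | l m n.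
        n \<in> Nk (kdim G) \<and> n \<noteq> (\<lambda>_. 0) \<and> l \<in> le_paths G n \<and> m \<in> le_paths G n}
     \<comment> \<open>KP4\<close>
   \<union> {fdiff (mono [Pv v]) (\<lambda>u. \<Sum>l\<in>{l \<in> le_paths G n. rng G l = v}. mono [gw G l, gws G l] u) | v n.
        v \<in> verts G \<and> n \<in> Nk (kdim G) \<and> n \<noteq> (\<lambda>_. 0)}"

definition kp_rel_ideal :: "'p kgraph \<Rightarrow> ('p kpgen list \<Rightarrow> 'r::comm_ring_1) set" where
  "kp_rel_ideal G = genideal (free_alg G) (kp_rels G)"

text \<open>Unitization of \<open>KP_R(\<Lambda>)\<close>, as a quotient ring; \<open>KP_R(\<Lambda>)\<close> itself is the subset \<open>KP G\<close>.\<close>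
definition KPU :: "'p kgraph \<Rightarrow> ('p kpgen list \<Rightarrow> 'r::comm_ring_1) set ring" where
  "KPU G = free_alg G Quot kp_rel_ideal G"

definition kpe :: "'p kgraph \<Rightarrow> ('p kpgen list \<Rightarrow> 'r::comm_ring_1) \<Rightarrow> ('p kpgen list \<Rightarrow> 'r) set" where
  "kpe G f = kp_rel_ideal G +>\<^bsub>free_alg G\<^esub> f"

definition KP :: "'p kgraph \<Rightarrow> ('p kpgen list \<Rightarrow> 'r::comm_ring_1) set set" where
  "KP G = {kpe G f | f. f \<in> carrier (free_alg G) \<and> f [] = 0}"

definition scal :: "'p kgraph \<Rightarrow> 'r \<Rightarrow> ('p kpgen list \<Rightarrow> 'r::comm_ring_1) set" where
  "scal G r = kpe G (\<lambda>w. if w = [] then r else 0)"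

definition pv :: "'p kgraph \<Rightarrow> 'p \<Rightarrow> ('p kpgen list \<Rightarrow> 'r::comm_ring_1) set" where
  "pv G v = kpe G (mono [Pv v])"

definition sab :: "'p kgraph \<Rightarrow> 'p \<Rightarrow> 'p \<Rightarrow> ('p kpgen list \<Rightarrow> 'r::comm_ring_1) set" where
  "sab G a b = kpe G (mono [gw G a, gws G b])"

text \<open>An ideal of \<open>KP_R(\<Lambda>)\<close> (two-sided; equivalently an ideal of the unitization contained in KP).\<close>
definition kp_ideal :: "'p kgraph \<Rightarrow> ('p kpgen list \<Rightarrow> 'r::comm_ring_1) set set \<Rightarrow> bool" where
  "kp_ideal G J \<longleftrightarrow> ideal J (KPU G) \<and> J \<subseteq> KP G"

definition H_of :: "'p kgraph \<Rightarrow> ('p kpgen list \<Rightarrow> 'r::comm_ring_1) set set \<Rightarrow> 'p set" where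
  "H_of G J = {v \<in> verts G. pv G v \<in> J}"

definition basic_ideal :: "'p kgraph \<Rightarrow> ('p kpgen list \<Rightarrow> 'r::comm_ring_1) set set \<Rightarrow> bool" where
  "basic_ideal G J \<longleftrightarrow> (\<forall>v\<in>verts G. \<forall>r::'r. r \<noteq> 0 \<and> scal G r \<otimes>\<^bsub>KPU G\<^esub> pv G v \<in> J \<longrightarrow> pv G v \<in> J)"

inductive_set rspan :: "('a, 'b) ring_scheme \<Rightarrow> ('r \<Rightarrow> 'a) \<Rightarrow> 'a set \<Rightarrow> 'a set"
  for A sc S where
  rspan_zero: "\<zero>\<^bsub>A\<^esub> \<in> rspan A sc S"
| rspan_gen: "x \<in> S \<Longrightarrow> x \<in> rspan A sc S"
| rspan_add: "x \<in> rspan A sc S \<Longrightarrow> y \<in> rspan A sc S \<Longrightarrow> x \<oplus>\<^bsub>A\<^esub> y \<in> rspan A sc S"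
| rspan_smult: "x \<in> rspan A sc S \<Longrightarrow> sc r \<otimes>\<^bsub>A\<^esub> x \<in> rspan A sc S"

definition homog :: "'p kgraph \<Rightarrow> (nat \<Rightarrow> int) \<Rightarrow> ('p kpgen list \<Rightarrow> 'r::comm_ring_1) set set" where
  "homog G n = rspan (KPU G) (scal G)
     {sab G a b | a b. a \<in> paths G \<and> b \<in> paths G \<and> (\<forall>i. int (deg G a i) - int (deg G b i) = n i)}"

definition graded_ideal :: "'p kgraph \<Rightarrow> ('p kpgen list \<Rightarrow> 'r::comm_ring_1) set set \<Rightarrow> bool" where
  "graded_ideal G J \<longleftrightarrow> (\<forall>a\<in>J. \<forall>F c. finite F \<and> (\<forall>n\<in>F. c n \<in> homog G n) \<and>
      a = finsum (KPU G) c F \<longrightarrow> (\<forall>n\<in>F. c n \<in> J))"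

definition kp_perp :: "'p kgraph \<Rightarrow> ('p kpgen list \<Rightarrow> 'r::comm_ring_1) set set \<Rightarrow> ('p kpgen list \<Rightarrow> 'r) set set" where
  "kp_perp G I = {a \<in> KP G. \<forall>x\<in>I. a \<otimes>\<^bsub>KPU G\<^esub> x = \<zero>\<^bsub>KPU G\<^esub> \<and> x \<otimes>\<^bsub>KPU G\<^esub> a = \<zero>\<^bsub>KPU G\<^esub>}"

definition regular_ideal :: "'p kgraph \<Rightarrow> ('p kpgen list \<Rightarrow> 'r::comm_ring_1) set set \<Rightarrow> bool" where
  "regular_ideal G J \<longleftrightarrow> kp_perp G (kp_perp G J) = J"

end

(*
  Write H = H(J). It is hereditary, because s_m^* p_{r(m)} s_m = p_{s(m)}. The heart is: every vertex v
  outside H has a path to some w from which H cannot be reached. Otherwise take a in the annihilator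
  of J. For l of large degree, s_l^* a is a combination of elements s_k^*, which is killed from the
  left by s_m^* whenever s(m) lies in H; such m exists by assumption. The elements s_{km}^* are
  linearly independent, as is seen by letting them act on an aperiodic boundary path at s(m), so
  s_l^* a = 0 for all such l, and p_v a = 0 by (KP4). The involution gives a p_v = 0, so p_v lies in
  the double annihilator of J, which is J.
  Given w and a path l from v to w, an aperiodic boundary path x at w never meets H, so l x is a
  boundary path of the smaller graph, and a (l x) = (a l) x shows that it is aperiodic.
*)
theory Submission
  imports Defs
begin

section \<open>k-graphs and factorization\<close>

text \<open>The computations take place in the free algebra: an element is a finitely supported
  function on words, and an equation in the quotient is membership of a difference in
  \<open>kp_rel_ideal G\<close>. A word in the generators may be arbitrarily tangled, and this
  shapes the proof: multiplying on the left by s_l^* with l in \<open>le_paths G n\<close> and n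
  large turns every word into 0 or a single ghost path s_k^*. The reason is that, for d(m) \<le> n,
  the product s_l^* s_m is s_k^* if l = m k and 0 otherwise: expand p_{s(m)} by (KP4) at degree n -
  d(m), so that each m k lies in \<open>le_paths G n\<close> and (KP3) applies. Membership in the
  ideal is derived from the relations; non-membership is detected by the action on boundary paths,
  where words become partial maps and the ideal lies in the kernel. Local convexity makes l y a
  boundary path, which the action requires; row-finiteness makes the sums in (KP4) finite.\<close>

lemma le_unitv: "d \<le> unitv i \<Longrightarrow> d = (\<lambda>_. 0) \<or> d = unitv i"
proof -
  assume d: "d \<le> unitv i"
  then have *: "d j \<le> (if j = i then 1 else 0)" for j by (simp add: le_fun_def unitv_def)
  show ?thesis
  proof (cases "d i = 0")
    case True
    then have "d j = 0" for j using *[of j] by (auto split: if_splits)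
    then show ?thesis by auto
  next
    case False
    then have "d j = unitv i j" for j using *[of j] by (auto simp: unitv_def split: if_splits)
    then show ?thesis by auto
  qed
qed

locale kgraph =
  fixes G :: "'p kgraph"
  assumes is_kgraph: "is_kgraph G"
begin

lemmas kgraph_ends = is_kgraph[unfolded is_kgraph_def, THEN conjunct2, THEN conjunct1, rule_format]
lemmas kgraph_cmp = is_kgraph[unfolded is_kgraph_def, THEN conjunct2, THEN conjunct2, THEN conjunct1, rule_format]
lemmas kgraph_assoc = is_kgraph[unfolded is_kgraph_def, THEN conjunct2, THEN conjunct2, THEN conjunct2, THEN conjunct1, rule_format]
lemmas kgraph_factor = is_kgraph[unfolded is_kgraph_def, THEN conjunct2, THEN conjunct2, THEN conjunct2, THEN conjunct2, rule_format]

lemma path_ends [simp]: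
  assumes "l \<in> paths G"
  shows "rng G l \<in> paths G" "src G l \<in> paths G"
    "rng G (rng G l) = rng G l" "src G (rng G l) = rng G l"
    "rng G (src G l) = src G l" "src G (src G l) = src G l"
    "cmp G (rng G l) l = l" "cmp G l (src G l) = l" "deg G l \<in> Nk (kdim G)"
  using kgraph_ends[OF assms] by simp_all

lemma path_cmp [simp]:
  assumes "l \<in> paths G" "m \<in> paths G" "src G l = rng G m"
  shows "cmp G l m \<in> paths G" "rng G (cmp G l m) = rng G l" "src G (cmp G l m) = src G m"
    "deg G (cmp G l m) = (\<lambda>i. deg G l i + deg G m i)"
  using kgraph_cmp[OF assms] by simp_all

lemma cmp_assoc:
  assumes "l \<in> paths G" "m \<in> paths G" "n \<in> paths G" "src G l = rng G m" "src G m = rng G n"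
  shows "cmp G (cmp G l m) n = cmp G l (cmp G m n)"
  using kgraph_assoc[OF assms(1,2,3)] assms(4,5) by simp

lemma deg_ends [simp]:
  assumes "l \<in> paths G"
  shows "deg G (rng G l) = (\<lambda>_. 0)" "deg G (src G l) = (\<lambda>_. 0)"
proof -
  have *: "deg G (rng G m) = (\<lambda>_. 0)" if "m \<in> paths G" for m
  proof -
    have "deg G m = (\<lambda>i. deg G (rng G m) i + deg G m i)"
      using path_cmp(4)[of "rng G m" m] that by simp
    from fun_cong[OF this] show ?thesis by auto
  qed
  from *[OF assms] *[of "src G l"] assms
  show "deg G (rng G l) = (\<lambda>_. 0)" "deg G (src G l) = (\<lambda>_. 0)" by simp_all
qed

lemma ends_in_verts [simp]:
  "l \<in> paths G \<Longrightarrow> rng G l \<in> verts G" "l \<in> paths G \<Longrightarrow> src G l \<in> verts G"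
  by (simp_all add: verts_def)

text \<open>A bound p \<le> d(l) already forces p to vanish outside the first k coordinates, so the
  factorization property applies to p and d(l) - p.\<close>

lemma factor_ex:
  assumes l: "l \<in> paths G" and p: "p \<le> deg G l"
  shows "\<exists>!pr. fst pr \<in> paths G \<and> snd pr \<in> paths G \<and> src G (fst pr) = rng G (snd pr) \<and>
    deg G (fst pr) = p \<and> deg G (snd pr) = (\<lambda>i. deg G l i - p i) \<and> cmp G (fst pr) (snd pr) = l"
proof -
  have "deg G l \<in> Nk (kdim G)" using l by simp
  then have nz: "deg G l i = 0" if "i \<ge> kdim G" for i using that by (simp add: Nk_def)
  have le: "p i \<le> deg G l i" for i using p by (simp add: le_fun_def)
  have "p i = 0" if "i \<ge> kdim G" for i using le[of i] nz[OF that] by simp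
  then have "p \<in> Nk (kdim G)" "(\<lambda>i. deg G l i - p i) \<in> Nk (kdim G)"
    using nz by (simp_all add: Nk_def)
  moreover have "deg G l = (\<lambda>i. p i + (deg G l i - p i))"
    using le by auto
  ultimately show ?thesis
    using kgraph_factor[OF l] by blast
qed

lemma ex1_unique: "\<exists>!x. P x \<Longrightarrow> P a \<Longrightarrow> P b \<Longrightarrow> a = b"
  by (auto simp: Ex1_def)

text \<open>Only the degrees of the left factors are compared: those of the right factors follow by
  subtraction from the degree of the common product.\<close>

lemma factor_unique:
  assumes "a \<in> paths G" "b \<in> paths G" "a' \<in> paths G" "b' \<in> paths G"
    "src G a = rng G b" "src G a' = rng G b'" "deg G a = deg G a'" "cmp G a b = cmp G a' b'"
  shows "a = a'" "b = b'"
proof -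
  define l where "l = cmp G a b"
  have l': "l = cmp G a' b'" by (simp add: l_def assms(8))
  have l: "l \<in> paths G" using path_cmp(1)[OF assms(1,2,5)] by (simp add: l_def)
  have d: "deg G l = (\<lambda>i. deg G a i + deg G b i)"
    using path_cmp(4)[OF assms(1,2,5)] by (simp add: l_def)
  have d': "deg G l = (\<lambda>i. deg G a i + deg G b' i)"
    using path_cmp(4)[OF assms(3,4,6)] by (simp add: l' assms(7))
  have "deg G a \<le> deg G l" by (simp add: d le_fun_def)
  note ex = factor_ex[OF l this]
  have db: "deg G b = (\<lambda>i. deg G l i - deg G a i)" by (simp only: d add_diff_cancel_left')
  have db': "deg G b' = (\<lambda>i. deg G l i - deg G a i)" by (simp only: d' add_diff_cancel_left')
  have "(a, b) = (a', b')"
    by (rule ex1_unique[OF ex]; unfold fst_conv snd_conv; intro conjI)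
      (fact assms db db' l_def[symmetric] l'[symmetric] refl assms(7)[symmetric])+
  then show "a = a'" "b = b'" by auto
qed

text \<open>The choice is determined by \<open>factor_ex\<close> for p \<le> d(l) and left
  unspecified otherwise; this keeps \<open>head\<close> and \<open>tail\<close> total.\<close>

definition split_at :: "'p \<Rightarrow> (nat \<Rightarrow> nat) \<Rightarrow> 'p \<times> 'p" where
  "split_at l p = (SOME pr. fst pr \<in> paths G \<and> snd pr \<in> paths G \<and> src G (fst pr) = rng G (snd pr) \<and>
    deg G (fst pr) = p \<and> deg G (snd pr) = (\<lambda>i. deg G l i - p i) \<and> cmp G (fst pr) (snd pr) = l)"

definition head :: "'p \<Rightarrow> (nat \<Rightarrow> nat) \<Rightarrow> 'p" where "head l p = fst (split_at l p)"
definition tail :: "'p \<Rightarrow> (nat \<Rightarrow> nat) \<Rightarrow> 'p" where "tail l p = snd (split_at l p)"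

lemma head_tail:
  assumes l: "l \<in> paths G" and p: "p \<le> deg G l"
  shows "head l p \<in> paths G" "tail l p \<in> paths G" "src G (head l p) = rng G (tail l p)"
    "deg G (head l p) = p" "deg G (tail l p) = (\<lambda>i. deg G l i - p i)"
    "cmp G (head l p) (tail l p) = l" "rng G (head l p) = rng G l" "src G (tail l p) = src G l"
proof -
  note * = someI_ex[OF ex1_implies_ex[OF factor_ex[OF l p]], folded split_at_def,
      folded head_def tail_def]
  from * show 1: "head l p \<in> paths G" "tail l p \<in> paths G" "src G (head l p) = rng G (tail l p)"
    "deg G (head l p) = p" "deg G (tail l p) = (\<lambda>i. deg G l i - p i)"
    "cmp G (head l p) (tail l p) = l" by auto
  from path_cmp(2,3)[OF 1(1,2,3)] 1(6)
  show "rng G (head l p) = rng G l" "src G (tail l p) = src G l" by auto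
qed

lemma head_tail_eqI:
  assumes "a \<in> paths G" "b \<in> paths G" "src G a = rng G b" "p = deg G a" "l = cmp G a b"
  shows "head l p = a" "tail l p = b"
proof -
  have l: "l \<in> paths G" and p: "p \<le> deg G l" using path_cmp[OF assms(1-3)] assms(4,5) by (simp_all add: le_fun_def)
  note ht = head_tail[OF l p]
  show "head l p = a" "tail l p = b"
    using factor_unique[OF ht(1,2) assms(1,2) ht(3) assms(3)] ht(4,6) assms(4,5) by simp_all
qed

text \<open>Reassociate: a b is the head of a followed by the composite of its tail with b, and this
  is a factorization at degree p.\<close>

lemma head_cmp:
  assumes "a \<in> paths G" "b \<in> paths G" "src G a = rng G b" "p \<le> deg G a"
  shows "head (cmp G a b) p = head a p"
proof -
  note ht = head_tail[OF assms(1,4)]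
  have s: "src G (tail a p) = rng G b" using ht assms by simp
  have "cmp G a b = cmp G (head a p) (cmp G (tail a p) b)"
    using cmp_assoc[OF ht(1,2) assms(2) ht(3) s] unfolding ht(6) .
  note e = this
  have "src G (head a p) = rng G (cmp G (tail a p) b)"
    unfolding path_cmp(2)[OF ht(2) assms(2) s] by (fact ht(3))
  from head_tail_eqI(1)[OF ht(1) path_cmp(1)[OF ht(2) assms(2) s] this ht(4)[symmetric] e]
  show ?thesis .
qed

lemma head_head:
  assumes "l \<in> paths G" "p \<le> q" "q \<le> deg G l"
  shows "head (head l q) p = head l p"
  using head_cmp[of "head l q" "tail l q" p] head_tail[of l q] assms by simp

lemma head_full:
  assumes "l \<in> paths G"
  shows "head l (deg G l) = l" "tail l (deg G l) = src G l"
  using head_tail_eqI[of l "src G l" "deg G l" l] assms by simp_all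

lemma head_zero:
  assumes "l \<in> paths G"
  shows "head l (\<lambda>_. 0) = rng G l" "tail l (\<lambda>_. 0) = l"
  using head_tail_eqI[of "rng G l" l "\<lambda>_. 0" l] assms by simp_all

text \<open>Splitting at degree zero gives r(l) as head and l as tail, while splitting at d(l) gives
  l as head and s(l) as tail. For d(l) = 0 these are the same splitting.\<close>

lemma deg_zero_ends:
  assumes "l \<in> paths G" "deg G l = (\<lambda>_. 0)"
  shows "rng G l = l" "src G l = l"
  using head_zero(1)[of l] head_full[of l] head_zero(2)[of l] assms by auto

lemma vertsD: "v \<in> verts G \<Longrightarrow> v \<in> paths G" "v \<in> verts G \<Longrightarrow> deg G v = (\<lambda>_. 0)"
  by (auto simp: verts_def)

lemma verts_ends [simp]: "v \<in> verts G \<Longrightarrow> rng G v = v" "v \<in> verts G \<Longrightarrow> src G v = v"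
  by (simp_all add: verts_def deg_zero_ends)

section \<open>Edges with a given range, paths of bounded degree, local convexity\<close>

definition emits :: "'p \<Rightarrow> nat \<Rightarrow> bool" where
  "emits v i \<longleftrightarrow> (\<exists>e\<in>paths G. rng G e = v \<and> deg G e = unitv i)"

lemma le_paths_iff:
  "l \<in> le_paths G n \<longleftrightarrow> l \<in> paths G \<and> deg G l \<le> n \<and>
    (\<forall>i<kdim G. deg G l i < n i \<longrightarrow> \<not> emits (src G l) i)"
  by (simp add: le_paths_def emits_def)

lemma le_paths_deg: "l \<in> paths G \<Longrightarrow> l \<in> le_paths G (deg G l)"
  by (simp add: le_paths_iff)

lemma le_paths_cmp:
  assumes "m \<in> paths G" "l \<in> le_paths G n" "src G m = rng G l"
  shows "cmp G m l \<in> le_paths G (\<lambda>i. deg G m i + n i)"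
  using assms by (auto simp: le_paths_iff le_fun_def)

text \<open>Being maximal below n is a condition at the source, and m l and l share their source. So
  an initial segment can be removed once its degree is subtracted from the bound.\<close>

lemma le_paths_cmpD:
  assumes "m \<in> paths G" "l \<in> paths G" "src G m = rng G l" "cmp G m l \<in> le_paths G n"
  shows "l \<in> le_paths G (\<lambda>i. n i - deg G m i)"
  using assms by (auto simp: le_paths_iff le_fun_def) (metis add_diff_cancel_left' diff_le_mono)

text \<open>Turns the graph side of the boundary condition into the absence of edges: a path of
  degree at most e_i that is not a vertex is an edge in direction i.\<close>

lemma le_paths_unitv_singleton:
  assumes v: "v \<in> verts G" and i: "i < kdim G"
  shows "{l \<in> le_paths G (unitv i). rng G l = v} = {v} \<longleftrightarrow> \<not> emits v i"
proof -
  note vv = vertsD[OF v]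
  show ?thesis
  proof
    assume "{l \<in> le_paths G (unitv i). rng G l = v} = {v}"
    then have "v \<in> le_paths G (unitv i)" by blast
    then show "\<not> emits v i" using v i vv by (simp add: le_paths_iff unitv_def)
  next
    assume n: "\<not> emits v i"
    show "{l \<in> le_paths G (unitv i). rng G l = v} = {v}"
    proof (intro equalityI subsetI)
      fix l assume "l \<in> {l \<in> le_paths G (unitv i). rng G l = v}"
      then have l: "l \<in> paths G" "deg G l \<le> unitv i" "rng G l = v" by (auto simp: le_paths_iff)
      then have "deg G l \<noteq> unitv i" using n by (auto simp: emits_def)
      then have "deg G l = (\<lambda>_. 0)" using le_unitv l by blast
      then show "l \<in> {v}" using deg_zero_ends(1)[OF l(1)] l(3) by simp
    next
      fix l assume "l \<in> {v}"
      then show "l \<in> {l \<in> le_paths G (unitv i). rng G l = v}"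
        using v n vv by (simp add: le_paths_iff le_fun_def unitv_def)
    qed
  qed
qed

text \<open>Induction on the total degree of m. Its first edge has a direction j different from i,
  because d(m)_i = 0, and local convexity carries an edge in direction i from the range of that edge
  to its source.\<close>

lemma emits_forward:
  assumes lc: "locally_convex G" and i: "i < kdim G"
    and "m \<in> paths G" "deg G m i = 0" "emits (rng G m) i"
  shows "emits (src G m) i"
  using assms(3-)
proof (induction "\<Sum>j<kdim G. deg G m j" arbitrary: m rule: less_induct)
  case less
  show ?case
  proof (cases "deg G m = (\<lambda>_. 0)")
    case True
    then show ?thesis using less.prems deg_zero_ends[of m] by simp
  next
    case False
    then obtain j where j: "deg G m j \<noteq> 0" by auto
    have "deg G m \<in> Nk (kdim G)" using less.prems by simp
    then have jk: "j < kdim G" using j unfolding Nk_def by (metis (mono_tags) mem_Collect_eq not_less)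
    have ji: "j \<noteq> i" using j less.prems by auto
    have le: "unitv j \<le> deg G m" using j by (auto simp: unitv_def le_fun_def)
    note ht = head_tail[OF less.prems(1) le]
    obtain e where e: "e \<in> paths G" "rng G e = rng G m" "deg G e = unitv i"
      using less.prems by (auto simp: emits_def)
    have em: "emits (rng G (tail m (unitv j))) i"
      using lc[unfolded locally_convex_def, rule_format, OF jk i ji, of "head m (unitv j)" e] e ht
      by (auto simp: emits_def)
    have "(\<Sum>a<kdim G. deg G (tail m (unitv j)) a) < (\<Sum>a<kdim G. deg G m a)"
      by (rule sum_strict_mono_ex1) (use ht jk j in \<open>auto simp: unitv_def intro!: bexI[of _ j]\<close>)
    from less.hyps[OF this ht(2) _ em] show ?thesis using ht less.prems by simp
  qed
qed

text \<open>\<open>row_finite\<close> speaks of one degree at a time, and only finitely many degrees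
  lie below n. A sum over an infinite index set is 0 by convention, so this finiteness gives the sum
  in (KP4) its intended value.\<close>

lemma finite_le_paths:
  assumes rf: "row_finite G" and v: "v \<in> verts G" and n: "n \<in> Nk (kdim G)"
  shows "finite {l \<in> le_paths G n. rng G l = v}"
proof -
  have nz: "\<And>i. i \<ge> kdim G \<Longrightarrow> n i = 0" using n by (simp add: Nk_def)
  have "finite {d. \<forall>i. (i \<in> {..<kdim G} \<longrightarrow> d i \<in> {..Max (n ` {..<kdim G})}) \<and> (i \<notin> {..<kdim G} \<longrightarrow> d i = 0)}"
    by (rule finite_set_of_finite_funs) auto
  moreover have "{d. d \<le> n} \<subseteq> {d. \<forall>i. (i \<in> {..<kdim G} \<longrightarrow> d i \<in> {..Max (n ` {..<kdim G})}) \<and> (i \<notin> {..<kdim G} \<longrightarrow> d i = 0)}"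
  proof (clarsimp simp: le_fun_def, intro conjI impI)
    fix d :: "nat \<Rightarrow> nat" and i assume d: "\<forall>i. d i \<le> n i"
    show "d i \<le> Max (n ` {..<kdim G})" if "i < kdim G"
      using that d by (meson Max_ge finite_imageI finite_lessThan imageI le_trans lessThan_iff)
    show "d i = 0" if "\<not> i < kdim G" using that d nz[of i] by (metis le_zero_eq not_less)
  qed
  ultimately have "finite {d. d \<le> n}" by (rule rev_finite_subset)
  moreover have "finite {l \<in> paths G. rng G l = v \<and> deg G l = d}" if "d \<le> n" for d
  proof -
    have "d \<in> Nk (kdim G)" using nz that by (auto simp: Nk_def le_fun_def) (metis le_zero_eq)
    then show ?thesis using rf v by (auto simp: row_finite_def)
  qed
  ultimately have "finite (\<Union>d\<in>{d. d \<le> n}. {l \<in> paths G. rng G l = v \<and> deg G l = d})" by auto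
  then show ?thesis by (rule rev_finite_subset) (auto simp: le_paths_iff)
qed

end

section \<open>Boundary paths as coherent families of initial segments\<close>

lemma Omega_paths_iff [simp]:
  "(p, q) \<in> paths (Omega k m) \<longleftrightarrow> p \<in> Nk k \<and> p \<le> q \<and> le_enat q m"
  by (simp add: Omega_def)

lemma le_enat_trans: "p \<le> q \<Longrightarrow> le_enat q m \<Longrightarrow> le_enat p m"
  unfolding le_enat_def le_fun_def by (meson enat_ord_simps(1) order_trans)

lemma le_enat_Nk: "le_enat p m \<Longrightarrow> \<forall>i\<ge>k. m i = 0 \<Longrightarrow> p \<in> Nk k"
  unfolding le_enat_def Nk_def by (auto simp: enat_0_iff) (metis enat_0_iff(1) ile0_eq)

text \<open>An edge of \<open>Omega\<close> from p in direction i leads to p + e_i, which exists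
  exactly when m_i exceeds p_i. So the singleton condition says that m is exhausted at p in
  direction i.\<close>

lemma Omega_singleton:
  assumes p: "le_enat p m" and m: "\<forall>i\<ge>k. m i = 0" and i: "i < k"
  shows "{l \<in> le_paths (Omega k m) (unitv i). rng (Omega k m) l = (p, p)} = {(p, p)} \<longleftrightarrow> m i = enat (p i)"
    (is "?L = _ \<longleftrightarrow> _")
proof
  have pN: "p \<in> Nk k" by (rule le_enat_Nk[OF p m])
  assume L: "?L = {(p, p)}"
  show "m i = enat (p i)"
  proof (rule ccontr)
    assume ne: "m i \<noteq> enat (p i)"
    have pi: "enat (p i) \<le> m i" using p by (simp add: le_enat_def)
    define q where "q = (\<lambda>j. p j + unitv i j)"
    have "le_enat q m" unfolding le_enat_def
    proof
      fix j show "enat (q j) \<le> m j"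
      proof (cases "j = i")
        case True
        then have "enat (q j) = eSuc (enat (p i))" by (simp add: q_def unitv_def eSuc_enat)
        then show ?thesis using pi ne True by (simp add: ileI1)
      next
        case False
        then show ?thesis using p by (simp add: q_def unitv_def le_enat_def)
      qed
    qed
    then have q: "(p, q) \<in> paths (Omega k m)" using pN by (simp add: q_def le_fun_def)
    have "(p, p) \<in> le_paths (Omega k m) (unitv i)" using L by blast
    then have "\<not> (\<exists>l\<in>paths (Omega k m). rng (Omega k m) l = (p, p) \<and> deg (Omega k m) l = unitv i)"
      using i by (auto simp: le_paths_def Omega_def unitv_def)
    moreover have "rng (Omega k m) (p, q) = (p, p)" "deg (Omega k m) (p, q) = unitv i"
      by (simp_all add: Omega_def q_def)
    ultimately show False using q by blast
  qed
next
  have pN: "p \<in> Nk k" by (rule le_enat_Nk[OF p m])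
  assume mi: "m i = enat (p i)"
  have none: "deg (Omega k m) l \<noteq> unitv i" if "l \<in> paths (Omega k m)" "rng (Omega k m) l = (p, p)" for l
  proof -
    obtain a q where "l = (a, q)" by (cases l)
    then have l: "l = (p, q)" using that(2) by (simp add: Omega_def)
    then have "enat (q i) \<le> m i" using that(1) by (simp add: le_enat_def)
    then have "q i \<le> p i" by (simp add: mi)
    then have "deg (Omega k m) l i \<noteq> unitv i i" by (simp add: l Omega_def unitv_def)
    then show ?thesis by metis
  qed
  show "?L = {(p, p)}"
  proof (intro equalityI subsetI)
    fix l assume l: "l \<in> ?L"
    then have l': "l \<in> paths (Omega k m)" "rng (Omega k m) l = (p, p)" "deg (Omega k m) l \<le> unitv i"
      by (auto simp: le_paths_def)
    then have d: "deg (Omega k m) l = (\<lambda>_. 0)" using none le_unitv by blast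
    obtain q where q: "l = (p, q)" using l'(2) by (cases l) (auto simp: Omega_def)
    have "q j \<le> p j" for j using fun_cong[OF d, of j] by (simp add: q Omega_def)
    moreover have "p \<le> q" using l' q by simp
    ultimately have "q = p" by (simp add: le_fun_def order_antisym fun_eq_iff)
    then show "l \<in> {(p, p)}" using q by simp
  next
    fix l assume "l \<in> {(p, p)}"
    moreover have "(p, p) \<in> ?L"
      using p pN none by (auto simp: le_paths_def) (auto simp: Omega_def le_fun_def unitv_def split: if_splits)
    ultimately show "l \<in> ?L" by simp
  qed
qed

context kgraph
begin

text \<open>The functor part of \<open>boundary_path\<close> with the encoding by
  \<open>Omega\<close> unfolded. Membership in \<open>Nk\<close> is absorbed by
  \<open>le_enat\<close>, as the degree vanishes from \<open>kdim G\<close> on.\<close>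

definition gpath :: "'p bpath \<Rightarrow> bool" where
  "gpath y \<longleftrightarrow> (\<forall>i\<ge>kdim G. fst y i = 0) \<and>
    (\<forall>p q. \<not> (p \<le> q \<and> le_enat q (fst y)) \<longrightarrow> snd y (p, q) = undefined) \<and>
    (\<forall>p q. p \<le> q \<longrightarrow> le_enat q (fst y) \<longrightarrow> snd y (p, q) \<in> paths G \<and>
      deg G (snd y (p, q)) = (\<lambda>i. q i - p i) \<and>
      rng G (snd y (p, q)) = snd y (p, p) \<and> src G (snd y (p, q)) = snd y (q, q)) \<and>
    (\<forall>p q t. p \<le> q \<longrightarrow> q \<le> t \<longrightarrow> le_enat t (fst y) \<longrightarrow>
      snd y (p, t) = cmp G (snd y (p, q)) (snd y (q, t)))"

text \<open>The boundary condition as seen through \<open>Omega_singleton\<close> and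
  \<open>le_paths_unitv_singleton\<close>: where the path has used up direction i, the graph offers
  no further edge in it.\<close>

definition terminal :: "'p bpath \<Rightarrow> bool" where
  "terminal y \<longleftrightarrow> (\<forall>p i. le_enat p (fst y) \<longrightarrow> i < kdim G \<longrightarrow> fst y i = enat (p i) \<longrightarrow>
     \<not> emits (snd y (p, p)) i)"

lemma
  assumes "gpath y"
  shows gpath_zero: "i \<ge> kdim G \<Longrightarrow> fst y i = 0"
    and gpath_undefined: "\<not> (p \<le> q \<and> le_enat q (fst y)) \<Longrightarrow> snd y (p, q) = undefined"
    and gpath_mor: "p \<le> q \<Longrightarrow> le_enat q (fst y) \<Longrightarrow> snd y (p, q) \<in> paths G \<and>
      deg G (snd y (p, q)) = (\<lambda>i. q i - p i) \<and>
      rng G (snd y (p, q)) = snd y (p, p) \<and> src G (snd y (p, q)) = snd y (q, q)"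
    and gpath_comp: "p \<le> q \<Longrightarrow> q \<le> t \<Longrightarrow> le_enat t (fst y) \<Longrightarrow>
      snd y (p, t) = cmp G (snd y (p, q)) (snd y (q, t))"
proof -
  note * = assms[unfolded gpath_def]
  show "i \<ge> kdim G \<Longrightarrow> fst y i = 0" by (rule *[THEN conjunct1, rule_format])
  show "\<not> (p \<le> q \<and> le_enat q (fst y)) \<Longrightarrow> snd y (p, q) = undefined"
    by (rule *[THEN conjunct2, THEN conjunct1, THEN spec, THEN spec, THEN mp])
  show "p \<le> q \<Longrightarrow> le_enat q (fst y) \<Longrightarrow> snd y (p, q) \<in> paths G \<and>
      deg G (snd y (p, q)) = (\<lambda>i. q i - p i) \<and>
      rng G (snd y (p, q)) = snd y (p, p) \<and> src G (snd y (p, q)) = snd y (q, q)"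
    by (rule *[THEN conjunct2, THEN conjunct2, THEN conjunct1, THEN spec, THEN spec, THEN mp, THEN mp])
  show "p \<le> q \<Longrightarrow> q \<le> t \<Longrightarrow> le_enat t (fst y) \<Longrightarrow>
      snd y (p, t) = cmp G (snd y (p, q)) (snd y (q, t))"
    by (rule *[THEN conjunct2, THEN conjunct2, THEN conjunct2, THEN spec, THEN spec, THEN spec,
          THEN mp, THEN mp, THEN mp])
qed

lemma gpathD:
  assumes "gpath y" "p \<le> q" "le_enat q (fst y)"
  shows "snd y (p, q) \<in> paths G" "deg G (snd y (p, q)) = (\<lambda>i. q i - p i)"
    "rng G (snd y (p, q)) = snd y (p, p)" "src G (snd y (p, q)) = snd y (q, q)"
  using gpath_mor[OF assms] by simp_all

lemma gpath_cmp:
  assumes "gpath y" "p \<le> q" "q \<le> t" "le_enat t (fst y)"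
  shows "cmp G (snd y (p, q)) (snd y (q, t)) = snd y (p, t)"
  using gpath_comp[OF assms] by simp

lemma gpath_Nk: "gpath y \<Longrightarrow> le_enat p (fst y) \<Longrightarrow> p \<in> Nk (kdim G)"
  using le_enat_Nk gpath_zero by blast

lemma gpath_vert: "gpath y \<Longrightarrow> le_enat p (fst y) \<Longrightarrow> snd y (p, p) \<in> verts G"
  using gpathD(1,2)[of y p p] by (simp add: verts_def)

lemma boundary_path_iff: "boundary_path G y \<longleftrightarrow> gpath y \<and> terminal y"
proof -
  obtain m x where y: "y = (m, x)" by (cases y)
  let ?k = "kdim G"
  define Z where "Z \<longleftrightarrow> (\<forall>i\<ge>?k. m i = 0)"
  have le: "p \<le> q \<and> le_enat q m \<longleftrightarrow> p \<in> Nk ?k \<and> p \<le> q \<and> le_enat q m" if Z for p q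
    using that le_enat_Nk[of p m ?k] le_enat_trans[of p q m] unfolding Z_def by blast
  have nk: "p \<in> Nk ?k" if Z "le_enat p m" for p using le[OF that(1), of p p] that(2) by simp
  have 1: "(\<forall>pq. pq \<notin> paths (Omega ?k m) \<longrightarrow> x pq = undefined) \<longleftrightarrow>
     (\<forall>p q. \<not> (p \<le> q \<and> le_enat q m) \<longrightarrow> x (p, q) = undefined)" if Z
    unfolding split_paired_All Omega_paths_iff le[OF that, symmetric] ..
  have 2: "(\<forall>pq\<in>paths (Omega ?k m). x pq \<in> paths G \<and>
         deg G (x pq) = deg (Omega ?k m) pq \<and>
         rng G (x pq) = x (rng (Omega ?k m) pq) \<and> src G (x pq) = x (src (Omega ?k m) pq)) \<longleftrightarrow>
     (\<forall>p q. p \<le> q \<longrightarrow> le_enat q m \<longrightarrow> x (p, q) \<in> paths G \<and> deg G (x (p, q)) = (\<lambda>i. q i - p i) \<and>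
      rng G (x (p, q)) = x (p, p) \<and> src G (x (p, q)) = x (q, q))" if Z
    unfolding Ball_def split_paired_All Omega_paths_iff le[OF that, symmetric]
    by (simp add: Omega_def imp_conjL)
  have 3: "(\<forall>pq\<in>paths (Omega ?k m). \<forall>qt\<in>paths (Omega ?k m).
         src (Omega ?k m) pq = rng (Omega ?k m) qt \<longrightarrow> x (cmp (Omega ?k m) pq qt) = cmp G (x pq) (x qt)) \<longleftrightarrow>
    (\<forall>p q t. p \<le> q \<longrightarrow> q \<le> t \<longrightarrow> le_enat t m \<longrightarrow> x (p, t) = cmp G (x (p, q)) (x (q, t)))" if Z
    unfolding Ball_def split_paired_All Omega_paths_iff le[OF that, symmetric]
    by (auto simp: Omega_def intro: le_enat_trans)
  have 4: "(\<forall>p. (p, p) \<in> paths (Omega ?k m) \<longrightarrow> (\<forall>i<?k.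
         {l \<in> le_paths (Omega ?k m) (unitv i). rng (Omega ?k m) l = (p, p)} = {(p, p)}
         \<longrightarrow> {l \<in> le_paths G (unitv i). rng G l = x (p, p)} = {x (p, p)})) \<longleftrightarrow> terminal y"
    if Z and g: "gpath y"
  proof -
    have Zm: "\<forall>i\<ge>?k. m i = 0" using \<open>Z\<close> Z_def by blast
    have a: "(p, p) \<in> paths (Omega ?k m) \<longleftrightarrow> le_enat p m" for p
      using nk[OF \<open>Z\<close>] by auto
    have b: "({l \<in> le_paths (Omega ?k m) (unitv i). rng (Omega ?k m) l = (p, p)} = {(p, p)}
         \<longrightarrow> {l \<in> le_paths G (unitv i). rng G l = x (p, p)} = {x (p, p)})
       \<longleftrightarrow> (m i = enat (p i) \<longrightarrow> \<not> emits (x (p, p)) i)" if "le_enat p m" "i < ?k" for p i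
    proof -
      have "x (p, p) \<in> verts G" using gpath_vert[OF g] that by (simp add: y)
      from le_paths_unitv_singleton[OF this that(2)] Omega_singleton[OF that(1) Zm that(2)]
      show ?thesis by simp
    qed
    have all: "(\<forall>p. A p \<longrightarrow> (\<forall>i<?k. P p i)) \<longleftrightarrow> (\<forall>p i. A p \<longrightarrow> i < ?k \<longrightarrow> Q p i \<longrightarrow> S p i)"
      if "\<And>p i. A p \<Longrightarrow> i < ?k \<Longrightarrow> P p i \<longleftrightarrow> (Q p i \<longrightarrow> S p i)"
      for A :: "(nat \<Rightarrow> nat) \<Rightarrow> bool" and P Q S using that by blast
    show ?thesis unfolding a terminal_def y fst_conv snd_conv by (rule all) (rule b)
  qed
  define A where "A \<longleftrightarrow> (\<forall>pq. pq \<notin> paths (Omega ?k m) \<longrightarrow> x pq = undefined) \<and>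
     (\<forall>pq\<in>paths (Omega ?k m). x pq \<in> paths G \<and>
         deg G (x pq) = deg (Omega ?k m) pq \<and>
         rng G (x pq) = x (rng (Omega ?k m) pq) \<and> src G (x pq) = x (src (Omega ?k m) pq)) \<and>
     (\<forall>pq\<in>paths (Omega ?k m). \<forall>qt\<in>paths (Omega ?k m).
         src (Omega ?k m) pq = rng (Omega ?k m) qt \<longrightarrow> x (cmp (Omega ?k m) pq qt) = cmp G (x pq) (x qt))"
  define B where "B \<longleftrightarrow> (\<forall>p. (p, p) \<in> paths (Omega ?k m) \<longrightarrow> (\<forall>i<?k.
         {l \<in> le_paths (Omega ?k m) (unitv i). rng (Omega ?k m) l = (p, p)} = {(p, p)}
         \<longrightarrow> {l \<in> le_paths G (unitv i). rng G l = x (p, p)} = {x (p, p)}))"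
  have bd: "boundary_path G y \<longleftrightarrow> Z \<and> A \<and> B"
    unfolding boundary_path_def y prod.case Z_def A_def B_def by (simp only: conj_assoc)
  have Zg: "Z" if "gpath y" using gpath_zero[OF that] by (simp add: y Z_def)
  have g: "gpath y \<longleftrightarrow> A" if Z
    unfolding A_def 1[OF that] 2[OF that] 3[OF that] using that by (simp add: gpath_def y Z_def)
  show ?thesis
    using bd Zg g 4[folded B_def] by blast
qed

lemma zero_le [simp]: "(\<lambda>_. 0::nat) \<le> p"
  by (simp add: le_fun_def)

text \<open>By unique factorization the initial segments y(0,q) determine every segment y(p,q).
  Functors can therefore be compared and constructed through their initial segments alone.\<close>

lemma gpath_head_tail:
  assumes "gpath y" "p \<le> q" "le_enat q (fst y)"
  shows "head (snd y (\<lambda>_. 0, q)) p = snd y (\<lambda>_. 0, p)"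
    "tail (snd y (\<lambda>_. 0, q)) p = snd y (p, q)"
proof -
  have p: "le_enat p (fst y)" by (rule le_enat_trans[OF assms(2,3)])
  note 1 = gpathD[OF assms(1) zero_le p] and 2 = gpathD[OF assms]
  show "head (snd y (\<lambda>_. 0, q)) p = snd y (\<lambda>_. 0, p)" "tail (snd y (\<lambda>_. 0, q)) p = snd y (p, q)"
    using head_tail_eqI[OF 1(1) 2(1), of p "snd y (\<lambda>_. 0, q)"] 1(2,4) 2(3)
      gpath_cmp[OF assms(1) zero_le assms(2,3)] by simp_all
qed

lemma gpath_eqI:
  assumes "gpath y" "gpath z" "fst y = fst z"
    and "\<And>q. le_enat q (fst y) \<Longrightarrow> snd y (\<lambda>_. 0, q) = snd z (\<lambda>_. 0, q)"
  shows "y = z"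
proof (rule prod_eqI[OF assms(3)], rule ext)
  fix pq show "snd y pq = snd z pq"
  proof (cases pq)
    case (Pair p q)
    show ?thesis
    proof (cases "p \<le> q \<and> le_enat q (fst y)")
      case True
      then show ?thesis
        using gpath_head_tail(2)[OF assms(1), of p q] gpath_head_tail(2)[OF assms(2), of p q]
          assms(3) assms(4)[of q] Pair by simp
    next
      case False
      then show ?thesis
        using gpath_undefined[OF assms(1), of p q] gpath_undefined[OF assms(2), of p q] assms(3) Pair
        by simp
    qed
  qed
qed

text \<open>The inverse of restricting a functor to its initial segments.\<close>

definition family_path :: "(nat \<Rightarrow> enat) \<Rightarrow> ((nat \<Rightarrow> nat) \<Rightarrow> 'p) \<Rightarrow> 'p bpath" where
  "family_path m Z = (m, \<lambda>(p, q). if p \<le> q \<and> le_enat q m then tail (Z q) p else undefined)"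

text \<open>Coherence of the family is all that functoriality demands: it makes the tails
  composable, and uniqueness of tails gives the composition law.\<close>

lemma family_path:
  assumes m: "\<And>i. i \<ge> kdim G \<Longrightarrow> m i = 0"
    and Z: "\<And>q. le_enat q m \<Longrightarrow> Z q \<in> paths G" "\<And>q. le_enat q m \<Longrightarrow> deg G (Z q) = q"
    and hd: "\<And>p q. p \<le> q \<Longrightarrow> le_enat q m \<Longrightarrow> head (Z q) p = Z p"
  shows "gpath (family_path m Z)" "fst (family_path m Z) = m"
    "\<And>q. le_enat q m \<Longrightarrow> snd (family_path m Z) (\<lambda>_. 0, q) = Z q"
proof -
  show "fst (family_path m Z) = m" by (simp add: family_path_def)
  show "\<And>q. le_enat q m \<Longrightarrow> snd (family_path m Z) (\<lambda>_. 0, q) = Z q"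
    using head_zero(2)[OF Z(1)] by (simp add: family_path_def)
  have ht: "tail (Z q) p \<in> paths G" "deg G (tail (Z q) p) = (\<lambda>i. q i - p i)"
    "rng G (tail (Z q) p) = src G (Z p)" "src G (tail (Z q) p) = src G (Z q)"
    "cmp G (Z p) (tail (Z q) p) = Z q"
    if "p \<le> q" "le_enat q m" for p q
    using head_tail[OF Z(1)[OF that(2)], of p] that Z(2)[of q] hd[of p q] by simp_all
  have tp: "tail (Z p) p = src G (Z p)" if "le_enat p m" for p
    using head_full(2)[OF Z(1)[OF that]] Z(2)[OF that] by simp
  \<comment> \<open>Both sides complete \<open>Z p\<close> to \<open>Z t\<close>, so both are the
    tail of \<open>Z t\<close> at p.\<close>
  have c: "tail (Z t) p = cmp G (tail (Z q) p) (tail (Z t) q)"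
    if "p \<le> q" "q \<le> t" "le_enat t m" for p q t
  proof -
    have q: "le_enat q m" and p: "le_enat p m" and pt: "p \<le> t"
      using that le_enat_trans order_trans by blast+
    have s: "src G (tail (Z q) p) = rng G (tail (Z t) q)"
      using ht(4)[OF that(1) q] ht(3)[OF that(2,3)] by simp
    have s0: "src G (Z p) = rng G (tail (Z q) p)" using ht(3)[OF that(1) q] by simp
    have "Z t = cmp G (Z p) (cmp G (tail (Z q) p) (tail (Z t) q))"
      using cmp_assoc[OF Z(1)[OF p] ht(1)[OF that(1) q] ht(1)[OF that(2,3)] s0 s]
      unfolding ht(5)[OF that(1) q] ht(5)[OF that(2,3)] .
    then show ?thesis
      using head_tail_eqI(2)[OF Z(1)[OF p] path_cmp(1)[OF ht(1)[OF that(1) q] ht(1)[OF that(2,3)] s], of p "Z t"]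
        s0 path_cmp(2)[OF ht(1)[OF that(1) q] ht(1)[OF that(2,3)] s] Z(2)[OF p] by simp
  qed
  let ?y = "family_path m Z"
  have y: "fst ?y = m" "p \<le> q \<Longrightarrow> le_enat q m \<Longrightarrow> snd ?y (p, q) = tail (Z q) p"
    "\<not> (p \<le> q \<and> le_enat q m) \<Longrightarrow> snd ?y (p, q) = undefined" for p q
    by (auto simp: family_path_def)
  show "gpath ?y"
    unfolding gpath_def y(1)
  proof (intro conjI allI impI)
    show "i \<ge> kdim G \<Longrightarrow> m i = 0" for i by (fact m)
    show "\<not> (p \<le> q \<and> le_enat q m) \<Longrightarrow> snd ?y (p, q) = undefined" for p q by (fact y(3))
  next
    fix p q assume pq: "p \<le> q" "le_enat q m"
    then have p: "le_enat p m" using le_enat_trans by blast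
    note h = ht[OF pq]
    show "snd ?y (p, q) \<in> paths G" "deg G (snd ?y (p, q)) = (\<lambda>i. q i - p i)"
      "rng G (snd ?y (p, q)) = snd ?y (p, p)" "src G (snd ?y (p, q)) = snd ?y (q, q)"
      unfolding y(2)[OF pq] y(2)[OF order_refl pq(2)] y(2)[OF order_refl p]
      using h tp[OF p] tp[OF pq(2)] by simp_all
  next
    fix p q t assume a: "p \<le> q" "q \<le> t" "le_enat t m"
    have q: "le_enat q m" and pt: "p \<le> t" using a le_enat_trans order_trans by blast+
    show "snd ?y (p, t) = cmp G (snd ?y (p, q)) (snd ?y (q, t))"
      unfolding y(2)[OF a(1) q] y(2)[OF a(2,3)] y(2)[OF pt a(3)] using c a by blast
  qed
qed

end

section \<open>Concatenation and shift of boundary paths\<close>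

lemma le_enat_add: "le_enat t m \<Longrightarrow> le_enat (\<lambda>i. d i + t i) (\<lambda>i. enat (d i) + m i)"
  unfolding le_enat_def plus_enat_simps(1)[symmetric] by (blast intro: add_left_mono)

text \<open>The subtraction is truncated, so q may fall short of d in some coordinates. This handles
  arbitrary positions on a concatenated path.\<close>

lemma le_enat_diff:
  assumes "le_enat q (\<lambda>i. enat (d i) + m i)"
  shows "le_enat (\<lambda>i. q i - d i) m"
  unfolding le_enat_def
proof
  fix i
  have "enat (q i) \<le> enat (d i) + m i" using assms by (simp add: le_enat_def)
  then show "enat (q i - d i) \<le> m i" by (cases "m i") auto
qed

lemma le_enat_zero [simp]: "le_enat (\<lambda>_. 0) m"
  by (simp add: le_enat_def enat_0)

context kgraph
begin

text \<open>The clauses of \<open>bp_concat\<close> as a relation, free of the definite description.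
  It is read in both directions, as prepending l to y and as removing l from z, and it involves only
  the degree map of the graph, so a subgraph has the same relation.\<close>

definition is_concat :: "'p \<Rightarrow> 'p bpath \<Rightarrow> 'p bpath \<Rightarrow> bool" where
  "is_concat l y z \<longleftrightarrow> fst z = (\<lambda>i. enat (deg G l i) + fst y i) \<and> snd z (\<lambda>_. 0, deg G l) = l \<and>
     (\<forall>p q. p \<le> q \<longrightarrow> le_enat q (fst y) \<longrightarrow>
        snd z (\<lambda>i. deg G l i + p i, \<lambda>i. deg G l i + q i) = snd y (p, q))"

lemma is_concatD:
  assumes "is_concat l y z"
  shows "fst z = (\<lambda>i. enat (deg G l i) + fst y i)" "snd z (\<lambda>_. 0, deg G l) = l"
    "p \<le> q \<Longrightarrow> le_enat q (fst y) \<Longrightarrow>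
       snd z (\<lambda>i. deg G l i + p i, \<lambda>i. deg G l i + q i) = snd y (p, q)"
  using assms by (auto simp: is_concat_def)

lemma is_concat_le:
  assumes "is_concat l y z"
  shows "le_enat t (fst y) \<Longrightarrow> le_enat (\<lambda>i. deg G l i + t i) (fst z)" "le_enat (deg G l) (fst z)"
proof -
  show *: "le_enat t (fst y) \<Longrightarrow> le_enat (\<lambda>i. deg G l i + t i) (fst z)" for t
    unfolding is_concatD(1)[OF assms] by (rule le_enat_add)
  from *[of "\<lambda>_. 0"] show "le_enat (deg G l) (fst z)" by simp
qed

lemma is_concat_initial:
  assumes z: "gpath z" and c: "is_concat l y z" and t: "le_enat t (fst y)"
  shows "snd z (\<lambda>_. 0, \<lambda>i. deg G l i + t i) = cmp G l (snd y (\<lambda>_. 0, t))"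
proof -
  have le: "deg G l \<le> (\<lambda>i. deg G l i + t i)" by (simp add: le_fun_def)
  show ?thesis
    using gpath_cmp[OF z zero_le le is_concat_le(1)[OF c t]] is_concatD(2)[OF c]
      is_concatD(3)[OF c zero_le t] by simp
qed

lemma is_concat_ends:
  assumes z: "gpath z" and c: "is_concat l y z"
  shows "l \<in> paths G" "bp_range z = rng G l" "src G l = bp_range y"
proof -
  note d = gpathD[OF z zero_le is_concat_le(2)[OF c], unfolded is_concatD(2)[OF c]]
  show "l \<in> paths G" "bp_range z = rng G l" "src G l = bp_range y"
    using d is_concatD(3)[OF c, of "\<lambda>_. 0" "\<lambda>_. 0"] by (simp_all add: bp_range_def)
qed

text \<open>Every position q of z lies below d(l) + t for t the truncated difference q - d(l), and
  the initial segment there is l y(0,t).\<close>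

lemma is_concat_unique:
  assumes z: "gpath z" and z': "gpath z'" and y: "gpath y" and c: "is_concat l y z" and c': "is_concat l y z'"
  shows "z = z'"
proof (rule gpath_eqI[OF z z'])
  show e: "fst z = fst z'" using is_concatD(1)[OF c] is_concatD(1)[OF c'] by simp
  fix q assume q: "le_enat q (fst z)"
  define t where "t = (\<lambda>i. q i - deg G l i)"
  have t: "le_enat t (fst y)" using q le_enat_diff unfolding is_concatD(1)[OF c] t_def by blast
  have le: "q \<le> (\<lambda>i. deg G l i + t i)" unfolding le_fun_def t_def by auto
  show "snd z (\<lambda>_. 0, q) = snd z' (\<lambda>_. 0, q)"
    using gpath_head_tail(1)[OF z le is_concat_le(1)[OF c t]]
      gpath_head_tail(1)[OF z' le is_concat_le(1)[OF c' t]]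
      is_concat_initial[OF z c t] is_concat_initial[OF z' c' t] by simp
qed

text \<open>Left cancellation; it makes the action of s_l^* a well-defined partial map.\<close>

lemma is_concat_cancel:
  assumes "gpath y" "gpath y'" "is_concat l y z" "is_concat l y' z"
  shows "y = y'"
proof (rule gpath_eqI[OF assms(1,2)])
  show e: "fst y = fst y'"
    using is_concatD(1)[OF assms(3)] is_concatD(1)[OF assms(4)] by (auto simp: fun_eq_iff)
  show "snd y (\<lambda>_. 0, q) = snd y' (\<lambda>_. 0, q)" if "le_enat q (fst y)" for q
    using is_concatD(3)[OF assms(3) zero_le that]
      is_concatD(3)[OF assms(4) zero_le that[unfolded e]] by simp
qed

lemma is_concat_assoc:
  assumes u: "gpath u" and cm: "is_concat m y z" and cl: "is_concat l z u"
    and l: "l \<in> paths G" and m: "m \<in> paths G" and s: "src G l = rng G m"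
  shows "is_concat (cmp G l m) y u"
proof -
  have d: "deg G (cmp G l m) = (\<lambda>i. deg G l i + deg G m i)" using path_cmp(4)[OF l m s] .
  have 1: "fst u = (\<lambda>i. enat (deg G l i + deg G m i) + fst y i)"
    using is_concatD(1)[OF cl] is_concatD(1)[OF cm] by (simp add: fun_eq_iff add.assoc flip: plus_enat_simps(1))
  have 2: "snd u (\<lambda>_. 0, \<lambda>i. deg G l i + deg G m i) = cmp G l m"
    using is_concat_initial[OF u cl is_concat_le(2)[OF cm]] is_concatD(2)[OF cm] by simp
  have 3: "snd u (\<lambda>i. deg G l i + deg G m i + p i, \<lambda>i. deg G l i + deg G m i + q i) = snd y (p, q)"
    if "p \<le> q" "le_enat q (fst y)" for p q
  proof -
    have "(\<lambda>i. deg G m i + p i) \<le> (\<lambda>i. deg G m i + q i)" using that(1) by (simp add: le_fun_def)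
    from is_concatD(3)[OF cl this is_concat_le(1)[OF cm that(2)]] is_concatD(3)[OF cm that]
    show ?thesis by (simp add: add.assoc)
  qed
  show ?thesis unfolding is_concat_def d using 1 2 3 by simp
qed

text \<open>The initial segment of l y at a position q is cut from l y(0,t), with t the truncated
  difference q - d(l). Local convexity is what secures the boundary condition.\<close>

lemma concat_exists:
  assumes lc: "locally_convex G" and y: "gpath y" and ty: "terminal y" and l: "l \<in> paths G"
    and s: "src G l = bp_range y"
  shows "\<exists>z. gpath z \<and> terminal z \<and> is_concat l y z"
proof -
  let ?d = "deg G l"
  define M where "M = (\<lambda>i. enat (?d i) + fst y i)"
  \<comment> \<open>\<open>L q\<close> has as degree the coordinatewise maximum of q and d(l), so it
    is long enough to have a head of degree q.\<close>
  define L where "L = (\<lambda>q. cmp G l (snd y (\<lambda>_. 0, \<lambda>i. q i - ?d i)))"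
  define Z where "Z = (\<lambda>q. head (L q) q)"
  have M0: "M i = 0" if "i \<ge> kdim G" for i
  proof -
    have "?d \<in> Nk (kdim G)" using l by simp
    then have "?d i = 0" using that by (simp add: Nk_def)
    then show ?thesis using gpath_zero[OF y that] by (simp add: M_def enat_0)
  qed
  have t: "le_enat (\<lambda>i. q i - ?d i) (fst y)" if "le_enat q M" for q
    using that unfolding M_def by (rule le_enat_diff)
  have y0: "snd y (\<lambda>_. 0, \<lambda>i. q i - ?d i) \<in> paths G"
    "deg G (snd y (\<lambda>_. 0, \<lambda>i. q i - ?d i)) = (\<lambda>i. q i - ?d i)"
    "src G l = rng G (snd y (\<lambda>_. 0, \<lambda>i. q i - ?d i))" if "le_enat q M" for q
    using gpathD[OF y zero_le t[OF that]] s by (simp_all add: bp_range_def)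
  have L: "L q \<in> paths G" "deg G (L q) = (\<lambda>i. ?d i + (q i - ?d i))" "q \<le> deg G (L q)" if "le_enat q M" for q
  proof -
    note c = path_cmp[OF l y0(1,3)[OF that], folded L_def]
    show "L q \<in> paths G" "deg G (L q) = (\<lambda>i. ?d i + (q i - ?d i))"
      using c(1,4) y0(2)[OF that] by (simp_all add: L_def)
    then show "q \<le> deg G (L q)" by (simp only: le_fun_def) arith
  qed
  have Z: "Z q \<in> paths G" "deg G (Z q) = q" if "le_enat q M" for q
    using head_tail[OF L(1,3)[OF that]] by (simp_all add: Z_def)
  have hd: "head (Z q) p = Z p" if pq: "p \<le> q" and q: "le_enat q M" for p q
  proof -
    have p: "le_enat p M" using le_enat_trans[OF that] .
    have le: "(\<lambda>i. p i - ?d i) \<le> (\<lambda>i. q i - ?d i)" using pq by (simp add: le_fun_def diff_le_mono)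
    note yq = gpathD[OF y le t[OF q]]
    have s': "src G (snd y (\<lambda>_. 0, \<lambda>i. p i - ?d i)) = rng G (snd y (\<lambda>i. p i - ?d i, \<lambda>i. q i - ?d i))"
      using gpathD(4)[OF y zero_le t[OF p]] yq(3) by simp
    \<comment> \<open>\<open>L q\<close> extends \<open>L p\<close>, hence both have the same head
      of degree p.\<close>
    have "L q = cmp G (L p) (snd y (\<lambda>i. p i - ?d i, \<lambda>i. q i - ?d i))"
      unfolding L_def using cmp_assoc[OF l y0(1)[OF p] yq(1) y0(3)[OF p] s']
        gpath_cmp[OF y zero_le le t[OF q]] by simp
    moreover have "src G (L p) = rng G (snd y (\<lambda>i. p i - ?d i, \<lambda>i. q i - ?d i))"
      unfolding L_def using path_cmp(3)[OF l y0(1,3)[OF p]] s' by simp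
    ultimately have "head (L q) p = head (L p) p"
      using head_cmp[OF L(1)[OF p] yq(1) _ L(3)[OF p]] by simp
    then show ?thesis unfolding Z_def using head_head[OF L(1)[OF q] pq L(3)[OF q]] by simp
  qed
  define z where "z = family_path M Z"
  have z: "gpath z" "fst z = M" "\<And>q. le_enat q M \<Longrightarrow> snd z (\<lambda>_. 0, q) = Z q"
    unfolding z_def using family_path[of M Z, OF M0 Z hd] by blast+
  have zq: "snd z (\<lambda>i. ?d i + p i, \<lambda>i. ?d i + q i) = snd y (p, q)"
    if pq: "p \<le> q" and q: "le_enat q (fst y)" for p q
  proof -
    have dle: "(\<lambda>i. ?d i + p i) \<le> (\<lambda>i. ?d i + q i)" using pq by (simp add: le_fun_def)
    have dq: "le_enat (\<lambda>i. ?d i + q i) M" unfolding M_def by (rule le_enat_add[OF q])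
    have p: "le_enat p (fst y)" using le_enat_trans[OF pq q] .
    have Zq: "Z (\<lambda>i. ?d i + q i) = cmp G l (snd y (\<lambda>_. 0, q))"
      using head_full(1)[OF L(1)[OF dq]] L(2)[OF dq] by (simp add: Z_def L_def)
    note yq = gpathD[OF y pq q] and yp = gpathD[OF y zero_le p]
    have s': "src G l = rng G (snd y (\<lambda>_. 0, p))" using yp(3) s by (simp add: bp_range_def)
    have sp: "src G (snd y (\<lambda>_. 0, p)) = rng G (snd y (p, q))" using yp(4) yq(3) by simp
    have "cmp G l (snd y (\<lambda>_. 0, q)) = cmp G (cmp G l (snd y (\<lambda>_. 0, p))) (snd y (p, q))"
      using cmp_assoc[OF l yp(1) yq(1) s' sp] gpath_cmp[OF y zero_le pq q] by simp
    then have "tail (Z (\<lambda>i. ?d i + q i)) (\<lambda>i. ?d i + p i) = snd y (p, q)"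
      using head_tail_eqI(2)[OF path_cmp(1)[OF l yp(1) s'] yq(1)] path_cmp(3,4)[OF l yp(1) s'] sp yp(2) Zq
      by simp
    then show ?thesis using gpath_head_tail(2)[OF z(1) dle] z(2,3) dq by simp
  qed
  have dM: "le_enat ?d M" unfolding M_def using le_enat_add[of "\<lambda>_. 0" "fst y" ?d] by simp
  have "L ?d = l"
    unfolding L_def using s[unfolded bp_range_def, symmetric] path_ends(8)[OF l] by simp
  then have "snd z (\<lambda>_. 0, ?d) = l"
    using z(3)[OF dM] head_full(1)[OF l] by (simp add: Z_def)
  then have c: "is_concat l y z"
    unfolding is_concat_def using z(2) zq by (simp add: M_def)
  \<comment> \<open>Beyond position \<open>p\<close> joined with the degree of \<open>l\<close> the path agrees with \<open>y\<close>;
    local convexity carries an edge at \<open>p\<close> forward to there.\<close>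
  have "terminal z" unfolding terminal_def z(2)
  proof (intro allI impI notI)
    fix p i assume p: "le_enat p M" and i: "i < kdim G" and Mi: "M i = enat (p i)"
      and em: "emits (snd z (p, p)) i"
    define b where "b = (\<lambda>j. p j - ?d j)"
    define q where "q = (\<lambda>j. ?d j + b j)"
    have b: "le_enat b (fst y)" unfolding b_def by (rule t[OF p])
    have q: "le_enat q M" unfolding q_def M_def by (rule le_enat_add[OF b])
    have pq: "p \<le> q" unfolding q_def b_def le_fun_def by arith
    have yi: "fst y i = enat (b i)" and qi: "q i = p i"
      using Mi unfolding M_def q_def b_def by (cases "fst y i"; auto)+
    note zd = gpathD[OF z(1) pq, unfolded z(2), OF q]
    have "emits (snd z (q, q)) i"
      using emits_forward[OF lc i zd(1)] zd(2,3,4) qi em by simp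
    moreover have "snd z (q, q) = snd y (b, b)" unfolding q_def by (rule zq[OF order_refl b])
    ultimately show False using ty b i yi by (simp add: terminal_def)
  qed
  then show ?thesis using z(1) c by blast
qed

text \<open>Dropping an initial segment keeps the boundary condition, since the vertex of the
  shifted path at a is the vertex of z at p + a.\<close>

lemma shift_exists:
  assumes z: "gpath z" and tz: "terminal z" and p: "le_enat p (fst z)"
  shows "\<exists>y. gpath y \<and> terminal y \<and> is_concat (snd z (\<lambda>_. 0, p)) y z"
proof -
  \<comment> \<open>Subtraction in \<open>enat\<close> leaves infinite coordinates infinite.\<close>
  define M where "M = (\<lambda>i. fst z i - enat (p i))"
  have zM: "fst z = (\<lambda>i. enat (p i) + M i)"
  proof
    fix i have "enat (p i) \<le> fst z i" using p by (simp add: le_enat_def)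
    then show "fst z i = enat (p i) + M i" by (cases "fst z i") (auto simp: M_def)
  qed
  define Z where "Z = (\<lambda>q. snd z (p, \<lambda>i. p i + q i))"
  have le: "p \<le> (\<lambda>i. p i + q i)" for q by (simp add: le_fun_def)
  have qz: "le_enat (\<lambda>i. p i + q i) (fst z)" if "le_enat q M" for q
    unfolding zM by (rule le_enat_add[OF that])
  have M0: "M i = 0" if "i \<ge> kdim G" for i
    using gpath_zero[OF z that] by (simp add: M_def)
  have Z: "Z q \<in> paths G" "deg G (Z q) = q" if "le_enat q M" for q
    using gpathD[OF z le qz[OF that]] by (simp_all add: Z_def)
  have ht: "head (Z q) a = Z a \<and> tail (Z q) a = snd z (\<lambda>i. p i + a i, \<lambda>i. p i + q i)"
    if aq: "a \<le> q" and q: "le_enat q M" for a q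
  proof -
    have a: "le_enat a M" using le_enat_trans[OF that] .
    have le': "(\<lambda>i. p i + a i) \<le> (\<lambda>i. p i + q i)" using aq by (simp add: le_fun_def)
    note 1 = gpathD[OF z le qz[OF a]] and 2 = gpathD[OF z le' qz[OF q]]
    show ?thesis unfolding Z_def
      using head_tail_eqI[OF 1(1) 2(1)] 1(2,4) 2(3) gpath_cmp[OF z le le' qz[OF q]] by simp
  qed
  define y where "y = family_path M Z"
  have y: "gpath y" "fst y = M" "\<And>q. le_enat q M \<Longrightarrow> snd y (\<lambda>_. 0, q) = Z q"
    unfolding y_def using family_path[of M Z, OF M0 Z] ht by blast+
  have yz: "snd y (a, q) = snd z (\<lambda>i. p i + a i, \<lambda>i. p i + q i)" if "a \<le> q" "le_enat q M" for a q
    using gpath_head_tail(2)[OF y(1) that(1)] y(2,3) that ht[OF that] by simp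
  note zp = gpathD[OF z zero_le p]
  have "is_concat (snd z (\<lambda>_. 0, p)) y z"
    unfolding is_concat_def using zp(2) zM yz y(2) by simp
  moreover have "terminal y"
    unfolding terminal_def y(2)
  proof (intro allI impI)
    fix a i assume "le_enat a M" "i < kdim G" "M i = enat (a i)"
    then show "\<not> emits (snd y (a, a)) i"
      using tz[unfolded terminal_def, rule_format, OF qz, of a i] yz[of a a] by (simp add: zM)
  qed
  ultimately show ?thesis using y(1) by blast
qed

text \<open>If l stops short of n in direction i, then no edge in direction i has range s(l), so y
  cannot move in that direction either.\<close>

lemma concat_le_paths_deg:
  assumes y: "gpath y" and z: "gpath z" and c: "is_concat l y z"
    and l: "l \<in> le_paths G n" and i: "i < kdim G" "deg G l i < n i"
  shows "fst z i = enat (deg G l i)"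
proof -
  have "fst y i = 0"
  proof (rule ccontr)
    assume "fst y i \<noteq> 0"
    then have "1 \<le> fst y i" using ileI1[of 0 "fst y i"] by (simp add: one_eSuc)
    then have "le_enat (unitv i) (fst y)"
      by (simp add: le_enat_def unitv_def enat_0 one_enat_def)
    from gpathD[OF y zero_le this] is_concat_ends(3)[OF z c]
    have "emits (src G l) i" unfolding emits_def bp_range_def by auto
    then show False using l i by (simp add: le_paths_iff)
  qed
  then show ?thesis using is_concatD(1)[OF c] by simp
qed

text \<open>All initial segments of z in \<open>le_paths G n\<close> have the same degree: one that
  is shorter than another in direction i stops short of n there, so z itself ends with it in
  direction i. This is what (KP3) amounts to on boundary paths.\<close>

lemma concat_le_paths_unique:
  assumes y: "gpath y" "gpath y'" and z: "gpath z" and c: "is_concat l y z" "is_concat m y' z"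
    and l: "l \<in> le_paths G n" "m \<in> le_paths G n" and n: "n \<in> Nk (kdim G)"
  shows "l = m"
proof -
  have *: "deg G m i \<le> deg G l i" if y: "gpath y" "gpath y'" and c: "is_concat l y z" "is_concat m y' z"
    and l: "l \<in> le_paths G n" "m \<in> le_paths G n" for l m y y' i
  proof (rule ccontr)
    assume a: "\<not> deg G m i \<le> deg G l i"
    have mn: "deg G m i \<le> n i" using l(2) by (simp add: le_paths_iff le_fun_def)
    moreover have "n i = 0" if "i \<ge> kdim G" using n that by (simp add: Nk_def)
    ultimately have "i < kdim G" using a by (cases "i < kdim G") auto
    then have "fst z i = enat (deg G l i)" using concat_le_paths_deg[OF y(1) z c(1) l(1)] a mn by simp
    moreover have "enat (deg G m i) \<le> fst z i" using is_concat_le(2)[OF c(2)] by (simp add: le_enat_def)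
    ultimately show False using a by simp
  qed
  have "deg G l = deg G m"
    using *[OF y c l] *[OF y(2,1) c(2,1) l(2,1)] by (simp add: fun_eq_iff order_antisym)
  then show ?thesis using is_concatD(2)[OF c(1)] is_concatD(2)[OF c(2)] by metis
qed

text \<open>The segment ends at the coordinatewise minimum of n and the degree of z; where this
  falls below n, the path is exhausted and the boundary condition excludes edges. Together with
  uniqueness it yields (KP4) on boundary paths.\<close>

lemma le_paths_initial:
  assumes z: "gpath z" "terminal z"
  shows "\<exists>l\<in>le_paths G n. \<exists>y. gpath y \<and> terminal y \<and> is_concat l y z"
proof -
  \<comment> \<open>\<open>the_enat\<close> is applied only where the degree of z is below
    \<open>n i\<close>, hence finite.\<close>
  define p where "p = (\<lambda>i. if enat (n i) \<le> fst z i then n i else the_enat (fst z i))"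
  have fin: "fst z i = enat (p i) \<and> p i < n i" if "\<not> enat (n i) \<le> fst z i" for i
    using that by (cases "fst z i") (auto simp: p_def)
  have p: "le_enat p (fst z)" unfolding le_enat_def
  proof
    fix i show "enat (p i) \<le> fst z i" using fin[of i] by (cases "enat (n i) \<le> fst z i") (auto simp: p_def)
  qed
  have pn: "p i \<le> n i" for i using fin[of i] by (cases "enat (n i) \<le> fst z i") (auto simp: p_def)
  note zp = gpathD[OF z(1) zero_le p]
  have "\<not> emits (snd z (p, p)) i" if "i < kdim G" "p i < n i" for i
  proof -
    have "\<not> enat (n i) \<le> fst z i" using that by (auto simp: p_def)
    then show ?thesis using z(2) p that(1) fin[of i] by (simp add: terminal_def)
  qed
  then have "snd z (\<lambda>_. 0, p) \<in> le_paths G n"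
    using zp pn by (simp add: le_paths_iff le_fun_def)
  then show ?thesis using shift_exists[OF z p] by blast
qed

lemma bp_concat_def':
  assumes "gpath y"
  shows "bp_concat G l y = (THE z. (gpath z \<and> terminal z) \<and> is_concat l y z)"
proof -
  have "(p, q) \<in> paths (Omega (kdim G) (fst y)) \<longleftrightarrow> p \<le> q \<and> le_enat q (fst y)" for p q
    using le_enat_trans[of p q "fst y"] gpath_Nk[OF assms, of p] by auto
  then show ?thesis
    unfolding bp_concat_def boundary_path_iff is_concat_def by (simp only: imp_conjL)
qed

text \<open>\<open>is_concat_unique\<close> makes the definite description in
  \<open>bp_concat\<close> meaningful.\<close>

lemma bp_concat_eqI:
  assumes "gpath y" "gpath z" "terminal z" "is_concat l y z"
  shows "bp_concat G l y = z"
  unfolding bp_concat_def'[OF assms(1)]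
  by (rule the_equality) (use assms is_concat_unique in blast)+

end

section \<open>The free algebra\<close>

text \<open>Linear extension to the free algebra of a function on words. Products, the involution
  and the representation are all tested through such functionals.\<close>

definition ev :: "('g list \<Rightarrow> 'r::comm_ring_1) \<Rightarrow> ('g list \<Rightarrow> 'r) \<Rightarrow> 'r" where
  "ev f \<phi> = (\<Sum>w | f w \<noteq> 0. f w * \<phi> w)"

definition conv :: "('g list \<Rightarrow> 'r::comm_ring_1) \<Rightarrow> ('g list \<Rightarrow> 'r) \<Rightarrow> 'g list \<Rightarrow> 'r" where
  "conv f g = (\<lambda>w. \<Sum>i\<in>{..length w}. f (take i w) * g (drop i w))"

abbreviation fsupp :: "('g list \<Rightarrow> 'r::comm_ring_1) \<Rightarrow> bool" where
  "fsupp f \<equiv> finite {w. f w \<noteq> 0}"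

lemma ev_superset: "finite S \<Longrightarrow> {w. f w \<noteq> 0} \<subseteq> S \<Longrightarrow> ev f \<phi> = (\<Sum>w\<in>S. f w * \<phi> w)"
  unfolding ev_def by (rule sum.mono_neutral_left) auto

lemma ev_delta: "fsupp f \<Longrightarrow> ev f (\<lambda>u. if u = w then 1 else 0) = f w"
proof -
  assume f: "fsupp f"
  have "ev f (\<lambda>u. if u = w then 1 else 0) = (\<Sum>u\<in>insert w {w. f w \<noteq> 0}. if u = w then f u else 0)"
    by (rule trans[OF ev_superset[of "insert w {w. f w \<noteq> 0}"] sum.cong]) (use f in auto)
  also have "\<dots> = f w" by (subst sum.delta) (use f in auto)
  finally show ?thesis .
qed

lemma ev_mono [simp]: "ev (mono u) \<phi> = \<phi> u"
  using ev_superset[of "{u}" "mono u" \<phi>] by (auto simp: mono_def)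

lemma ev_zero [simp]: "ev (\<lambda>_. 0) \<phi> = 0" "ev f (\<lambda>_. 0) = 0"
  by (simp_all add: ev_def)

lemma fsupp_mono [simp]: "fsupp (mono u)"
  by (rule finite_subset[of _ "{u}"]) (auto simp: mono_def)

lemma fsupp_add [simp]: "fsupp f \<Longrightarrow> fsupp g \<Longrightarrow> fsupp (\<lambda>w. f w + g w)"
  by (rule finite_subset[of _ "{w. f w \<noteq> 0} \<union> {w. g w \<noteq> 0}"]) auto

lemma fsupp_fdiff [simp]: "fsupp f \<Longrightarrow> fsupp g \<Longrightarrow> fsupp (fdiff f g)"
  by (rule finite_subset[of _ "{w. f w \<noteq> 0} \<union> {w. g w \<noteq> 0}"]) (auto simp: fdiff_def)

lemma fsupp_sum: "finite S \<Longrightarrow> (\<And>l. l \<in> S \<Longrightarrow> fsupp (h l)) \<Longrightarrow> fsupp (\<lambda>w. \<Sum>l\<in>S. h l w)"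
  by (rule finite_subset[of _ "\<Union>l\<in>S. {w. h l w \<noteq> 0}"]) (auto intro: ccontr dest: sum.not_neutral_contains_not_neutral)

lemma ev_add:
  assumes "fsupp f" "fsupp g"
  shows "ev (\<lambda>w. f w + g w) \<phi> = ev f \<phi> + ev g \<phi>"
proof -
  let ?S = "{w. f w \<noteq> 0} \<union> {w. g w \<noteq> 0}"
  have S: "finite ?S" "{w. f w + g w \<noteq> 0} \<subseteq> ?S" using assms by auto
  show ?thesis
    unfolding ev_superset[OF S] ev_superset[OF S(1), of f, OF Un_upper1]
      ev_superset[OF S(1), of g, OF Un_upper2]
    by (simp add: sum.distrib distrib_right)
qed

lemma ev_smult:
  assumes "fsupp f"
  shows "ev (\<lambda>w. c * f w) \<phi> = c * ev f \<phi>"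
proof -
  have "{w. c * f w \<noteq> 0} \<subseteq> {w. f w \<noteq> 0}" by auto
  from ev_superset[OF assms this] show ?thesis
    by (simp add: ev_def sum_distrib_left mult.assoc)
qed

lemma ev_uminus: "fsupp f \<Longrightarrow> ev (\<lambda>w. - f w) \<phi> = - ev f \<phi>"
  using ev_smult[of f "-1" \<phi>] by simp

lemma ev_fdiff: "fsupp f \<Longrightarrow> fsupp g \<Longrightarrow> ev (fdiff f g) \<phi> = ev f \<phi> - ev g \<phi>"
  using ev_add[of f "\<lambda>w. - g w" \<phi>] by (simp add: fdiff_def ev_uminus)

lemma ev_sum:
  assumes "finite S" "\<And>l. l \<in> S \<Longrightarrow> fsupp (h l)"
  shows "ev (\<lambda>w. \<Sum>l\<in>S. h l w) \<phi> = (\<Sum>l\<in>S. ev (h l) \<phi>)"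
  using assms by (induction S) (auto simp: ev_add fsupp_sum)

lemma ev_swap: "fsupp f \<Longrightarrow> fsupp g \<Longrightarrow> ev f (\<lambda>u. ev g (\<lambda>v. F u v)) = ev g (\<lambda>v. ev f (\<lambda>u. F u v))"
  unfolding ev_def sum_distrib_left by (subst sum.swap) (simp add: ac_simps)

text \<open>A word with a cutting position is the same as a pair of words, so the double sum over
  cuts becomes a double sum over the two supports. Facts about products thus reduce to facts about
  concatenation of words.\<close>

lemma conv_ev:
  assumes f: "fsupp f" and g: "fsupp g"
  shows "{w. conv f g w \<noteq> 0} \<subseteq> (\<lambda>(u, v). u @ v) ` ({w. f w \<noteq> 0} \<times> {w. g w \<noteq> 0})" (is "_ \<subseteq> ?S")
    and "ev (conv f g) \<phi> = ev f (\<lambda>u. ev g (\<lambda>v. \<phi> (u @ v)))"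
proof -
  let ?A = "{w. f w \<noteq> 0}" and ?B = "{w. g w \<noteq> 0}"
  show sub: "{w. conv f g w \<noteq> 0} \<subseteq> ?S"
  proof
    fix w assume "w \<in> {w. conv f g w \<noteq> 0}"
    then obtain i where "f (take i w) * g (drop i w) \<noteq> 0"
      unfolding conv_def by (metis (mono_tags, lifting) mem_Collect_eq sum.neutral)
    then have "(take i w, drop i w) \<in> ?A \<times> ?B" by auto
    then show "w \<in> ?S" by (rule rev_image_eqI) simp
  qed
  have fin: "finite ?S" using f g by simp
  \<comment> \<open>Sends a pair of words to their concatenation and the position of the
    cut.\<close>
  let ?j = "\<lambda>(u, v). (u @ v, length u)"
  let ?F = "\<lambda>(w, i). f (take i w) * g (drop i w) * \<phi> w"
  have inj: "inj_on ?j (?A \<times> ?B)" by (auto simp: inj_on_def)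
  have "ev (conv f g) \<phi> = (\<Sum>w\<in>?S. conv f g w * \<phi> w)" by (rule ev_superset[OF fin sub])
  also have "\<dots> = (\<Sum>w\<in>?S. \<Sum>i\<in>{..length w}. f (take i w) * g (drop i w) * \<phi> w)"
    by (simp add: conv_def sum_distrib_right)
  also have "\<dots> = (\<Sum>p\<in>Sigma ?S (\<lambda>w. {..length w}). ?F p)"
    by (subst sum.Sigma) (use fin in auto)
  also have "\<dots> = (\<Sum>p\<in>?j ` (?A \<times> ?B). ?F p)"
  proof (rule sum.mono_neutral_right)
    show "finite (Sigma ?S (\<lambda>w. {..length w}))" using fin by blast
    show "?j ` (?A \<times> ?B) \<subseteq> Sigma ?S (\<lambda>w. {..length w})" by auto
    show "\<forall>p\<in>Sigma ?S (\<lambda>w. {..length w}) - ?j ` (?A \<times> ?B). ?F p = 0"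
    proof (rule ballI, rule ccontr)
      fix p assume p: "p \<in> Sigma ?S (\<lambda>w. {..length w}) - ?j ` (?A \<times> ?B)" and n: "?F p \<noteq> 0"
      obtain w i where wi: "p = (w, i)" by (cases p)
      from n wi have "(take i w, drop i w) \<in> ?A \<times> ?B" by auto
      moreover have "p = ?j (take i w, drop i w)" using p wi by auto
      ultimately show False using p by blast
    qed
  qed
  also have "\<dots> = (\<Sum>p\<in>?A \<times> ?B. ?F (?j p))" by (rule sum.reindex_cong[OF inj]) auto
  also have "\<dots> = (\<Sum>u\<in>?A. \<Sum>v\<in>?B. f u * g v * \<phi> (u @ v))"
    by (subst sum.cartesian_product) (rule sum.cong, auto)
  also have "\<dots> = ev f (\<lambda>u. ev g (\<lambda>v. \<phi> (u @ v)))"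
    by (simp add: ev_def sum_distrib_left mult.assoc)
  finally show "ev (conv f g) \<phi> = ev f (\<lambda>u. ev g (\<lambda>v. \<phi> (u @ v)))" .
qed

lemma fsupp_conv [simp]: "fsupp f \<Longrightarrow> fsupp g \<Longrightarrow> fsupp (conv f g)"
  by (rule finite_subset[OF conv_ev(1)]) auto

text \<open>A coefficient is the value of the functional dual to the word, so products can be
  compared through \<open>conv_ev\<close>.\<close>

lemma conv_apply:
  "fsupp f \<Longrightarrow> fsupp g \<Longrightarrow> conv f g w = ev f (\<lambda>u. ev g (\<lambda>v. if u @ v = w then 1 else 0))"
  using conv_ev(2)[of f g "\<lambda>u. if u = w then 1 else 0"] ev_delta[of "conv f g" w] by simp

lemma conv_assoc: "fsupp f \<Longrightarrow> fsupp g \<Longrightarrow> fsupp h \<Longrightarrow> conv (conv f g) h = conv f (conv g h)"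
proof (rule ext)
  fix x assume *: "fsupp f" "fsupp g" "fsupp h"
  have "conv (conv f g) h x = ev f (\<lambda>u. ev g (\<lambda>v. ev h (\<lambda>w. if (u @ v) @ w = x then 1 else 0)))"
    by (subst conv_apply[OF fsupp_conv[OF *(1,2)] *(3)], subst conv_ev(2)[OF *(1,2)]) (rule refl)
  also have "\<dots> = conv f (conv g h) x"
    by (subst conv_apply[OF *(1) fsupp_conv[OF *(2,3)]], subst conv_ev(2)[OF *(2,3)]) simp
  finally show "conv (conv f g) h x = conv f (conv g h) x" .
qed

lemma conv_mono: "conv (mono u) (mono v) = mono (u @ v)"
  by (rule ext) (simp add: conv_apply, auto simp: mono_def)

lemma conv_one: "fsupp f \<Longrightarrow> conv (mono []) f = f" "fsupp f \<Longrightarrow> conv f (mono []) = f"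
  by (rule ext, simp add: conv_apply ev_delta)+

lemma conv_mono_left: "fsupp f \<Longrightarrow> conv (mono u) f = (\<lambda>x. \<Sum>w | f w \<noteq> 0. f w * mono (u @ w) x)"
  by (rule ext) (auto simp add: conv_apply, auto simp: ev_def mono_def intro!: sum.cong)

lemma conv_add_left: "conv (\<lambda>w. f w + g w) h = (\<lambda>w. conv f h w + conv g h w)"
  by (simp add: conv_def algebra_simps sum.distrib)

lemma conv_add_right: "conv h (\<lambda>w. f w + g w) = (\<lambda>w. conv h f w + conv h g w)"
  by (simp add: conv_def algebra_simps sum.distrib)

lemma conv_fdiff_left: "conv (fdiff f g) h = fdiff (conv f h) (conv g h)"
  by (simp add: conv_def fdiff_def algebra_simps sum_subtractf)

lemma conv_fdiff_right: "conv h (fdiff f g) = fdiff (conv h f) (conv h g)"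
  by (simp add: conv_def fdiff_def algebra_simps sum_subtractf)

abbreviation FC :: "'p kgraph \<Rightarrow> ('p kpgen list \<Rightarrow> 'r::comm_ring_1) set" where
  "FC G \<equiv> carrier (free_alg G)"

lemma FC_iff: "f \<in> FC G \<longleftrightarrow> fsupp f \<and> (\<forall>w. f w \<noteq> 0 \<longrightarrow> set w \<subseteq> gens G)"
  by (simp add: free_alg_def)

lemma FC_fsupp: "f \<in> FC G \<Longrightarrow> fsupp f"
  by (simp add: FC_iff)

lemma free_alg_ops:
  "mult (free_alg G) = conv" "add (free_alg G) = (\<lambda>f g w. f w + g w)"
  "zero (free_alg G) = (\<lambda>_. 0)" "one (free_alg G) = mono []"
  by (simp_all add: free_alg_def conv_def fun_eq_iff)

lemma FC_mono: "set u \<subseteq> gens G \<Longrightarrow> mono u \<in> FC G"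
  by (auto simp: FC_iff) (auto simp: mono_def split: if_splits)

lemma FC_zero: "(\<lambda>_. 0) \<in> FC G"
  by (simp add: FC_iff)

lemma FC_combine:
  assumes "f \<in> FC G" "g \<in> FC G" and h: "\<And>w. f w = 0 \<Longrightarrow> g w = 0 \<Longrightarrow> h w = 0"
  shows "h \<in> FC G"
proof -
  have *: "f w \<noteq> 0 \<or> g w \<noteq> 0" if "h w \<noteq> 0" for w using h that by blast
  then have "{w. h w \<noteq> 0} \<subseteq> {w. f w \<noteq> 0} \<union> {w. g w \<noteq> 0}" by blast
  moreover have "set w \<subseteq> gens G" if "h w \<noteq> 0" for w
    using *[OF that] assms(1,2) unfolding FC_iff by blast
  ultimately show ?thesis
    using assms(1,2) unfolding FC_iff by (blast intro: finite_subset finite_UnI)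
qed

lemma FC_add: "f \<in> FC G \<Longrightarrow> g \<in> FC G \<Longrightarrow> (\<lambda>w. f w + g w) \<in> FC G"
  by (rule FC_combine[of f _ g]) auto

lemma FC_fdiff: "f \<in> FC G \<Longrightarrow> g \<in> FC G \<Longrightarrow> fdiff f g \<in> FC G"
  by (rule FC_combine[of f _ g]) (auto simp: fdiff_def)

lemma FC_smult: "f \<in> FC G \<Longrightarrow> (\<lambda>w. c * f w) \<in> FC G"
  by (rule FC_combine[of f _ f]) auto

lemma FC_uminus: "f \<in> FC G \<Longrightarrow> (\<lambda>w. - f w) \<in> FC G"
  by (auto simp: FC_iff)

lemma FC_sum: "(\<And>l. l \<in> S \<Longrightarrow> h l \<in> FC G) \<Longrightarrow> (\<lambda>w. \<Sum>l\<in>S. h l w) \<in> FC G"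
  by (induction S rule: infinite_finite_induct) (auto simp: FC_add FC_zero)

lemma FC_conv:
  assumes "f \<in> FC G" "g \<in> FC G"
  shows "conv f g \<in> FC G"
proof -
  have "set w \<subseteq> gens G" if "conv f g w \<noteq> 0" for w
    using conv_ev(1)[OF assms[THEN FC_fsupp]] that assms by (fastforce simp: FC_iff)
  then show ?thesis using assms by (simp add: FC_iff)
qed

lemma free_alg_ring: "ring (free_alg G :: ('p kpgen list \<Rightarrow> 'r::comm_ring_1) ring)"
proof (rule ringI)
  show "abelian_group (free_alg G :: ('p kpgen list \<Rightarrow> 'r) ring)"
  proof (rule abelian_groupI, unfold free_alg_ops)
    fix x :: "'p kpgen list \<Rightarrow> 'r" assume "x \<in> FC G"
    then show "\<exists>y\<in>FC G. (\<lambda>w. y w + x w) = (\<lambda>_. 0)"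
      by (intro bexI[of _ "\<lambda>w. - x w"]) (auto simp: FC_uminus)
  qed (auto simp: FC_add FC_zero ac_simps)
  show "monoid (free_alg G :: ('p kpgen list \<Rightarrow> 'r) ring)"
    by (rule monoidI, unfold free_alg_ops)
      (auto simp: FC_conv FC_mono conv_assoc conv_one FC_fsupp)
qed (auto simp: free_alg_ops conv_add_left conv_add_right)

lemma free_alg_idealI:
  assumes N: "N \<subseteq> FC G" "(\<lambda>_. 0) \<in> N"
    and "\<And>f g. f \<in> N \<Longrightarrow> g \<in> N \<Longrightarrow> (\<lambda>w. f w + g w) \<in> N"
    and neg: "\<And>f. f \<in> N \<Longrightarrow> (\<lambda>w. - f w) \<in> N"
    and "\<And>f g. f \<in> N \<Longrightarrow> g \<in> FC G \<Longrightarrow> conv f g \<in> N"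
    and "\<And>f g. f \<in> N \<Longrightarrow> g \<in> FC G \<Longrightarrow> conv g f \<in> N"
  shows "ideal N (free_alg G)"
proof -
  interpret F: ring "free_alg G" by (rule free_alg_ring)
  have inv: "inv\<^bsub>add_monoid (free_alg G)\<^esub> f = (\<lambda>w. - f w)" if "f \<in> FC G" for f
    using F.minus_equality[of "\<lambda>w. - f w" f] that FC_uminus[OF that]
    by (simp add: free_alg_ops a_inv_def)
  show ?thesis
  proof (rule idealI[OF free_alg_ring])
    show "subgroup N (add_monoid (free_alg G))"
    proof (rule group.subgroupI[OF F.a_group])
      show "inv\<^bsub>add_monoid (free_alg G)\<^esub> f \<in> N" if "f \<in> N" for f
        using inv[of f] neg[OF that] that N(1) by auto
    qed (use assms in \<open>auto simp: free_alg_ops\<close>)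
  qed (use assms in \<open>auto simp: free_alg_ops\<close>)
qed

section \<open>Generators and defining relations inside the free algebra\<close>

context kgraph
begin

lemma gw_gens: "l \<in> paths G \<Longrightarrow> gw G l \<in> gens G" "l \<in> paths G \<Longrightarrow> gws G l \<in> gens G"
  by (auto simp: gw_def gws_def gens_def verts_def)

lemma Pv_gens: "v \<in> verts G \<Longrightarrow> Pv v \<in> gens G"
  by (simp add: gens_def)

lemma gw_vert: "v \<in> verts G \<Longrightarrow> gw G v = Pv v" "v \<in> verts G \<Longrightarrow> gws G v = Pv v"
  by (simp_all add: gw_def gws_def vertsD)

lemma kp_relsE:
  assumes "f \<in> kp_rels G"
  obtains (KP1) v w where "v \<in> verts G" "w \<in> verts G"
      "f = fdiff (mono [Pv v, Pv w]) (if v = w then mono [Pv v] else (\<lambda>_. 0))"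
  | (KP2) l m where "l \<in> paths G" "m \<in> paths G" "src G l = rng G m"
      "f = fdiff (mono [gw G l, gw G m]) (mono [gw G (cmp G l m)])"
  | (KP2') l m where "l \<in> paths G" "m \<in> paths G" "src G l = rng G m"
      "f = fdiff (mono [gws G m, gws G l]) (mono [gws G (cmp G l m)])"
  | (KP2_rng) l where "l \<in> paths G" "f = fdiff (mono [Pv (rng G l), gw G l]) (mono [gw G l])"
  | (KP2_src) l where "l \<in> paths G" "f = fdiff (mono [gw G l, Pv (src G l)]) (mono [gw G l])"
  | (KP2_src') l where "l \<in> paths G" "f = fdiff (mono [Pv (src G l), gws G l]) (mono [gws G l])"
  | (KP2_rng') l where "l \<in> paths G" "f = fdiff (mono [gws G l, Pv (rng G l)]) (mono [gws G l])"
  | (KP3) l m n where "n \<in> Nk (kdim G)" "n \<noteq> (\<lambda>_. 0)" "l \<in> le_paths G n" "m \<in> le_paths G n"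
      "f = fdiff (mono [gws G l, gw G m]) (if l = m then mono [Pv (src G l)] else (\<lambda>_. 0))"
  | (KP4) v n where "v \<in> verts G" "n \<in> Nk (kdim G)" "n \<noteq> (\<lambda>_. 0)"
      "f = fdiff (mono [Pv v]) (\<lambda>u. \<Sum>l\<in>{l \<in> le_paths G n. rng G l = v}. mono [gw G l, gws G l] u)"
  using assms unfolding kp_rels_def by (elim UnE CollectE exE conjE) (assumption | metis)+

lemma kp_rels_FC: "kp_rels G \<subseteq> FC G"
proof
  fix f :: "'p kpgen list \<Rightarrow> 'r::comm_ring_1" assume "f \<in> kp_rels G"
  then show "f \<in> FC G"
  proof (cases rule: kp_relsE)
    case (KP1 v w)
    then show ?thesis by (auto intro!: FC_fdiff FC_mono FC_zero simp: Pv_gens)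
  next
    case (KP3 l m n)
    then have "l \<in> paths G" "m \<in> paths G" by (auto simp: le_paths_iff)
    with KP3(5) show ?thesis by (auto intro!: FC_fdiff FC_mono FC_zero simp: Pv_gens gw_gens)
  next
    case (KP4 v n)
    have "l \<in> paths G" if "l \<in> le_paths G n" for l using that by (simp add: le_paths_iff)
    with KP4(1,4) show ?thesis by (auto intro!: FC_fdiff FC_mono FC_sum simp: Pv_gens gw_gens)
  qed (auto intro!: FC_fdiff FC_mono simp: Pv_gens gw_gens)
qed

lemma ideal_I: "ideal (kp_rel_ideal G) (free_alg G)"
  unfolding kp_rel_ideal_def by (rule ring.genideal_ideal[OF free_alg_ring kp_rels_FC])

lemma I_minimal: "ideal N (free_alg G) \<Longrightarrow> kp_rels G \<subseteq> N \<Longrightarrow> kp_rel_ideal G \<subseteq> N"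
  unfolding kp_rel_ideal_def by (rule ring.genideal_minimal[OF free_alg_ring])

lemma I_rel: "f \<in> kp_rels G \<Longrightarrow> f \<in> kp_rel_ideal G"
  unfolding kp_rel_ideal_def using ring.genideal_self[OF free_alg_ring kp_rels_FC] by blast

end

section \<open>The representation on boundary paths\<close>

text \<open>A word acts like a product of operators, the last letter first. \<open>None\<close>
  stands for the zero vector.\<close>

fun act_word :: "('g \<Rightarrow> 'b \<Rightarrow> 'b option) \<Rightarrow> 'g list \<Rightarrow> 'b \<Rightarrow> 'b option" where
  "act_word a [] y = Some y"
| "act_word a (g # w) y = Option.bind (act_word a w y) (a g)"

lemma act_word_append: "act_word a (u @ v) y = Option.bind (act_word a v y) (act_word a u)"
  by (induction u) (cases "act_word a v y"; auto)+

text \<open>A functional on the free module with basis \<open>'b\<close>, evaluated at a basis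
  vector or at zero.\<close>

definition val :: "('b \<Rightarrow> 'r::comm_ring_1) \<Rightarrow> 'b option \<Rightarrow> 'r" where
  "val \<phi> o' = (case o' of None \<Rightarrow> 0 | Some y \<Rightarrow> \<phi> y)"

lemma val_simps [simp]: "val \<phi> None = 0" "val \<phi> (Some y) = \<phi> y"
  by (simp_all add: val_def)

lemma option_eqI: "(\<And>x. a = Some x \<longleftrightarrow> b = Some x) \<Longrightarrow> a = b"
  by (metis option.exhaust)

text \<open>The annihilator of that free module, expressed by matrix coefficients: f acts as zero if
  every functional vanishes on the image of every basis vector.\<close>

definition act_kernel :: "'p kgraph \<Rightarrow> ('p kpgen \<Rightarrow> 'b \<Rightarrow> 'b option) \<Rightarrow> ('p kpgen list \<Rightarrow> 'r::comm_ring_1) set" where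
  "act_kernel G a = {f \<in> FC G. \<forall>\<phi> y. ev f (\<lambda>w. val \<phi> (act_word a w y)) = 0}"

lemma ideal_act_kernel:
  "ideal (act_kernel G a :: ('p kpgen list \<Rightarrow> 'r::comm_ring_1) set) (free_alg G)"
proof (rule free_alg_idealI)
  fix f g :: "'p kpgen list \<Rightarrow> 'r" assume f: "f \<in> act_kernel G a" and g: "g \<in> FC G"
  have fin: "fsupp f" "fsupp g" "f \<in> FC G" using f g by (auto simp: act_kernel_def FC_iff)
  have f0: "ev f (\<lambda>w. val \<phi> (act_word a w y)) = 0" for \<phi> y
    using f by (simp add: act_kernel_def)
  have "ev (conv f g) (\<lambda>w. val \<phi> (act_word a w y)) = 0" for \<phi> y
  proof -
    \<comment> \<open>In the product f g, the words of g first move y to another basis vector or to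
      zero, and f kills both.\<close>
    have "ev f (\<lambda>u. val \<phi> (Option.bind (act_word a v y) (act_word a u))) = 0" for v
      by (cases "act_word a v y") (simp_all add: f0)
    then show ?thesis
      unfolding conv_ev(2)[OF fin(1,2)] ev_swap[OF fin(1,2)] act_word_append by simp
  qed
  then show "conv f g \<in> act_kernel G a" using fin g by (simp add: act_kernel_def FC_conv)
  have "ev (conv g f) (\<lambda>w. val \<phi> (act_word a w y)) = 0" for \<phi> y
  proof -
    \<comment> \<open>In the product g f, the action of a word of g is absorbed into the
      functional.\<close>
    have b: "val \<phi> (Option.bind z (act_word a u)) = val (\<lambda>x. val \<phi> (act_word a u x)) z" for u z
      by (cases z) simp_all
    show ?thesis
      unfolding conv_ev(2)[OF fin(2,1)] act_word_append b f0 by simp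
  qed
  then show "conv g f \<in> act_kernel G a" using fin g by (simp add: act_kernel_def FC_conv)
qed (auto simp: act_kernel_def FC_zero FC_add FC_uminus ev_add ev_uminus FC_fsupp)

locale lc_kgraph = kgraph G for G :: "'p kgraph" +
  assumes row_finite: "row_finite G" and locally_convex: "locally_convex G"
begin

definition bpaths :: "'p bpath set" where
  "bpaths = {y. gpath y \<and> terminal y}"

lemma bpathsD: "y \<in> bpaths \<Longrightarrow> gpath y" "y \<in> bpaths \<Longrightarrow> terminal y"
  by (simp_all add: bpaths_def)

lemma boundary_path_bpaths: "boundary_path G y \<longleftrightarrow> y \<in> bpaths"
  by (simp add: bpaths_def boundary_path_iff)

text \<open>Prepending and removing l are converse relations, so s_l and s_l^* use the same
  \<open>is_concat\<close> with arguments exchanged.\<close>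

fun act_rel :: "'p kpgen \<Rightarrow> 'p bpath \<Rightarrow> 'p bpath \<Rightarrow> bool" where
  "act_rel (Pv v) y x \<longleftrightarrow> y \<in> bpaths \<and> x = y \<and> bp_range y = v"
| "act_rel (Sg l) y x \<longleftrightarrow> y \<in> bpaths \<and> x \<in> bpaths \<and> is_concat l y x"
| "act_rel (Ss l) y x \<longleftrightarrow> y \<in> bpaths \<and> x \<in> bpaths \<and> is_concat l x y"

definition act :: "'p kpgen \<Rightarrow> 'p bpath \<Rightarrow> 'p bpath option" where
  "act g y = (if \<exists>x. act_rel g y x then Some (THE x. act_rel g y x) else None)"

lemma act_rel_unique: "act_rel g y x \<Longrightarrow> act_rel g y x' \<Longrightarrow> x = x'"
  by (cases g) (auto dest: bpathsD intro: is_concat_unique is_concat_cancel)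

lemma act_iff: "act g y = Some x \<longleftrightarrow> act_rel g y x"
proof -
  have "(THE x. act_rel g y x) = z" if "act_rel g y z" for z
    using that act_rel_unique by (blast intro: the_equality)
  then show ?thesis unfolding act_def by (metis option.distinct(1) option.inject)
qed

text \<open>Vertices act as range projections, in agreement with the convention s_v = s_{v^*} = p_v
  that \<open>gw\<close> and \<open>gws\<close> encode.\<close>

lemma is_concat_vert:
  assumes "v \<in> verts G" "y \<in> bpaths" "x \<in> bpaths"
  shows "is_concat v y x \<longleftrightarrow> x = y \<and> bp_range y = v"
proof -
  have *: "is_concat v y y" if "bp_range y = v"
    using that assms by (simp add: is_concat_def vertsD bp_range_def enat_0)
  have "x = y \<and> bp_range y = v" if c: "is_concat v y x"
  proof -
    have r: "bp_range y = v"
      using is_concat_ends(3)[OF bpathsD(1)[OF assms(3)] c] assms(1) by simp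
    show "x = y \<and> bp_range y = v"
      using is_concat_unique[OF bpathsD(1)[OF assms(3)] bpathsD(1)[OF assms(2)] bpathsD(1)[OF assms(2)] c *[OF r]] r
      by simp
  qed
  with * show ?thesis by blast
qed

lemma act_gw:
  assumes "l \<in> paths G"
  shows "act (gw G l) y = Some x \<longleftrightarrow> y \<in> bpaths \<and> x \<in> bpaths \<and> is_concat l y x"
    "act (gws G l) y = Some x \<longleftrightarrow> y \<in> bpaths \<and> x \<in> bpaths \<and> is_concat l x y"
proof -
  have "act (gw G l) y = Some x \<longleftrightarrow> act_rel (Sg l) y x" "act (gws G l) y = Some x \<longleftrightarrow> act_rel (Ss l) y x"
    if "l \<in> verts G"
    unfolding act_iff gw_vert[OF that] act_rel.simps using is_concat_vert[OF that] by blast+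
  moreover have "gw G l = Sg l" "gws G l = Ss l" if "l \<notin> verts G"
    using assms that by (auto simp: gw_def gws_def verts_def)
  ultimately have "act (gw G l) y = Some x \<longleftrightarrow> act_rel (Sg l) y x"
    "act (gws G l) y = Some x \<longleftrightarrow> act_rel (Ss l) y x"
    unfolding act_iff by (cases "l \<in> verts G"; simp)+
  then show "act (gw G l) y = Some x \<longleftrightarrow> y \<in> bpaths \<and> x \<in> bpaths \<and> is_concat l y x"
    "act (gws G l) y = Some x \<longleftrightarrow> y \<in> bpaths \<and> x \<in> bpaths \<and> is_concat l x y" by simp_all
qed

lemma act_Pv: "act (Pv v) y = Some x \<longleftrightarrow> y \<in> bpaths \<and> x = y \<and> bp_range y = v"
  by (simp add: act_iff)

lemma concat_ex:
  assumes "y \<in> bpaths" "l \<in> paths G" "src G l = bp_range y"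
  shows "\<exists>z\<in>bpaths. is_concat l y z"
  using concat_exists[OF locally_convex _ _ assms(2,3)] assms(1) by (auto simp: bpaths_def)

text \<open>Right to left is associativity. Conversely, form m y and then l (m y); uniqueness
  identifies the result with x.\<close>

lemma is_concat_cmp:
  assumes "y \<in> bpaths" "x \<in> bpaths" "l \<in> paths G" "m \<in> paths G" "src G l = rng G m"
  shows "is_concat (cmp G l m) y x \<longleftrightarrow> (\<exists>z\<in>bpaths. is_concat m y z \<and> is_concat l z x)"
proof
  assume c: "is_concat (cmp G l m) y x"
  note e = is_concat_ends[OF bpathsD(1)[OF assms(2)] c]
  obtain z where z: "z \<in> bpaths" "is_concat m y z"
    using concat_ex[OF assms(1,4)] e(3) path_cmp(3)[OF assms(3-5)] by auto
  obtain u where u: "u \<in> bpaths" "is_concat l z u"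
    using concat_ex[OF z(1) assms(3)] is_concat_ends(2)[OF bpathsD(1)[OF z(1)] z(2)] assms(5) by auto
  have "is_concat (cmp G l m) y u"
    by (rule is_concat_assoc[OF bpathsD(1)[OF u(1)] z(2) u(2) assms(3-5)])
  then have "u = x" using is_concat_unique[OF _ _ _ _ c] u(1) assms(1,2) bpathsD(1) by blast
  then show "\<exists>z\<in>bpaths. is_concat m y z \<and> is_concat l z x" using z u by blast
qed (use is_concat_assoc assms bpathsD(1) in blast)

lemma is_concat_rng: "x \<in> bpaths \<Longrightarrow> is_concat l y x \<Longrightarrow> bp_range x = rng G l"
  "x \<in> bpaths \<Longrightarrow> is_concat l y x \<Longrightarrow> bp_range y = src G l"
  using is_concat_ends bpathsD by metis+

lemma act_word_Some:
  "act_word act [g] y = Some x \<longleftrightarrow> act g y = Some x"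
  "act_word act [g, h] y = Some x \<longleftrightarrow> (\<exists>z. act h y = Some z \<and> act g z = Some x)"
  by (simp_all add: bind_eq_Some_conv)

text \<open>Except for (KP4), each relation compares a word with another word or with zero, that is,
  two partial maps. (KP3) for different paths and (KP4) rest on the unique initial segment in
  \<open>le_paths G n\<close>.\<close>

lemma kp_rels_act_kernel: "kp_rels G \<subseteq> act_kernel G act"
proof
  fix f :: "'p kpgen list \<Rightarrow> 'r::comm_ring_1" assume f: "f \<in> kp_rels G"
  have eq: "ev (fdiff (mono u) (mono v)) (\<lambda>w. val \<phi> (act_word act w y)) = 0"
    if "\<And>x. act_word act u y = Some x \<longleftrightarrow> act_word act v y = Some x"
    for u v y and \<phi> :: "'p bpath \<Rightarrow> 'r"
    using option_eqI[OF that] by (simp add: ev_fdiff)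
  have eq0: "ev (fdiff (mono u) (\<lambda>_. 0)) (\<lambda>w. val \<phi> (act_word act w y)) = 0"
    if "\<And>x. act_word act u y \<noteq> Some x" for u y and \<phi> :: "'p bpath \<Rightarrow> 'r"
  proof -
    have "act_word act u y = None" using that by (meson not_None_eq)
    then show ?thesis by (simp add: ev_fdiff)
  qed
  have "ev f (\<lambda>w. val \<phi> (act_word act w y)) = 0" for \<phi> y
    using f
  proof (cases rule: kp_relsE)
    case (KP1 v w)
    show ?thesis
    proof (cases "v = w")
      case True
      then show ?thesis unfolding KP1(3) if_P[OF True]
        by (intro eq) (unfold act_word_Some act_Pv, blast)
    next
      case False
      then show ?thesis unfolding KP1(3) if_not_P[OF False]
        by (intro eq0) (unfold act_word_Some act_Pv, blast)
    qed
  next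
    case (KP2 l m)
    note g = act_gw[OF KP2(1)] act_gw[OF KP2(2)] act_gw[OF path_cmp(1)[OF KP2(1-3)]]
    show ?thesis unfolding KP2(4)
      by (rule eq) (use is_concat_cmp[OF _ _ KP2(1-3)] in \<open>unfold act_word_Some g, blast\<close>)
  next
    case (KP2' l m)
    note g = act_gw[OF KP2'(1)] act_gw[OF KP2'(2)] act_gw[OF path_cmp(1)[OF KP2'(1-3)]]
    show ?thesis unfolding KP2'(4)
      by (rule eq) (use is_concat_cmp[OF _ _ KP2'(1-3)] in \<open>unfold act_word_Some g, blast\<close>)
  next
    case (KP2_rng l)
    show ?thesis unfolding KP2_rng(2)
      by (rule eq) (use is_concat_rng in \<open>unfold act_word_Some act_gw[OF KP2_rng(1)] act_Pv, blast\<close>)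
  next
    case (KP2_src l)
    show ?thesis unfolding KP2_src(2)
      by (rule eq) (use is_concat_rng in \<open>unfold act_word_Some act_gw[OF KP2_src(1)] act_Pv, blast\<close>)
  next
    case (KP2_src' l)
    show ?thesis unfolding KP2_src'(2)
      by (rule eq) (use is_concat_rng in \<open>unfold act_word_Some act_gw[OF KP2_src'(1)] act_Pv, blast\<close>)
  next
    case (KP2_rng' l)
    show ?thesis unfolding KP2_rng'(2)
      by (rule eq) (use is_concat_rng in \<open>unfold act_word_Some act_gw[OF KP2_rng'(1)] act_Pv, blast\<close>)
  next
    case (KP3 l m n)
    have lm: "l \<in> paths G" "m \<in> paths G" using KP3 by (auto simp: le_paths_iff)
    show ?thesis
    proof (cases "l = m")
      case True
      have "act_word act [gws G l, gw G m] y = Some x \<longleftrightarrow> act_word act [Pv (src G l)] y = Some x" for x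
      proof -
        have "(\<exists>z. z \<in> bpaths \<and> is_concat l y z \<and> is_concat l x z) \<longleftrightarrow> x = y \<and> bp_range y = src G l"
          if "y \<in> bpaths" "x \<in> bpaths"
          using that concat_ex[OF that(1) lm(1)] is_concat_cancel[OF bpathsD(1)[OF that(2)] bpathsD(1)[OF that(1)]]
            is_concat_rng(2) by metis
        moreover have "gw G m = gw G l" using True by simp
        ultimately show ?thesis unfolding act_word_Some act_Pv act_gw[OF lm(1)] by (metis act_gw(1)[OF lm(1)])
      qed
      then show ?thesis unfolding KP3(5) if_P[OF True] by (rule eq)
    next
      case False
      have "act_word act [gws G l, gw G m] y \<noteq> Some x" for x
      proof
        assume "act_word act [gws G l, gw G m] y = Some x"
        then obtain z where "y \<in> bpaths" "z \<in> bpaths" "x \<in> bpaths" "is_concat m y z" "is_concat l x z"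
          unfolding act_word_Some act_gw(1)[OF lm(2)] act_gw(2)[OF lm(1)] by blast
        then show False
          using concat_le_paths_unique[OF _ _ _ _ _ KP3(3,4,1)] False bpathsD(1) by blast
      qed
      then show ?thesis unfolding KP3(5) if_not_P[OF False] by (rule eq0)
    qed
  next
    case (KP4 v n)
    let ?L = "{l \<in> le_paths G n. rng G l = v}"
    have fin: "finite ?L" by (rule finite_le_paths[OF row_finite KP4(1,2)])
    have L: "l \<in> paths G" if "l \<in> ?L" for l using that by (simp add: le_paths_iff)
    \<comment> \<open>s_l s_l^* acts as the projection onto the boundary paths that begin with
      l.\<close>
    have w: "act_word act [gw G l, gws G l] y = (if y \<in> bpaths \<and> (\<exists>z\<in>bpaths. is_concat l z y) then Some y else None)"
      if "l \<in> ?L" for l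
    proof (rule option_eqI)
      fix x
      have "(\<exists>z. z \<in> bpaths \<and> is_concat l z y \<and> is_concat l z x) \<longleftrightarrow> x = y \<and> (\<exists>z\<in>bpaths. is_concat l z y)"
        if "y \<in> bpaths" "x \<in> bpaths"
        using is_concat_unique[OF bpathsD(1)[OF that(1)] bpathsD(1)[OF that(2)]] bpathsD(1) by blast
      then show "act_word act [gw G l, gws G l] y = Some x \<longleftrightarrow>
          (if y \<in> bpaths \<and> (\<exists>z\<in>bpaths. is_concat l z y) then Some y else None) = Some x"
        unfolding act_word_Some act_gw[OF L[OF that]] by (metis option.distinct(1) option.inject)
    qed
    have "(\<Sum>l\<in>?L. val \<phi> (act_word act [gw G l, gws G l] y)) = val \<phi> (act_word act [Pv v] y)"
    proof (cases "y \<in> bpaths \<and> bp_range y = v")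
      case True
      then obtain l z where l: "l \<in> le_paths G n" "z \<in> bpaths" "is_concat l z y"
        using le_paths_initial[of y n] by (auto simp: bpaths_def)
      have rl: "rng G l = v" using True l(3) is_concat_rng(1)[of y l z] by simp
      have "val \<phi> (act_word act [gw G m, gws G m] y) = (if m = l then \<phi> y else 0)" if m: "m \<in> ?L" for m
      proof -
        \<comment> \<open>Exactly one of these projections fixes y; the others send it to
          zero.\<close>
        have "(\<exists>z\<in>bpaths. is_concat m z y) \<longleftrightarrow> m = l"
          using concat_le_paths_unique[OF _ _ _ _ l(3) _ l(1) KP4(2)] l m True bpathsD(1) by blast
        then show ?thesis unfolding w[OF m] using True by simp
      qed
      then have "(\<Sum>m\<in>?L. val \<phi> (act_word act [gw G m, gws G m] y)) = (\<Sum>m\<in>?L. if m = l then \<phi> y else 0)"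
        by (rule sum.cong[OF refl])
      also have "\<dots> = \<phi> y" using l rl fin by simp
      also have "act_word act [Pv v] y = Some y" using True unfolding act_word_Some act_Pv by simp
      ultimately show ?thesis by simp
    next
      case False
      have "val \<phi> (act_word act [gw G m, gws G m] y) = 0" if m: "m \<in> ?L" for m
      proof -
        have "\<not> (y \<in> bpaths \<and> (\<exists>z\<in>bpaths. is_concat m z y))"
          using m False is_concat_rng(1)[of y m] by blast
        then show ?thesis unfolding w[OF m] by (simp only: if_False val_simps)
      qed
      moreover have "act_word act [Pv v] y = None"
        using False by (intro option_eqI) (unfold act_word_Some act_Pv, auto)
      ultimately show ?thesis by simp
    qed
    then show ?thesis unfolding KP4(4) by (simp add: ev_fdiff fsupp_sum fin ev_sum)
  qed
  then show "f \<in> act_kernel G act" using f kp_rels_FC by (auto simp: act_kernel_def)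
qed

text \<open>The action descends to the quotient; a nonzero coefficient on some boundary path thus
  shows that an element lies outside the relation ideal.\<close>

lemma I_act:
  assumes "f \<in> kp_rel_ideal G"
  shows "ev f (\<lambda>w. val \<phi> (act_word act w y)) = 0"
  using subsetD[OF I_minimal[OF ideal_act_kernel kp_rels_act_kernel] assms]
  unfolding act_kernel_def by blast

end

section \<open>The involution, and congruence of words\<close>

fun star_gen :: "'p kpgen \<Rightarrow> 'p kpgen" where
  "star_gen (Pv v) = Pv v"
| "star_gen (Sg l) = Ss l"
| "star_gen (Ss l) = Sg l"

text \<open>The R-linear involution that sends s_a s_b^* to s_b s_a^*. As the map on words is its
  own inverse, the image is obtained by evaluating f at the starred word.\<close>

definition star :: "('p kpgen list \<Rightarrow> 'r::comm_ring_1) \<Rightarrow> 'p kpgen list \<Rightarrow> 'r" where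
  "star f = (\<lambda>w. f (rev (map star_gen w)))"

lemma star_gen_idem [simp]: "star_gen (star_gen g) = g"
  by (cases g) auto

lemma star_gen_comp [simp]: "star_gen \<circ> star_gen = id"
  by auto

lemma star_word_idem [simp]: "rev (map star_gen (rev (map star_gen w))) = w"
  by (simp add: rev_map)

lemma star_star [simp]: "star (star f) = f"
  unfolding star_def star_word_idem ..

lemma star_word_eq: "rev (map star_gen u) = w \<longleftrightarrow> u = rev (map star_gen w)"
  by (metis star_word_idem)

lemma star_mono: "star (mono u) = mono (rev (map star_gen u))"
  by (simp add: star_def mono_def fun_eq_iff star_word_eq)

lemma star_fdiff: "star (fdiff f g) = fdiff (star f) (star g)"
  by (simp add: star_def fdiff_def)

lemma star_zero [simp]: "star (\<lambda>_. 0) = (\<lambda>_. 0)"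
  by (simp add: star_def)

lemma star_supp: "{w. star f w \<noteq> 0} = (\<lambda>w. rev (map star_gen w)) ` {w. f w \<noteq> 0}"
proof -
  have "w \<in> (\<lambda>w. rev (map star_gen w)) ` {w. f w \<noteq> 0}" if "f (rev (map star_gen w)) \<noteq> 0" for w
    by (rule image_eqI[of _ _ "rev (map star_gen w)"]) (use that in simp_all)
  moreover have "f (rev (map star_gen (rev (map star_gen w)))) = f w" for w by (simp only: star_word_idem)
  ultimately show ?thesis unfolding star_def by auto
qed

lemma fsupp_star: "fsupp f \<Longrightarrow> fsupp (star f)"
  by (simp add: star_supp)

lemma ev_star: "ev (star f) \<phi> = ev f (\<lambda>w. \<phi> (rev (map star_gen w)))"
proof -
  have inj: "inj_on (\<lambda>w. rev (map star_gen w)) {w. f w \<noteq> 0}"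
    by (rule inj_on_inverseI[of _ "\<lambda>w. rev (map star_gen w)"]) (rule star_word_idem)
  show ?thesis unfolding ev_def star_supp
    by (subst sum.reindex[OF inj], unfold comp_def star_def star_word_idem) (rule refl)
qed

lemma star_conv:
  fixes f g :: "'p kpgen list \<Rightarrow> 'r::comm_ring_1"
  assumes "fsupp f" "fsupp g"
  shows "star (conv f g) = conv (star g) (star f)"
proof
  fix w :: "'p kpgen list"
  have "(rev (map star_gen v) @ rev (map star_gen u) = w) = (u @ v = rev (map star_gen w))" for u v
    using star_word_eq[of "u @ v" w] by simp
  then show "star (conv f g) w = conv (star g) (star f) w"
    unfolding star_def[of "conv f g"] conv_apply[OF assms] ev_star
      conv_apply[OF fsupp_star[OF assms(2)] fsupp_star[OF assms(1)]] ev_swap[OF assms]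
    by (simp only:)
qed

lemma star_gen_gens: "g \<in> gens G \<Longrightarrow> star_gen g \<in> gens G"
  by (auto simp: gens_def)

lemma FC_star:
  assumes "f \<in> FC G"
  shows "star f \<in> FC G"
proof -
  have "set w \<subseteq> gens G" if "star f w \<noteq> 0" for w
  proof -
    have "set (rev (map star_gen w)) \<subseteq> gens G" using that assms unfolding star_def FC_iff by blast
    then have "star_gen ` set w \<subseteq> gens G" by simp
    then show ?thesis using star_gen_gens star_gen_idem by (metis image_subset_iff subsetI)
  qed
  then show ?thesis using assms by (simp add: FC_iff fsupp_star)
qed

context kgraph
begin

lemma
  shows rel_KP1: "v \<in> verts G \<Longrightarrow> w \<in> verts G \<Longrightarrow>
    fdiff (mono [Pv v, Pv w]) (if v = w then mono [Pv v] else (\<lambda>_. 0)) \<in> kp_rels G"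
    and rel_KP2: "l \<in> paths G \<Longrightarrow> m \<in> paths G \<Longrightarrow> src G l = rng G m \<Longrightarrow>
    fdiff (mono [gw G l, gw G m]) (mono [gw G (cmp G l m)]) \<in> kp_rels G"
    and rel_KP2': "l \<in> paths G \<Longrightarrow> m \<in> paths G \<Longrightarrow> src G l = rng G m \<Longrightarrow>
    fdiff (mono [gws G m, gws G l]) (mono [gws G (cmp G l m)]) \<in> kp_rels G"
    and rel_KP2_rng: "l \<in> paths G \<Longrightarrow>
    fdiff (mono [Pv (rng G l), gw G l]) (mono [gw G l]) \<in> kp_rels G"
    and rel_KP2_src: "l \<in> paths G \<Longrightarrow>
    fdiff (mono [gw G l, Pv (src G l)]) (mono [gw G l]) \<in> kp_rels G"
    and rel_KP2_src': "l \<in> paths G \<Longrightarrow>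
    fdiff (mono [Pv (src G l), gws G l]) (mono [gws G l]) \<in> kp_rels G"
    and rel_KP2_rng': "l \<in> paths G \<Longrightarrow>
    fdiff (mono [gws G l, Pv (rng G l)]) (mono [gws G l]) \<in> kp_rels G"
    and rel_KP3: "n \<in> Nk (kdim G) \<Longrightarrow> n \<noteq> (\<lambda>_. 0) \<Longrightarrow> l \<in> le_paths G n \<Longrightarrow> m \<in> le_paths G n \<Longrightarrow>
    fdiff (mono [gws G l, gw G m]) (if l = m then mono [Pv (src G l)] else (\<lambda>_. 0)) \<in> kp_rels G"
    and rel_KP4: "v \<in> verts G \<Longrightarrow> n \<in> Nk (kdim G) \<Longrightarrow> n \<noteq> (\<lambda>_. 0) \<Longrightarrow>
    fdiff (mono [Pv v]) (\<lambda>u. \<Sum>l\<in>{l \<in> le_paths G n. rng G l = v}. mono [gw G l, gws G l] u) \<in> kp_rels G"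
proof -
  show "v \<in> verts G \<Longrightarrow> w \<in> verts G \<Longrightarrow>
    fdiff (mono [Pv v, Pv w]) (if v = w then mono [Pv v] else (\<lambda>_. 0)) \<in> kp_rels G"
    unfolding kp_rels_def by (rule UnI1, rule UnI1, rule UnI1, rule UnI1, rule UnI1, rule UnI1, rule UnI1, rule UnI1, blast)
  show "l \<in> paths G \<Longrightarrow> m \<in> paths G \<Longrightarrow> src G l = rng G m \<Longrightarrow>
    fdiff (mono [gw G l, gw G m]) (mono [gw G (cmp G l m)]) \<in> kp_rels G"
    unfolding kp_rels_def by (rule UnI1, rule UnI1, rule UnI1, rule UnI1, rule UnI1, rule UnI1, rule UnI1, rule UnI2, blast)
  show "l \<in> paths G \<Longrightarrow> m \<in> paths G \<Longrightarrow> src G l = rng G m \<Longrightarrow>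
    fdiff (mono [gws G m, gws G l]) (mono [gws G (cmp G l m)]) \<in> kp_rels G"
    unfolding kp_rels_def by (rule UnI1, rule UnI1, rule UnI1, rule UnI1, rule UnI1, rule UnI1, rule UnI2, blast)
  show "l \<in> paths G \<Longrightarrow>
    fdiff (mono [Pv (rng G l), gw G l]) (mono [gw G l]) \<in> kp_rels G"
    unfolding kp_rels_def by (rule UnI1, rule UnI1, rule UnI1, rule UnI1, rule UnI1, rule UnI2, blast)
  show "l \<in> paths G \<Longrightarrow>
    fdiff (mono [gw G l, Pv (src G l)]) (mono [gw G l]) \<in> kp_rels G"
    unfolding kp_rels_def by (rule UnI1, rule UnI1, rule UnI1, rule UnI1, rule UnI2, blast)
  show "l \<in> paths G \<Longrightarrow>
    fdiff (mono [Pv (src G l), gws G l]) (mono [gws G l]) \<in> kp_rels G"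
    unfolding kp_rels_def by (rule UnI1, rule UnI1, rule UnI1, rule UnI2, blast)
  show "l \<in> paths G \<Longrightarrow>
    fdiff (mono [gws G l, Pv (rng G l)]) (mono [gws G l]) \<in> kp_rels G"
    unfolding kp_rels_def by (rule UnI1, rule UnI1, rule UnI2, blast)
  show "n \<in> Nk (kdim G) \<Longrightarrow> n \<noteq> (\<lambda>_. 0) \<Longrightarrow> l \<in> le_paths G n \<Longrightarrow> m \<in> le_paths G n \<Longrightarrow>
    fdiff (mono [gws G l, gw G m]) (if l = m then mono [Pv (src G l)] else (\<lambda>_. 0)) \<in> kp_rels G"
    unfolding kp_rels_def by (rule UnI1, rule UnI2, blast)
  show "v \<in> verts G \<Longrightarrow> n \<in> Nk (kdim G) \<Longrightarrow> n \<noteq> (\<lambda>_. 0) \<Longrightarrow>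
    fdiff (mono [Pv v]) (\<lambda>u. \<Sum>l\<in>{l \<in> le_paths G n. rng G l = v}. mono [gw G l, gws G l] u) \<in> kp_rels G"
    unfolding kp_rels_def by (rule UnI2, blast)
qed

lemma star_gen_gw [simp]: "star_gen (gw G l) = gws G l" "star_gen (gws G l) = gw G l"
  by (simp_all add: gw_def gws_def)

text \<open>The involution exchanges the two halves of (KP2), swaps the two indices in (KP1) and
  (KP3), and fixes (KP4).\<close>

lemma star_kp_rels:
  fixes f :: "'p kpgen list \<Rightarrow> 'r::comm_ring_1"
  assumes "f \<in> kp_rels G"
  shows "star f \<in> kp_rels G"
  using assms
proof (cases rule: kp_relsE)
  case (KP1 v w)
  have "star f = fdiff (mono [Pv w, Pv v]) (if w = v then mono [Pv w] else (\<lambda>_. 0))"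
    unfolding KP1(3) by (simp add: star_fdiff star_mono)
  then show ?thesis using rel_KP1[OF KP1(2,1)] by (simp only:)
next
  case (KP2 l m)
  show ?thesis using rel_KP2'[OF KP2(1-3)] by (simp add: KP2(4) star_fdiff star_mono)
next
  case (KP2' l m)
  show ?thesis using rel_KP2[OF KP2'(1-3)] by (simp add: KP2'(4) star_fdiff star_mono)
next
  case (KP2_rng l)
  show ?thesis using rel_KP2_rng'[OF KP2_rng(1)] by (simp add: KP2_rng(2) star_fdiff star_mono)
next
  case (KP2_src l)
  show ?thesis using rel_KP2_src'[OF KP2_src(1)] by (simp add: KP2_src(2) star_fdiff star_mono)
next
  case (KP2_src' l)
  show ?thesis using rel_KP2_src[OF KP2_src'(1)] by (simp add: KP2_src'(2) star_fdiff star_mono)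
next
  case (KP2_rng' l)
  show ?thesis using rel_KP2_rng[OF KP2_rng'(1)] by (simp add: KP2_rng'(2) star_fdiff star_mono)
next
  case (KP3 l m n)
  have "star f = fdiff (mono [gws G m, gw G l]) (if m = l then mono [Pv (src G m)] else (\<lambda>_. 0))"
    unfolding KP3(5) by (simp add: star_fdiff star_mono)
  then show ?thesis using rel_KP3[OF KP3(1,2,4,3)] by (simp only:)
next
  case (KP4 v n)
  have *: "mono [gw G l, gws G l] (rev (map star_gen w)) = (mono [gw G l, gws G l] w :: 'r)" for l w
    using fun_cong[OF star_mono[of "[gw G l, gws G l]"], of w] by (simp add: star_def)
  have "star (\<lambda>u. \<Sum>l\<in>S. mono [gw G l, gws G l] u :: 'r) = (\<lambda>u. \<Sum>l\<in>S. mono [gw G l, gws G l] u)" for S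
    unfolding star_def * ..
  then show ?thesis using rel_KP4[OF KP4(1-3)] by (simp add: KP4(4) star_fdiff star_mono)
qed

section \<open>The relation ideal and congruence of words\<close>

abbreviation I :: "('p kpgen list \<Rightarrow> 'r::comm_ring_1) set" where "I \<equiv> kp_rel_ideal G"

lemma I_FC: "f \<in> I \<Longrightarrow> f \<in> FC G"
  using ideal_I ideal.Icarr by fastforce

lemma I_zero: "(\<lambda>_. 0) \<in> I"
  using additive_subgroup.zero_closed[OF ideal.axioms(1)[OF ideal_I]] by (simp add: free_alg_ops)

lemma I_add: "f \<in> I \<Longrightarrow> g \<in> I \<Longrightarrow> (\<lambda>w. f w + g w) \<in> I"
  using additive_subgroup.a_closed[OF ideal.axioms(1)[OF ideal_I], of f g] by (simp add: free_alg_ops)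

lemma I_conv: "f \<in> I \<Longrightarrow> g \<in> FC G \<Longrightarrow> conv f g \<in> I" "f \<in> I \<Longrightarrow> g \<in> FC G \<Longrightarrow> conv g f \<in> I"
  using ideal.I_r_closed[OF ideal_I, of f g] ideal.I_l_closed[OF ideal_I, of f g]
  by (simp_all add: free_alg_ops)

lemma I_smult:
  assumes "f \<in> I"
  shows "(\<lambda>w. c * f w) \<in> I"
proof -
  have "conv (\<lambda>w. c * mono [] w) f = (\<lambda>w. c * conv (mono []) f w)"
    by (simp add: conv_def sum_distrib_left mult.assoc)
  moreover have "(\<lambda>w. c * mono [] w) \<in> FC G" by (rule FC_smult[OF FC_mono]) simp
  ultimately show ?thesis
    using I_conv(2)[OF assms, of "\<lambda>w. c * mono [] w"] conv_one(1)[OF FC_fsupp[OF I_FC[OF assms]]] by simp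
qed

lemma I_uminus: "f \<in> I \<Longrightarrow> (\<lambda>w. - f w) \<in> I"
  using I_smult[of f "-1"] by simp

lemma I_sum: "(\<And>l. l \<in> S \<Longrightarrow> h l \<in> I) \<Longrightarrow> (\<lambda>w. \<Sum>l\<in>S. h l w) \<in> I"
  by (induction S rule: infinite_finite_induct) (auto simp: I_add I_zero)

text \<open>The elements whose star lies in the relation ideal form an ideal themselves, and it
  contains the relations.\<close>

lemma I_star:
  fixes f :: "'p kpgen list \<Rightarrow> 'r::comm_ring_1"
  assumes f: "f \<in> I"
  shows "star f \<in> I"
proof -
  let ?N = "{f \<in> FC G. star f \<in> (I :: ('p kpgen list \<Rightarrow> 'r) set)}"
  have "ideal ?N (free_alg G)"
  proof (rule free_alg_idealI)
    fix f g :: "'p kpgen list \<Rightarrow> 'r" assume "f \<in> ?N" "g \<in> FC G"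
    moreover from this have "fsupp f" "fsupp g" by (auto intro: FC_fsupp)
    ultimately show "conv f g \<in> ?N" "conv g f \<in> ?N"
      by (simp_all add: star_conv FC_conv I_conv FC_star)
  next
    fix f g :: "'p kpgen list \<Rightarrow> 'r" assume "f \<in> ?N" "g \<in> ?N"
    then show "(\<lambda>w. f w + g w) \<in> ?N"
      using I_add[of "star f" "star g"] by (simp add: star_def FC_add)
  next
    fix f :: "'p kpgen list \<Rightarrow> 'r" assume "f \<in> ?N"
    then show "(\<lambda>w. - f w) \<in> ?N"
      using I_uminus[of "star f"] by (simp add: star_def FC_uminus)
  qed (auto simp: FC_zero I_zero)
  moreover have "kp_rels G \<subseteq> ?N" using star_kp_rels I_rel kp_rels_FC by blast
  ultimately show ?thesis using I_minimal f by blast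
qed

lemma I_fdiff_iff: "fdiff f g \<in> I \<Longrightarrow> f \<in> I \<longleftrightarrow> g \<in> I"
proof -
  assume d: "fdiff f g \<in> I"
  have "f = (\<lambda>w. fdiff f g w + g w)" "g = (\<lambda>w. f w + - fdiff f g w)" by (simp_all add: fdiff_def)
  then show ?thesis using I_add[OF d] I_add[OF _ I_uminus[OF d]] by metis
qed

text \<open>Words do not mention the coefficient ring, so the argument \<open>T\<close> pins it
  down.\<close>

definition weq :: "'r::comm_ring_1 itself \<Rightarrow> 'p kpgen list \<Rightarrow> 'p kpgen list \<Rightarrow> bool" where
  "weq T u v \<longleftrightarrow> fdiff (mono u) (mono v) \<in> (I :: ('p kpgen list \<Rightarrow> 'r) set)"

definition wzero :: "'r::comm_ring_1 itself \<Rightarrow> 'p kpgen list \<Rightarrow> bool" where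
  "wzero T u \<longleftrightarrow> mono u \<in> (I :: ('p kpgen list \<Rightarrow> 'r) set)"

lemma weq_refl: "weq T u u"
  using I_zero by (simp add: weq_def fdiff_def)

lemma weq_sym: "weq T u v \<Longrightarrow> weq T v u"
  unfolding weq_def using I_uminus[of "fdiff (mono u) (mono v)"] by (simp add: fdiff_def)

lemma weq_trans [trans]: "weq T u v \<Longrightarrow> weq T v w \<Longrightarrow> weq T u w"
  unfolding weq_def using I_add[of "fdiff (mono u) (mono v)" "fdiff (mono v) (mono w)"]
  by (simp add: fdiff_def)

lemma weq_wzero: "weq T u v \<Longrightarrow> wzero T v \<Longrightarrow> wzero T u"
  unfolding weq_def wzero_def using I_fdiff_iff by blast

lemma weq_context:
  assumes "weq T u v" "set a \<subseteq> gens G" "set b \<subseteq> gens G"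
  shows "weq T (a @ u @ b) (a @ v @ b)"
  using I_conv(2)[OF I_conv(1)[OF assms(1)[unfolded weq_def] FC_mono[OF assms(3)]] FC_mono[OF assms(2)]]
  by (simp add: weq_def conv_fdiff_left conv_fdiff_right conv_mono)

lemma wzero_context:
  assumes "wzero T u" "set a \<subseteq> gens G" "set b \<subseteq> gens G"
  shows "wzero T (a @ u @ b)"
  using I_conv(2)[OF I_conv(1)[OF assms(1)[unfolded wzero_def] FC_mono[OF assms(3)]] FC_mono[OF assms(2)]]
  by (simp add: wzero_def conv_mono)

end

section \<open>Reduction of words and annihilators\<close>

context lc_kgraph
begin

lemma path_gens [simp]: "l \<in> paths G \<Longrightarrow> gw G l \<in> gens G" "l \<in> paths G \<Longrightarrow> gws G l \<in> gens G"
  "l \<in> paths G \<Longrightarrow> Pv (src G l) \<in> gens G" "l \<in> paths G \<Longrightarrow> Pv (rng G l) \<in> gens G"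
  by (simp_all add: gw_gens Pv_gens)

lemma weq_cmp:
  assumes "l \<in> paths G" "m \<in> paths G" "src G l = rng G m"
  shows "weq T [gw G l, gw G m] [gw G (cmp G l m)]" "weq T [gws G m, gws G l] [gws G (cmp G l m)]"
  unfolding weq_def using I_rel[OF rel_KP2[OF assms]] I_rel[OF rel_KP2'[OF assms]] by simp_all

lemma weq_ends:
  assumes "l \<in> paths G"
  shows "weq T [Pv (rng G l), gw G l] [gw G l]" "weq T [gw G l, Pv (src G l)] [gw G l]"
    "weq T [Pv (src G l), gws G l] [gws G l]" "weq T [gws G l, Pv (rng G l)] [gws G l]"
  unfolding weq_def
  using I_rel[OF rel_KP2_rng[OF assms]] I_rel[OF rel_KP2_src[OF assms]]
    I_rel[OF rel_KP2_src'[OF assms]] I_rel[OF rel_KP2_rng'[OF assms]] by simp_all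

lemma Pv_Pv:
  assumes "v \<in> verts G" "w \<in> verts G"
  shows "weq T [Pv v, Pv v] [Pv v]" "v \<noteq> w \<Longrightarrow> wzero T [Pv v, Pv w]"
proof -
  show "weq T [Pv v, Pv v] [Pv v]"
    using I_rel[OF rel_KP1[OF assms(1,1)]] by (simp add: weq_def)
  show "wzero T [Pv v, Pv w]" if "v \<noteq> w"
    using I_rel[OF rel_KP1[OF assms]] that I_fdiff_iff[OF _, of _ "\<lambda>_. 0"] I_zero
    by (auto simp: wzero_def)
qed

lemma le_paths_zero: "l \<in> le_paths G (\<lambda>_. 0) \<longleftrightarrow> l \<in> verts G"
  by (auto simp: le_paths_iff verts_def le_fun_def)

text \<open>Extends (KP3) to n = 0, where the paths in question are vertices and (KP1) takes over.
  Degrees such as n - d(m), which occur below, may be zero.\<close>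

lemma gws_gw:
  assumes n: "n \<in> Nk (kdim G)" and l: "l \<in> le_paths G n" and m: "m \<in> le_paths G n"
  shows "l = m \<Longrightarrow> weq T [gws G l, gw G l] [Pv (src G l)]" "l \<noteq> m \<Longrightarrow> wzero T [gws G l, gw G m]"
proof -
  show "weq T [gws G l, gw G l] [Pv (src G l)]" if "l = m"
  proof (cases "n = (\<lambda>_. 0)")
    case True
    then have "l \<in> verts G" using l le_paths_zero by simp
    then show ?thesis using Pv_Pv(1) by (simp add: gw_vert)
  next
    case False
    from I_rel[OF rel_KP3[OF n False l l]] show ?thesis by (simp add: weq_def)
  qed
  show "wzero T [gws G l, gw G m]" if "l \<noteq> m"
  proof (cases "n = (\<lambda>_. 0)")
    case True
    then have "l \<in> verts G" "m \<in> verts G" using l m le_paths_zero by simp_all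
    then show ?thesis using Pv_Pv(2) that by (simp add: gw_vert)
  next
    case False
    from I_rel[OF rel_KP3[OF n False l m]] that have "fdiff (mono [gws G l, gw G m]) (\<lambda>_. 0) \<in> I" by simp
    then show ?thesis unfolding wzero_def using I_fdiff_iff I_zero by blast
  qed
qed

text \<open>The same extension for (KP4): at n = 0 the sum is the single term p_v p_v.\<close>

lemma Pv_expand:
  assumes v: "v \<in> verts G" and n: "n \<in> Nk (kdim G)"
  shows "fdiff (mono [Pv v]) (\<lambda>u. \<Sum>l\<in>{l \<in> le_paths G n. rng G l = v}. mono [gw G l, gws G l] u) \<in> I"
proof (cases "n = (\<lambda>_. 0)")
  case True
  then have "{l \<in> le_paths G n. rng G l = v} = {v}" using v by (auto simp: le_paths_zero)
  then show ?thesis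
    using weq_sym[OF Pv_Pv(1)[OF v v]] by (simp add: weq_def gw_vert[OF v])
next
  case False
  from I_rel[OF rel_KP4[OF v n False]] show ?thesis .
qed

text \<open>Insert p_{r(l)} to the right of s_l^*, or p_{s(m)} to the left of s_m^*, and use the
  orthogonality of vertices.\<close>

lemma wzero_gws:
  assumes l: "l \<in> paths G"
  shows "v \<in> verts G \<Longrightarrow> v \<noteq> rng G l \<Longrightarrow> wzero T [gws G l, Pv v]"
    "m \<in> paths G \<Longrightarrow> src G m \<noteq> rng G l \<Longrightarrow> wzero T [gws G l, gws G m]"
proof -
  show *: "wzero T [gws G l, Pv v]" if "v \<in> verts G" "v \<noteq> rng G l" for v
  proof -
    have "weq T [gws G l, Pv (rng G l), Pv v] [gws G l, Pv v]"
      using weq_context[OF weq_ends(4)[OF l], of "[]" "[Pv v]"] that(1) Pv_gens by simp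
    moreover have "wzero T [gws G l, Pv (rng G l), Pv v]"
      using wzero_context[OF Pv_Pv(2), of "rng G l" v "[gws G l]" "[]"] that l by simp
    ultimately show ?thesis using weq_wzero weq_sym by blast
  qed
  show "wzero T [gws G l, gws G m]" if m: "m \<in> paths G" "src G m \<noteq> rng G l"
  proof -
    have "weq T [gws G l, Pv (src G m), gws G m] [gws G l, gws G m]"
      using weq_context[OF weq_ends(3)[OF m(1)], of "[gws G l]" "[]"] l by simp
    moreover have "wzero T [gws G l, Pv (src G m), gws G m]"
      using wzero_context[OF *, of "src G m" "[]" "[gws G m]"] m l by simp
    ultimately show ?thesis using weq_wzero weq_sym by blast
  qed
qed

lemma conv_sum_right: "conv h (\<lambda>u. \<Sum>l\<in>S. f l u) = (\<lambda>w. \<Sum>l\<in>S. conv h (f l) w)"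
  unfolding conv_def sum_distrib_left by (rule ext) (rule sum.swap)

lemma conv_sum_left: "conv (\<lambda>u. \<Sum>l\<in>S. f l u) h = (\<lambda>w. \<Sum>l\<in>S. conv (f l) h w)"
  unfolding conv_def sum_distrib_right by (rule ext) (rule sum.swap)

text \<open>If l = m k, the factor s_m^* s_m collapses to p_{s(m)} and s_k^* remains. Otherwise
  p_{s(m)} is expanded by (KP4), and every term contains s_l^* s_{m k} for some m k in
  \<open>le_paths G n\<close> different from l.\<close>

lemma gws_gw_reduce:
  assumes n: "n \<in> Nk (kdim G)" and l: "l \<in> le_paths G n" and m: "m \<in> paths G" and dm: "deg G m \<le> n"
  shows "wzero T [gws G l, gw G m] \<or>
    (\<exists>k\<in>paths G. src G m = rng G k \<and> l = cmp G m k \<and> weq T [gws G l, gw G m] [gws G k])"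
proof (cases "\<exists>k\<in>paths G. src G m = rng G k \<and> l = cmp G m k")
  case True
  then obtain k where k: "k \<in> paths G" "src G m = rng G k" "l = cmp G m k" by blast
  have "weq T [gws G l, gw G m] [gws G k, gws G m, gw G m]"
    using weq_sym[OF weq_context[OF weq_cmp(2)[OF m k(1,2)], of "[]" "[gw G m]"]] k m by simp
  also have "weq T \<dots> [gws G k, Pv (src G m)]"
    using weq_context[OF gws_gw(1)[OF path_ends(9)[OF m] le_paths_deg[OF m] le_paths_deg[OF m] refl],
        of "[gws G k]" "[]"] k m by simp
  also have "weq T \<dots> [gws G k]" using weq_ends(4)[OF k(1)] k(2) by simp
  finally show ?thesis using k by blast
next
  case False
  \<comment> \<open>Chosen so that m k lies in \<open>le_paths G n\<close> for every k in
    \<open>le_paths G d\<close> with range s(m).\<close>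
  define d where "d = (\<lambda>i. n i - deg G m i)"
  have nd: "n = (\<lambda>i. deg G m i + d i)" using dm by (auto simp: d_def le_fun_def)
  have d: "d \<in> Nk (kdim G)" using n by (simp add: d_def Nk_def)
  have lp: "l \<in> paths G" using l by (simp add: le_paths_iff)
  let ?K = "{k \<in> le_paths G d. rng G k = src G m}"
  let ?f = "mono [gws G l, gw G m] :: 'p kpgen list \<Rightarrow> 'a"
  have f: "?f \<in> FC G" using lp m by (intro FC_mono) simp
  have z: "conv ?f (mono [gw G k, gws G k]) \<in> I" if k: "k \<in> ?K" for k
  proof -
    have kp: "k \<in> paths G" "src G m = rng G k" using k by (auto simp: le_paths_iff)
    have mk: "cmp G m k \<in> le_paths G n" unfolding nd using le_paths_cmp[OF m _ kp(2)] k by simp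
    have mkp: "cmp G m k \<in> paths G" using path_cmp(1)[OF m kp] .
    have "weq T [gws G l, gw G m, gw G k, gws G k] [gws G l, gw G (cmp G m k), gws G k]"
      using weq_context[OF weq_cmp(1)[OF m kp], of "[gws G l]" "[gws G k]"] lp kp by simp
    moreover have "l \<noteq> cmp G m k" using False kp by blast
    then have "wzero T [gws G l, gw G (cmp G m k), gws G k]"
      using wzero_context[OF gws_gw(2)[OF n l mk], of "[]" "[gws G k]"] kp by simp
    ultimately have "wzero T [gws G l, gw G m, gw G k, gws G k]" by (rule weq_wzero)
    then show ?thesis by (simp add: wzero_def conv_mono)
  qed
  have "fdiff (conv ?f (mono [Pv (src G m)])) (\<lambda>w. \<Sum>k\<in>?K. conv ?f (mono [gw G k, gws G k]) w) \<in> I"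
    using I_conv(2)[OF Pv_expand[OF _ d, of "src G m"] f] m
    by (simp add: conv_fdiff_right conv_sum_right)
  moreover have "(\<lambda>w. \<Sum>k\<in>?K. conv ?f (mono [gw G k, gws G k]) w) \<in> I" by (rule I_sum[OF z])
  ultimately have "conv ?f (mono [Pv (src G m)]) \<in> I" using I_fdiff_iff by blast
  then have "wzero T [gws G l, gw G m, Pv (src G m)]" by (simp add: wzero_def conv_mono)
  moreover have "weq T [gws G l, gw G m, Pv (src G m)] [gws G l, gw G m]"
    using weq_context[OF weq_ends(2)[OF m], of "[gws G l]" "[]"] lp by simp
  ultimately show ?thesis using weq_wzero weq_sym by blast
qed

text \<open>The ghost path absorbs the letters of w one by one: p_v preserves it, s_{m^*} lengthens
  it, s_m shortens it, unless the product vanishes. Only s_m lowers the degree bound, so the total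
  degree of these letters serves as N. The source never changes.\<close>

lemma gws_word_reduce:
  assumes "set w \<subseteq> gens G"
  shows "\<exists>N\<in>Nk (kdim G). \<forall>n\<in>Nk (kdim G). N \<le> n \<longrightarrow> (\<forall>l\<in>le_paths G n.
    wzero T (gws G l # w) \<or> (\<exists>k\<in>paths G. src G k = src G l \<and> weq T (gws G l # w) [gws G k]))"
  using assms
proof (induction w)
  case Nil
  have "(\<lambda>_. 0) \<in> Nk (kdim G)" by (simp add: Nk_def)
  moreover have "\<exists>k\<in>paths G. src G k = src G l \<and> weq T [gws G l] [gws G k]" if "l \<in> le_paths G n" for l n
    using that weq_refl by (intro bexI[of _ l]) (auto simp: le_paths_iff)
  ultimately show ?case by blast
next
  case (Cons g w)
  have w: "set w \<subseteq> gens G" using Cons.prems by simp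
  from Cons.IH[OF w] obtain N where N: "N \<in> Nk (kdim G)"
    and IH: "\<And>n l. n \<in> Nk (kdim G) \<Longrightarrow> N \<le> n \<Longrightarrow> l \<in> le_paths G n \<Longrightarrow>
      wzero T (gws G l # w) \<or> (\<exists>k\<in>paths G. src G k = src G l \<and> weq T (gws G l # w) [gws G k])"
    by blast
  have zero: "wzero T (gws G l # g # w)" if "wzero T [gws G l, g]" for l
    using wzero_context[OF that, of "[]" w] w by simp
  have eq: "weq T (gws G l # g # w) (gws G k # w)" if "weq T [gws G l, g] [gws G k]" for l k
    using weq_context[OF that, of "[]" w] w by simp
  have step: "wzero T (gws G l # g # w) \<or> (\<exists>k\<in>paths G. src G k = src G l \<and> weq T (gws G l # g # w) [gws G k])"
    if "weq T [gws G l, g] [gws G k]" "src G k = src G l" "n \<in> Nk (kdim G)" "N \<le> n" "k \<in> le_paths G n"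
    for l k n
    using IH[OF that(3-5)] eq[OF that(1)] that(2) weq_wzero weq_trans by metis
  from Cons.prems have "(\<exists>v\<in>verts G. g = Pv v) \<or> (\<exists>m\<in>paths G. g = gw G m) \<or> (\<exists>m\<in>paths G. g = gws G m)"
    unfolding gens_def by (auto simp: gw_def gws_def verts_def)
  then consider (P) v where "v \<in> verts G" "g = Pv v" | (S) m where "m \<in> paths G" "g = gw G m"
    | (T) m where "m \<in> paths G" "g = gws G m" by blast
  then show ?case
  proof cases
    case P
    show ?thesis
    proof (intro bexI[OF _ N] ballI impI)
      fix n l assume n: "n \<in> Nk (kdim G)" "N \<le> n" and l: "l \<in> le_paths G n"
      have lp: "l \<in> paths G" using l by (simp add: le_paths_iff)
      show "wzero T (gws G l # g # w) \<or> (\<exists>k\<in>paths G. src G k = src G l \<and> weq T (gws G l # g # w) [gws G k])"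
      proof (cases "v = rng G l")
        case True
        then have "weq T [gws G l, g] [gws G l]" using weq_ends(4)[OF lp, of T] P(2) by simp
        then show ?thesis by (rule step[OF _ refl n l])
      next
        case False
        then show ?thesis using zero[of l] wzero_gws(1)[OF lp P(1) False, of T] P(2) by simp
      qed
    qed
  next
    case S
    \<comment> \<open>Removing m from l lowers the bound from n to n - d(m), which must still
      dominate N.\<close>
    let ?N = "\<lambda>i. deg G m i + N i"
    have "?N \<in> Nk (kdim G)" using N path_ends(9)[OF S(1)] by (simp add: Nk_def)
    then show ?thesis
    proof (rule bexI[rotated], intro ballI impI)
      fix n l assume n: "n \<in> Nk (kdim G)" "?N \<le> n" and l: "l \<in> le_paths G n"
      have le: "deg G m i + N i \<le> n i" for i using n(2) by (simp add: le_fun_def)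
      have dm: "deg G m \<le> n" unfolding le_fun_def using le add_leD1 by blast
      let ?n = "\<lambda>i. n i - deg G m i"
      have n': "?n \<in> Nk (kdim G)" using n by (simp add: Nk_def)
      have N': "N \<le> ?n" unfolding le_fun_def using le by (simp add: add_le_imp_le_diff add.commute)
      consider "wzero T [gws G l, gw G m]" | k where "k \<in> paths G" "src G m = rng G k" "l = cmp G m k"
        "weq T [gws G l, gw G m] [gws G k]"
        using gws_gw_reduce[OF n(1) l S(1) dm] by blast
      then show "wzero T (gws G l # g # w) \<or> (\<exists>k\<in>paths G. src G k = src G l \<and> weq T (gws G l # g # w) [gws G k])"
      proof cases
        case 1
        then show ?thesis using zero S by simp
      next
        case (2 k)
        have "k \<in> le_paths G ?n" using le_paths_cmpD[OF S(1) 2(1,2)] l 2(3) by simp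
        moreover have "src G k = src G l" using path_cmp(3)[OF S(1) 2(1,2)] 2(3) by simp
        ultimately show ?thesis using step[OF _ _ n' N'] 2(4) S(2) by simp
      qed
    qed
  next
    case T
    show ?thesis
    proof (intro bexI[OF _ N] ballI impI)
      fix n l assume n: "n \<in> Nk (kdim G)" "N \<le> n" and l: "l \<in> le_paths G n"
      have lp: "l \<in> paths G" using l by (simp add: le_paths_iff)
      show "wzero T (gws G l # g # w) \<or> (\<exists>k\<in>paths G. src G k = src G l \<and> weq T (gws G l # g # w) [gws G k])"
      proof (cases "src G m = rng G l")
        case True
        \<comment> \<open>Here the bound grows, so the N of the shorter word suffices.\<close>
        let ?n = "\<lambda>i. deg G m i + n i"
        have n': "?n \<in> Nk (kdim G)" using n path_ends(9)[OF T(1)] by (simp add: Nk_def)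
        have N': "N \<le> ?n" using n(2) by (simp add: le_fun_def trans_le_add2)
        have "cmp G m l \<in> le_paths G ?n" by (rule le_paths_cmp[OF T(1) l True])
        moreover have "weq T [gws G l, g] [gws G (cmp G m l)]" using weq_cmp(2)[OF T(1) lp True] T by simp
        ultimately show ?thesis using step[OF _ _ n' N'] path_cmp(3)[OF T(1) lp True] by simp
      next
        case False
        then show ?thesis using zero[of l] wzero_gws(2)[OF lp T(1) False, of T] T(2) by simp
      qed
    qed
  qed
qed

section \<open>Ghost paths acting on an aperiodic boundary path\<close>

lemma ev_cong: "(\<And>w. f w \<noteq> 0 \<Longrightarrow> \<phi> w = \<psi> w) \<Longrightarrow> ev f \<phi> = ev f \<psi>"
  unfolding ev_def by (rule sum.cong) auto

text \<open>The degrees of a and b agree, as both differ from the common total by d(l); unique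
  factorization does the rest.\<close>

lemma cmp_right_cancel:
  assumes "a \<in> paths G" "b \<in> paths G" "l \<in> paths G" "src G a = rng G l" "src G b = rng G l"
    "cmp G a l = cmp G b l"
  shows "a = b"
proof -
  have "(\<lambda>i. deg G a i + deg G l i) = (\<lambda>i. deg G b i + deg G l i)"
    using path_cmp(4)[OF assms(1,3,4)] path_cmp(4)[OF assms(2,3,5)] assms(6) by simp
  then have "deg G a = deg G b" by (simp add: fun_eq_iff)
  then show ?thesis using factor_unique(1)[OF assms(1,3,2,3,4,5) _ assms(6)] by simp
qed

text \<open>Aperiodicity in relational form: no boundary path arises from x by prepending two
  different paths.\<close>

lemma condB_vertexD:
  assumes "condB_vertex G v"
  obtains x where "x \<in> bpaths" "bp_range x = v"
    "\<And>a b z. a \<in> paths G \<Longrightarrow> b \<in> paths G \<Longrightarrow> z \<in> bpaths \<Longrightarrow> is_concat a x z \<Longrightarrow> is_concat b x z \<Longrightarrow> a = b"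
proof -
  from assms obtain x where x: "x \<in> bpaths" "bp_range x = v"
    and ap: "\<And>a b. a \<in> paths G \<Longrightarrow> b \<in> paths G \<Longrightarrow> src G a = v \<Longrightarrow> src G b = v \<Longrightarrow> a \<noteq> b \<Longrightarrow>
      bp_concat G a x \<noteq> bp_concat G b x"
    unfolding condB_vertex_def boundary_path_bpaths by blast
  have "a = b" if "a \<in> paths G" "b \<in> paths G" "z \<in> bpaths" "is_concat a x z" "is_concat b x z" for a b z
  proof (rule ccontr)
    note d = bpathsD(1)[OF x(1)] bpathsD[OF that(3)]
    have "src G a = v" "src G b = v"
      using is_concat_rng(2)[OF that(3,4)] is_concat_rng(2)[OF that(3,5)] x(2) by simp_all
    moreover assume "a \<noteq> b"
    ultimately have "bp_concat G a x \<noteq> bp_concat G b x" using ap that(1,2) by blast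
    then show False using bp_concat_eqI[OF d that(4)] bp_concat_eqI[OF d that(5)] by simp
  qed
  then show ?thesis using that x by blast
qed

text \<open>To isolate the coefficient of s_k^*, apply the element to z = (k m) x and read off the
  coefficient of x. The word s_m^* s_b^* sends z to x exactly if z = (b m) x; by aperiodicity this
  means b m = k m, hence b = k.\<close>

lemma gws_independent:
  assumes m: "m \<in> paths G" and B: "condB_vertex G (src G m)" and g: "fsupp g"
    and supp: "\<And>u. g u \<noteq> 0 \<Longrightarrow> \<exists>k\<in>paths G. src G k = rng G m \<and> u = [gws G k]"
    and I: "conv (mono [gws G m]) g \<in> I"
  shows "g = (\<lambda>_. 0)"
proof (rule ext, rule ccontr)
  fix u assume u: "g u \<noteq> 0"
  then obtain k where k: "k \<in> paths G" "src G k = rng G m" "u = [gws G k]" using supp by blast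
  obtain x where x: "x \<in> bpaths" "bp_range x = src G m"
    and ap: "\<And>a b z. a \<in> paths G \<Longrightarrow> b \<in> paths G \<Longrightarrow> z \<in> bpaths \<Longrightarrow> is_concat a x z \<Longrightarrow> is_concat b x z \<Longrightarrow> a = b"
    using condB_vertexD[OF B] by blast
  have "src G (cmp G k m) = bp_range x" using path_cmp(3)[OF k(1) m k(2)] x(2) by simp
  then obtain z where z: "z \<in> bpaths" "is_concat (cmp G k m) x z"
    using concat_ex[OF x(1) path_cmp(1)[OF k(1) m k(2)]] by blast
  define \<phi> where "\<phi> = (\<lambda>y. if y = x then 1 else 0 :: 'a)"
  have "ev (conv (mono [gws G m]) g) (\<lambda>w. val \<phi> (act_word act w z)) =
      ev g (\<lambda>v. val \<phi> (act_word act (gws G m # v) z))"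
    by (simp add: conv_ev(2)[OF fsupp_mono g])
  also have "\<dots> = ev g (\<lambda>v. if v = u then 1 else 0)"
  proof (rule ev_cong)
    fix v assume "g v \<noteq> 0"
    then obtain b where b: "b \<in> paths G" "src G b = rng G m" "v = [gws G b]" using supp by blast
    have *: "act_word act (gws G m # v) z = Some x \<longleftrightarrow> b = k"
    proof -
      have "act_word act (gws G m # v) z = Some x \<longleftrightarrow> is_concat (cmp G b m) x z"
        unfolding b(3) act_word_Some act_gw(2)[OF b(1)] act_gw(2)[OF m]
        using is_concat_cmp[OF x(1) z(1) b(1) m b(2)] x(1) z(1) by blast
      also have "\<dots> \<longleftrightarrow> cmp G b m = cmp G k m"
        using ap[OF path_cmp(1)[OF b(1) m b(2)] path_cmp(1)[OF k(1) m k(2)] z(1)] z(2) by auto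
      also have "\<dots> \<longleftrightarrow> b = k" using cmp_right_cancel[OF b(1) k(1) m b(2) k(2)] by blast
      finally show ?thesis .
    qed
    have inj: "b = k" if "v = u"
    proof -
      have "gws G b = gws G k" using that b(3) k(3) by simp
      then show ?thesis by (simp add: gws_def split: if_splits)
    qed
    then have "v = u \<longleftrightarrow> b = k" using b(3) k(3) by blast
    then show "val \<phi> (act_word act (gws G m # v) z) = (if v = u then 1 else 0)"
      using * by (cases "act_word act (gws G m # v) z") (auto simp: \<phi>_def simp del: act_word.simps)
  qed
  also have "\<dots> = g u" by (rule ev_delta[OF g])
  finally show False using I_act[OF I, of \<phi> z] u by simp
qed

text \<open>Stated for a representative f in the free algebra; the annihilator of J enters only
  through the ghost paths with source in H.\<close>

lemma annihilated_left:
  assumes f: "f \<in> FC G" and v: "v \<in> verts G" and B: "condB G" and H: "H \<subseteq> verts G"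
    and ann: "\<And>m. m \<in> paths G \<Longrightarrow> src G m \<in> H \<Longrightarrow> conv (mono [gws G m]) f \<in> I"
    and reach: "\<And>l. l \<in> paths G \<Longrightarrow> rng G l = v \<Longrightarrow> \<exists>m\<in>paths G. rng G m = src G l \<and> src G m \<in> H"
  shows "conv (mono [Pv v]) f \<in> (I :: ('p kpgen list \<Rightarrow> 'r::comm_ring_1) set)"
proof -
  let ?T = "TYPE('r)"
  let ?W = "{w. f w \<noteq> 0}"
  have fin: "finite ?W" using f by (simp add: FC_iff)
  let ?R = "\<lambda>w n. \<forall>l\<in>le_paths G n.
    wzero ?T (gws G l # w) \<or> (\<exists>k\<in>paths G. src G k = src G l \<and> weq ?T (gws G l # w) [gws G k])"
  have "\<forall>w\<in>?W. \<exists>N. N \<in> Nk (kdim G) \<and> (\<forall>n\<in>Nk (kdim G). N \<le> n \<longrightarrow> ?R w n)"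
  proof
    fix w assume "w \<in> ?W"
    then have "set w \<subseteq> gens G" using f by (simp add: FC_iff)
    from gws_word_reduce[OF this, of ?T]
    show "\<exists>N. N \<in> Nk (kdim G) \<and> (\<forall>n\<in>Nk (kdim G). N \<le> n \<longrightarrow> ?R w n)" by (elim bexE) (intro exI conjI)
  qed
  from bchoice[OF this] obtain N
    where N': "\<forall>w\<in>?W. N w \<in> Nk (kdim G) \<and> (\<forall>n\<in>Nk (kdim G). N w \<le> n \<longrightarrow> ?R w n)" ..
  then have N: "N w \<in> Nk (kdim G)" if "w \<in> ?W" for w using that by blast
  have red: "wzero ?T (gws G l # w) \<or> (\<exists>k\<in>paths G. src G k = src G l \<and> weq ?T (gws G l # w) [gws G k])"
    if "w \<in> ?W" "n \<in> Nk (kdim G)" "N w \<le> n" "l \<in> le_paths G n" for w n l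
    using N'[THEN bspec, OF that(1), THEN conjunct2, THEN bspec, OF that(2), THEN mp, OF that(3), THEN bspec, OF that(4)] .
  \<comment> \<open>The sum dominates every \<open>N w\<close>, so a single degree n reduces all
    words of f at once.\<close>
  define n where "n = (\<lambda>i. \<Sum>w\<in>?W. N w i)"
  have n: "n \<in> Nk (kdim G)" using N by (simp add: n_def Nk_def)
  have le: "N w \<le> n" if "w \<in> ?W" for w
    unfolding le_fun_def n_def using that fin by (auto intro!: member_le_sum)
  have key: "conv (mono [gws G l]) f \<in> I" if l: "l \<in> le_paths G n" "rng G l = v" for l
  proof -
    have lp: "l \<in> paths G" using l by (simp add: le_paths_iff)
    obtain m where m: "m \<in> paths G" "rng G m = src G l" "src G m \<in> H" using reach[OF lp l(2)] by blast
    have "\<forall>w\<in>?W. \<exists>h. fdiff (mono (gws G l # w)) h \<in> (I :: ('p kpgen list \<Rightarrow> 'r) set) \<and>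
      (h = (\<lambda>_. 0) \<or> (\<exists>k\<in>paths G. src G k = src G l \<and> h = mono [gws G k]))"
    proof
      fix w assume w: "w \<in> ?W"
      from red[OF w n le[OF w] l(1)]
      show "\<exists>h. fdiff (mono (gws G l # w)) h \<in> (I :: ('p kpgen list \<Rightarrow> 'r) set) \<and>
        (h = (\<lambda>_. 0) \<or> (\<exists>k\<in>paths G. src G k = src G l \<and> h = mono [gws G k]))"
      proof
        assume "wzero ?T (gws G l # w)"
        then have "fdiff (mono (gws G l # w)) (\<lambda>_. 0) \<in> (I :: ('p kpgen list \<Rightarrow> 'r) set)"
          by (simp add: wzero_def fdiff_def)
        then show ?thesis by blast
      next
        assume "\<exists>k\<in>paths G. src G k = src G l \<and> weq ?T (gws G l # w) [gws G k]"
        then show ?thesis unfolding weq_def by blast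
      qed
    qed
    then obtain h where h: "\<And>w. w \<in> ?W \<Longrightarrow> fdiff (mono (gws G l # w)) (h w) \<in> (I :: ('p kpgen list \<Rightarrow> 'r) set)"
      "\<And>w. w \<in> ?W \<Longrightarrow> h w = (\<lambda>_. 0) \<or> (\<exists>k\<in>paths G. src G k = src G l \<and> h w = mono [gws G k])"
      unfolding bchoice_iff by blast
    \<comment> \<open>The combination of ghost paths to which s_l^* f is congruent.\<close>
    define g where "g = (\<lambda>x. \<Sum>w\<in>?W. f w * h w x)"
    have d: "fdiff (conv (mono [gws G l]) f) g \<in> I"
    proof -
      have "fdiff (conv (mono [gws G l]) f) g = (\<lambda>x. \<Sum>w\<in>?W. f w * fdiff (mono (gws G l # w)) (h w) x)"
        using conv_mono_left[OF FC_fsupp[OF f], of "[gws G l]"]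
        by (simp add: g_def fdiff_def sum_subtractf right_diff_distrib)
      moreover have "(\<lambda>x. \<Sum>w\<in>?W. f w * fdiff (mono (gws G l # w)) (h w) x) \<in> I"
        by (rule I_sum, rule I_smult, rule h(1))
      ultimately show ?thesis by (simp only:)
    qed
    have hf: "fsupp (h w)" if "w \<in> ?W" for w using h(2)[OF that] by auto
    have gf: "fsupp g" unfolding g_def
    proof (rule fsupp_sum[OF fin])
      fix w assume "w \<in> ?W"
      from hf[OF this] show "fsupp (\<lambda>x. f w * h w x)" by (rule rev_finite_subset) auto
    qed
    have gs: "\<exists>k\<in>paths G. src G k = rng G m \<and> u = [gws G k]" if "g u \<noteq> 0" for u
    proof -
      from that obtain w where w: "w \<in> ?W" "f w * h w u \<noteq> 0"
        unfolding g_def by (rule sum.not_neutral_contains_not_neutral)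
      then have "h w u \<noteq> 0" by auto
      then show ?thesis using h(2)[OF w(1)] m(2) by (auto simp: mono_def split: if_splits)
    qed
    have s: "src G l = rng G m" using m(2) by simp
    \<comment> \<open>The path l m has its source in H, so s_{l m}^* annihilates f. But s_{l m}^* f
      is s_m^* s_l^* f, hence s_m^* g vanishes in the quotient.\<close>
    have "weq ?T [gws G m, gws G l] [gws G (cmp G l m)]" by (rule weq_cmp(2)[OF lp m(1) s])
    then have "fdiff (conv (mono [gws G m, gws G l]) f) (conv (mono [gws G (cmp G l m)]) f) \<in> I"
      unfolding weq_def using I_conv(1)[OF _ f] by (simp only: conv_fdiff_left[symmetric])
    moreover have "conv (mono [gws G (cmp G l m)]) f \<in> I"
      using ann[OF path_cmp(1)[OF lp m(1) s]] path_cmp(3)[OF lp m(1) s] m(3) by simp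
    ultimately have "conv (mono [gws G m, gws G l]) f \<in> I" using I_fdiff_iff by blast
    then have "conv (mono [gws G m]) (conv (mono [gws G l]) f) \<in> I"
      using conv_assoc[of "mono [gws G m]" "mono [gws G l]" f] FC_fsupp[OF f] by (simp add: conv_mono)
    moreover have "fdiff (conv (mono [gws G m]) (conv (mono [gws G l]) f)) (conv (mono [gws G m]) g) \<in> I"
      using I_conv(2)[OF d, of "mono [gws G m]"] m(1) by (simp add: conv_fdiff_right FC_mono)
    ultimately have "conv (mono [gws G m]) g \<in> I" using I_fdiff_iff by blast
    moreover have "condB_vertex G (src G m)" using B H m(3) unfolding condB_def by blast
    ultimately have "g = (\<lambda>_. 0)" using gws_independent[OF m(1) _ gf gs] by blast
    then show ?thesis using d I_fdiff_iff I_zero by blast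
  qed
  let ?L = "{l \<in> le_paths G n. rng G l = v}"
  have "fdiff (conv (mono [Pv v]) f) (\<lambda>w. \<Sum>l\<in>?L. conv (mono [gw G l, gws G l]) f w) \<in> I"
    using I_conv(1)[OF Pv_expand[OF v n] f] by (simp add: conv_fdiff_left conv_sum_left)
  moreover have "conv (mono [gw G l, gws G l]) f \<in> I" if "l \<in> ?L" for l
  proof -
    have "l \<in> paths G" using that by (simp add: le_paths_iff)
    then have "conv (mono [gw G l]) (conv (mono [gws G l]) f) \<in> I"
      using key[of l] that I_conv(2)[of "conv (mono [gws G l]) f" "mono [gw G l]"] by (simp add: FC_mono)
    then show ?thesis
      using conv_assoc[of "mono [gw G l]" "mono [gws G l]" f] FC_fsupp[OF f] by (simp add: conv_mono)
  qed
  then have "(\<lambda>w. \<Sum>l\<in>?L. conv (mono [gw G l, gws G l]) f w) \<in> I" by (rule I_sum)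
  ultimately show ?thesis using I_fdiff_iff by blast
qed

text \<open>The involution turns right multiplication by s_m into left multiplication by s_m^*, so
  the left version applies to \<open>star f\<close>.\<close>

lemma annihilated_right:
  assumes f: "f \<in> FC G" and v: "v \<in> verts G" and B: "condB G" and H: "H \<subseteq> verts G"
    and ann: "\<And>m. m \<in> paths G \<Longrightarrow> src G m \<in> H \<Longrightarrow> conv f (mono [gw G m]) \<in> I"
    and reach: "\<And>l. l \<in> paths G \<Longrightarrow> rng G l = v \<Longrightarrow> \<exists>m\<in>paths G. rng G m = src G l \<and> src G m \<in> H"
  shows "conv f (mono [Pv v]) \<in> (I :: ('p kpgen list \<Rightarrow> 'r::comm_ring_1) set)"
proof -
  have s: "star (conv f (mono [g])) = conv (mono [star_gen g]) (star f)" for g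
    using star_conv[of f "mono [g]"] FC_fsupp[OF f] by (simp add: star_mono)
  have "conv (mono [Pv v]) (star f) \<in> I"
    by (rule annihilated_left[OF FC_star[OF f] v B H _ reach]) (use I_star[OF ann] in \<open>simp add: s\<close>)
  then have "star (conv (mono [Pv v]) (star f)) \<in> I" by (rule I_star)
  then show ?thesis using s[of "Pv v", symmetric] by simp
qed

end

section \<open>The Kumjian-Pask algebra and the main theorem\<close>

context kgraph
begin

lemma kpe_hom:
  "(kpe G :: ('p kpgen list \<Rightarrow> 'r::comm_ring_1) \<Rightarrow> _) \<in> ring_hom (free_alg G) (KPU G)"
  unfolding KPU_def kpe_def[abs_def] by (rule ideal.rcos_ring_hom[OF ideal_I])

lemma kpe_mult: "f \<in> FC G \<Longrightarrow> g \<in> FC G \<Longrightarrow> kpe G f \<otimes>\<^bsub>KPU G\<^esub> kpe G g = kpe G (conv f g)"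
  using ring_hom_mult[OF kpe_hom, of f g] by (simp add: free_alg_ops)

lemma KPU_zero: "\<zero>\<^bsub>KPU G\<^esub> = kp_rel_ideal G"
  by (simp add: KPU_def FactRing_def)

lemma kpe_eq_zero: "f \<in> FC G \<Longrightarrow> kpe G f = \<zero>\<^bsub>KPU G\<^esub> \<longleftrightarrow> f \<in> I"
proof -
  assume f: "f \<in> FC G"
  have sg: "abelian_subgroup (kp_rel_ideal G) (free_alg G)"
    using abelian_subgroupI3[OF ideal.axioms(1)[OF ideal_I] ring.is_abelian_group[OF free_alg_ring]] .
  show ?thesis
    unfolding KPU_zero kpe_def
    using abelian_subgroup.a_rcos_const[OF sg, of f] abelian_subgroup.a_rcos_self[OF sg f] by auto
qed

lemma kpe_eq:
  assumes "fdiff f g \<in> I" "f \<in> FC G" "g \<in> FC G"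
  shows "kpe G f = kpe G g"
proof -
  have d: "fdiff f g \<in> FC G" using FC_fdiff[OF assms(2,3)] .
  have "f = fdiff f g \<oplus>\<^bsub>free_alg G\<^esub> g" by (simp add: free_alg_ops fdiff_def)
  then have "kpe G f = kpe G (fdiff f g) \<oplus>\<^bsub>KPU G\<^esub> kpe G g"
    using ring_hom_add[OF kpe_hom d assms(3)] by simp
  also have "kpe G (fdiff f g) = \<zero>\<^bsub>KPU G\<^esub>" using kpe_eq_zero[OF d] assms(1) by simp
  also have "\<zero>\<^bsub>KPU G\<^esub> \<oplus>\<^bsub>KPU G\<^esub> kpe G g = kpe G g"
  proof (rule ring.ring_simprules(8))
    show "ring (KPU G)" unfolding KPU_def by (rule ideal.quotient_is_ring[OF ideal_I])
    show "kpe G g \<in> carrier (KPU G)" by (rule ring_hom_closed[OF kpe_hom assms(3)])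
  qed
  finally show ?thesis .
qed

definition kpw :: "'p kpgen list \<Rightarrow> ('p kpgen list \<Rightarrow> 'r::comm_ring_1) set" where
  "kpw w = kpe G (mono w)"

lemma kpw_weq:
  "weq TYPE('r::comm_ring_1) u v \<Longrightarrow> set u \<subseteq> gens G \<Longrightarrow> set v \<subseteq> gens G \<Longrightarrow>
    (kpw u :: ('p kpgen list \<Rightarrow> 'r) set) = kpw v"
  unfolding weq_def kpw_def by (rule kpe_eq[OF _ FC_mono FC_mono])

end

context lc_kgraph
begin

context
  fixes J :: "('p kpgen list \<Rightarrow> 'r::comm_ring_1) set set"
  assumes J: "kp_ideal G J"
begin

lemma ideal_context:
  assumes "(kpw u :: ('p kpgen list \<Rightarrow> 'r) set) \<in> J" "set u \<subseteq> gens G" "set a \<subseteq> gens G" "set b \<subseteq> gens G"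
  shows "(kpw (a @ u @ b) :: ('p kpgen list \<Rightarrow> 'r) set) \<in> J"
proof -
  have id: "ideal J (KPU G)" using J by (simp add: kp_ideal_def)
  have c: "kpe G (mono w) \<in> carrier (KPU G)" if "set w \<subseteq> gens G" for w
    by (rule ring_hom_closed[OF kpe_hom FC_mono[OF that]])
  have "kpe G (mono a) \<otimes>\<^bsub>KPU G\<^esub> (kpe G (mono u) \<otimes>\<^bsub>KPU G\<^esub> kpe G (mono b)) \<in> J"
    using ideal.I_l_closed[OF id ideal.I_r_closed[OF id assms(1)[unfolded kpw_def] c[OF assms(4)]] c[OF assms(3)]] .
  then show ?thesis
    using assms(2-4) by (simp add: kpe_mult FC_mono conv_mono kpw_def)
qed

lemma H_of_iff: "v \<in> H_of G J \<longleftrightarrow> v \<in> verts G \<and> kpw [Pv v] \<in> J"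
  by (simp add: H_of_def pv_def kpw_def)

lemma H_of_hereditary:
  assumes m: "m \<in> paths G" and r: "rng G m \<in> H_of G J"
  shows "src G m \<in> H_of G J"
proof -
  let ?T = "TYPE('r)"
  have "weq ?T [gws G m, Pv (rng G m), gw G m] [gws G m, gw G m]"
    using weq_context[OF weq_ends(1)[OF m], of "[gws G m]" "[]"] m by simp
  also have "weq ?T \<dots> [Pv (src G m)]"
    by (rule gws_gw(1)[OF path_ends(9)[OF m] le_paths_deg[OF m] le_paths_deg[OF m] refl])
  finally have "(kpw [gws G m, Pv (rng G m), gw G m] :: ('p kpgen list \<Rightarrow> 'r) set) = kpw [Pv (src G m)]"
    by (rule kpw_weq) (use m in simp_all)
  moreover have "(kpw [gws G m, Pv (rng G m), gw G m] :: ('p kpgen list \<Rightarrow> 'r) set) \<in> J"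
    using ideal_context[of "[Pv (rng G m)]" "[gws G m]" "[gw G m]"] r m by (simp add: H_of_iff)
  ultimately show ?thesis using m by (simp add: H_of_iff)
qed

text \<open>From s_m = s_m p_{s(m)} and its starred form. These are the elements of J against which
  an annihilating element is tested.\<close>

lemma gw_in_ideal:
  assumes m: "m \<in> paths G" and s: "src G m \<in> H_of G J"
  shows "(kpw [gw G m] :: ('p kpgen list \<Rightarrow> 'r) set) \<in> J" "(kpw [gws G m] :: ('p kpgen list \<Rightarrow> 'r) set) \<in> J"
proof -
  have "(kpw [gw G m, Pv (src G m)] :: ('p kpgen list \<Rightarrow> 'r) set) = kpw [gw G m]"
    by (rule kpw_weq[OF weq_ends(2)[OF m]]) (use m in simp_all)
  then show "(kpw [gw G m] :: ('p kpgen list \<Rightarrow> 'r) set) \<in> J"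
    using ideal_context[of "[Pv (src G m)]" "[gw G m]" "[]"] s m by (simp add: H_of_iff)
  have "(kpw [Pv (src G m), gws G m] :: ('p kpgen list \<Rightarrow> 'r) set) = kpw [gws G m]"
    by (rule kpw_weq[OF weq_ends(3)[OF m]]) (use m in simp_all)
  then show "(kpw [gws G m] :: ('p kpgen list \<Rightarrow> 'r) set) \<in> J"
    using ideal_context[of "[Pv (src G m)]" "[]" "[gws G m]"] s m by (simp add: H_of_iff)
qed

lemma reaches_off_H:
  assumes reg: "regular_ideal G J" and B: "condB G" and v: "v \<in> verts G" "v \<notin> H_of G J"
  shows "\<exists>l\<in>paths G. rng G l = v \<and> (\<forall>m\<in>paths G. rng G m = src G l \<longrightarrow> src G m \<notin> H_of G J)"
proof (rule ccontr)
  assume "\<not> ?thesis"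
  then have reach: "\<And>l. l \<in> paths G \<Longrightarrow> rng G l = v \<Longrightarrow> \<exists>m\<in>paths G. rng G m = src G l \<and> src G m \<in> H_of G J"
    by blast
  have H: "H_of G J \<subseteq> verts G" by (auto simp: H_of_def)
  have p: "(mono [Pv v] :: _ \<Rightarrow> 'r) \<in> FC G" using v Pv_gens by (intro FC_mono) simp
  have "pv G v \<otimes>\<^bsub>KPU G\<^esub> a = \<zero>\<^bsub>KPU G\<^esub> \<and> a \<otimes>\<^bsub>KPU G\<^esub> pv G v = \<zero>\<^bsub>KPU G\<^esub>"
    if a: "a \<in> kp_perp G J" for a
  proof -
    from a obtain f where f: "f \<in> FC G" "a = kpe G f" by (auto simp: kp_perp_def KP_def)
    have ann: "conv (mono [gws G m]) f \<in> I" "conv f (mono [gw G m]) \<in> I"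
      if m: "m \<in> paths G" "src G m \<in> H_of G J" for m
    proof -
      have "kpe G (mono [gws G m]) \<otimes>\<^bsub>KPU G\<^esub> a = \<zero>\<^bsub>KPU G\<^esub>" "a \<otimes>\<^bsub>KPU G\<^esub> kpe G (mono [gw G m]) = \<zero>\<^bsub>KPU G\<^esub>"
        using a gw_in_ideal[OF m] by (simp_all add: kp_perp_def kpw_def)
      moreover have "(mono [gws G m] :: _ \<Rightarrow> 'r) \<in> FC G" "(mono [gw G m] :: _ \<Rightarrow> 'r) \<in> FC G" using m(1) by (auto intro: FC_mono)
      ultimately show "conv (mono [gws G m]) f \<in> I" "conv f (mono [gw G m]) \<in> I"
        using f by (simp_all add: kpe_mult kpe_eq_zero[symmetric] FC_conv)
    qed
    have "conv (mono [Pv v]) f \<in> I" "conv f (mono [Pv v]) \<in> I"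
      using annihilated_left[OF f(1) v(1) B H ann(1) reach]
        annihilated_right[OF f(1) v(1) B H ann(2) reach] by blast+
    then show ?thesis using f p by (simp add: pv_def kpe_mult kpe_eq_zero FC_conv)
  qed
  \<comment> \<open>\<open>kp_perp\<close> lives inside \<open>KP G\<close>, so p_v must have a
    representative without constant term.\<close>
  moreover have "(mono [Pv v] :: _ \<Rightarrow> 'r) [] = 0" by (simp add: mono_def)
  then have "(pv G v :: ('p kpgen list \<Rightarrow> 'r) set) \<in> KP G" unfolding KP_def pv_def using p by blast
  ultimately have "pv G v \<in> kp_perp G (kp_perp G J)" by (simp add: kp_perp_def)
  then show False using reg v by (simp add: regular_ideal_def H_of_def)
qed

end

end

section \<open>Removing a hereditary set of vertices\<close>

lemma remove_verts_simps [simp]: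
  "rng (remove_verts G H) = rng G" "src (remove_verts G H) = src G" "cmp (remove_verts G H) = cmp G"
  "deg (remove_verts G H) = deg G" "kdim (remove_verts G H) = kdim G"
  "l \<in> paths (remove_verts G H) \<longleftrightarrow> l \<in> paths G \<and> rng G l \<notin> H \<and> src G l \<notin> H"
  by (simp_all add: remove_verts_def)

text \<open>Factorizations stay in the subgraph: if the middle vertex were in the hereditary set H,
  so would be the source of the whole path.\<close>

lemma (in kgraph) kgraph_remove_verts:
  assumes her: "\<And>m. m \<in> paths G \<Longrightarrow> rng G m \<in> H \<Longrightarrow> src G m \<in> H"
  shows "kgraph (remove_verts G H)"
proof
  let ?G = "remove_verts G H"
  have "paths ?G \<subseteq> paths G" by auto
  then have 1: "countable (paths ?G)"
    by (rule countable_subset) (rule is_kgraph[unfolded is_kgraph_def, THEN conjunct1])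
  have 2: "\<exists>!pr. fst pr \<in> paths ?G \<and> snd pr \<in> paths ?G \<and> src ?G (fst pr) = rng ?G (snd pr) \<and>
        deg ?G (fst pr) = m \<and> deg ?G (snd pr) = n \<and> cmp ?G (fst pr) (snd pr) = l"
    if l: "l \<in> paths ?G" and mn: "m \<in> Nk (kdim ?G)" "n \<in> Nk (kdim ?G)" "deg ?G l = (\<lambda>i. m i + n i)" for l m n
  proof -
    have lp: "l \<in> paths G" using l by simp
    have le: "m \<le> deg G l" and dn: "(\<lambda>i. deg G l i - m i) = n" using mn(3) by (simp_all add: le_fun_def)
    note ht = head_tail[OF lp le]
    have "rng G (tail l m) \<notin> H" using her[OF ht(2)] ht(8) l by auto
    then have mem: "head l m \<in> paths ?G" "tail l m \<in> paths ?G" using ht l by simp_all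
    show ?thesis
    proof (rule ex1I[of _ "(head l m, tail l m)"])
      show "fst (head l m, tail l m) \<in> paths ?G \<and> snd (head l m, tail l m) \<in> paths ?G \<and>
        src ?G (fst (head l m, tail l m)) = rng ?G (snd (head l m, tail l m)) \<and>
        deg ?G (fst (head l m, tail l m)) = m \<and> deg ?G (snd (head l m, tail l m)) = n \<and>
        cmp ?G (fst (head l m, tail l m)) (snd (head l m, tail l m)) = l"
        unfolding fst_conv snd_conv using mem ht(3-6) dn by (intro conjI) (simp_all del: remove_verts_simps(6))
    next
      fix pr assume pr: "fst pr \<in> paths ?G \<and> snd pr \<in> paths ?G \<and> src ?G (fst pr) = rng ?G (snd pr) \<and>
        deg ?G (fst pr) = m \<and> deg ?G (snd pr) = n \<and> cmp ?G (fst pr) (snd pr) = l"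
      then have "head l m = fst pr" "tail l m = snd pr"
        using head_tail_eqI[of "fst pr" "snd pr" m l] by auto
      then show "pr = (head l m, tail l m)" by simp
    qed
  qed
  show "is_kgraph ?G"
    unfolding is_kgraph_def
  proof (intro conjI ballI impI; (elim conjE)?)
    show "countable (paths ?G)" by (rule 1)
  next
    fix l m n assume "l \<in> paths ?G" "m \<in> paths ?G" "n \<in> paths ?G" "src ?G l = rng ?G m" "src ?G m = rng ?G n"
    then show "cmp ?G (cmp ?G l m) n = cmp ?G l (cmp ?G m n)" using cmp_assoc[of l m n] by simp
  qed (rule 2, assumption+ | simp)+
qed

text \<open>Not only l x but every a l x with a in the subgraph has to be recognized as a boundary
  path of the subgraph, because concatenation there is a definite description over its own boundary
  paths.\<close>

lemma (in lc_kgraph) condB_remove_verts: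
  assumes B: "condB G" and her: "\<And>m. m \<in> paths G \<Longrightarrow> rng G m \<in> H \<Longrightarrow> src G m \<in> H"
    and off: "\<And>v. v \<in> verts G \<Longrightarrow> v \<notin> H \<Longrightarrow>
      \<exists>l\<in>paths G. rng G l = v \<and> (\<forall>m\<in>paths G. rng G m = src G l \<longrightarrow> src G m \<notin> H)"
  shows "condB (remove_verts G H)"
  unfolding condB_def
proof
  let ?G = "remove_verts G H"
  interpret R: kgraph ?G by (rule kgraph_remove_verts[OF her])
  fix v assume "v \<in> verts ?G"
  then have v: "v \<in> verts G" "v \<notin> H" by (auto simp: verts_def deg_zero_ends)
  obtain l where l: "l \<in> paths G" "rng G l = v" and noH: "\<And>m. m \<in> paths G \<Longrightarrow> rng G m = src G l \<Longrightarrow> src G m \<notin> H"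
    using off[OF v] by blast
  have "condB_vertex G (src G l)" using B l by (simp add: condB_def)
  then obtain x where x: "x \<in> bpaths" "bp_range x = src G l"
    and ap: "\<And>a b z. a \<in> paths G \<Longrightarrow> b \<in> paths G \<Longrightarrow> z \<in> bpaths \<Longrightarrow> is_concat a x z \<Longrightarrow> is_concat b x z \<Longrightarrow> a = b"
    using condB_vertexD by blast
  \<comment> \<open>Every vertex on \<open>z\<close> connects to a vertex on \<open>x\<close>, hence lies outside the hereditary set \<open>H\<close>.\<close>
  have R: "R.gpath z \<and> R.terminal z" if z: "z \<in> bpaths" and c: "is_concat a x z" for a z
  proof -
    note gz = bpathsD(1)[OF z]
    have nH: "snd z (p, p) \<notin> H" if p: "le_enat p (fst z)" for p
    proof
      assume pH: "snd z (p, p) \<in> H"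
      define t where "t = (\<lambda>i. p i - deg G a i)"
      have t: "le_enat t (fst x)" using le_enat_diff p unfolding is_concatD(1)[OF c] t_def by blast
      have le: "p \<le> (\<lambda>i. deg G a i + t i)" unfolding t_def le_fun_def by arith
      note q = gpathD[OF gz le is_concat_le(1)[OF c t]]
      have "snd x (t, t) \<in> H" using her[OF q(1)] q(3,4) pH is_concatD(3)[OF c order_refl t] by simp
      moreover note y = gpathD[OF bpathsD(1)[OF x(1)] zero_le t]
      ultimately show False using noH[OF y(1)] y(3,4) x(2) by (simp add: bp_range_def)
    qed
    have "R.gpath z"
      unfolding R.gpath_def remove_verts_simps
    proof (intro conjI allI impI)
      fix p q assume pq: "p \<le> q" "le_enat q (fst z)"
      note d = gpathD[OF gz pq]
      show "snd z (p, q) \<in> paths G" "deg G (snd z (p, q)) = (\<lambda>i. q i - p i)"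
        "rng G (snd z (p, q)) = snd z (p, p)" "src G (snd z (p, q)) = snd z (q, q)" by (fact d)+
      show "rng G (snd z (p, q)) \<notin> H" "src G (snd z (p, q)) \<notin> H"
        unfolding d(3,4) by (fact nH[OF le_enat_trans[OF pq]] nH[OF pq(2)])+
    qed (fact gpath_zero[OF gz] gpath_undefined[OF gz] gpath_comp[OF gz])+
    \<comment> \<open>Removing vertices can only remove edges, so the boundary condition is
      inherited.\<close>
    moreover have "R.terminal z"
      using bpathsD(2)[OF z] unfolding R.terminal_def terminal_def R.emits_def emits_def by auto
    ultimately show ?thesis ..
  qed
  have Rc: "R.is_concat = is_concat" by (simp add: fun_eq_iff R.is_concat_def is_concat_def)
  obtain y where y: "y \<in> bpaths" "is_concat l x y" using concat_ex[OF x(1) l(1)] x(2) by auto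
  note Ry = R[OF y]
  have yv: "bp_range y = v" using is_concat_rng(1)[OF y] l by simp
  show "condB_vertex ?G v"
    unfolding condB_vertex_def
  proof (intro exI[of _ y] conjI ballI impI; (elim conjE)?)
    show "boundary_path ?G y" using Ry R.boundary_path_iff by blast
    show "bp_range y = v" by (rule yv)
    \<comment> \<open>Concatenation in the subgraph gives the same path as in the whole graph, where
      a y is (a l) x and the aperiodicity of x applies.\<close>
    have ext: "bp_concat ?G a y \<in> bpaths" "is_concat (cmp G a l) x (bp_concat ?G a y)"
      if a: "a \<in> paths ?G" "src ?G a = v" for a
    proof -
      have ap: "a \<in> paths G" and s: "src G a = rng G l" using a l by simp_all
      obtain z where z: "z \<in> bpaths" "is_concat a y z" using concat_ex[OF y(1) ap] s yv l by auto
      have c: "is_concat (cmp G a l) x z"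
        by (rule is_concat_assoc[OF bpathsD(1)[OF z(1)] y(2) z(2) ap l(1) s])
      have "bp_concat ?G a y = z"
        by (rule R.bp_concat_eqI) (use Ry R[OF z(1) c] z(2) Rc in simp_all)
      then show "bp_concat ?G a y \<in> bpaths" "is_concat (cmp G a l) x (bp_concat ?G a y)"
        using z(1) c by simp_all
    qed
    fix a b assume a: "a \<in> paths ?G" "src ?G a = v" and b: "b \<in> paths ?G" "src ?G b = v" and ab: "a \<noteq> b"
    have ab': "a \<in> paths G" "src G a = rng G l" "b \<in> paths G" "src G b = rng G l" using a b l by simp_all
    show "bp_concat ?G a y \<noteq> bp_concat ?G b y"
    proof
      assume e: "bp_concat ?G a y = bp_concat ?G b y"
      note z = ext(1,2)[OF a] ext(2)[OF b, folded e]
      have "cmp G a l = cmp G b l"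
        using ap[OF path_cmp(1)[OF ab'(1) l(1) ab'(2)] path_cmp(1)[OF ab'(3) l(1) ab'(4)] z] .
      then show False using cmp_right_cancel[OF ab'(1,3) l(1) ab'(2,4)] ab by simp
    qed
  qed
qed

theorem mainTheorem8:
  fixes G :: "'p kgraph"
    and J :: "('p kpgen list \<Rightarrow> 'r::comm_ring_1) set set"
  assumes "is_kgraph G" and "row_finite G" and "locally_convex G" and "condB G"
    and "kp_ideal G J" and "regular_ideal G J" and "basic_ideal G J" and "graded_ideal G J"
  shows "condB (remove_verts G (H_of G J))"
proof -
  interpret lc_kgraph G by unfold_locales fact+
  show ?thesis
    using condB_remove_verts[OF assms(4)] H_of_hereditary[OF assms(5)] reaches_off_H[OF assms(5,6,4)] by blast
qed

end
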